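(* Let $X_N$ be a GUE random matrix, i.e. a complex Wigner matrix whose off-diagonal entries are complex Gaussian (so $\beta_2=1$ and $\beta_n=0$ for $n\ne2$). Then for any $r\ge1$ and any $m_1,\dots,m_r\in\mathbb N$, $$\lim_{N\to\infty}N^{r-2}k_r(\mathrm{Tr}(X_N^{m_1}),\dots,\mathrm{Tr}(X_N^{m_r}))=|NC_2(m_1,\dots,m_r)|.$$
   Context: $k_n$ denotes the classical (joint) cumulant of $n$ random variables and $\mathrm{Tr}$ the unnormalized trace. A complex random variable $x$ is $R$-diagonal if all its joint classical cumulants in $x,\overline x$ vanish except $\beta_{2n}:=k_{2n}(x,\overline x,\dots,x,\overline x)$ ($n$ copies of each, $n\geq1$); $(\beta_n)_n$ is its cumulant sequence. A complex Wigner matrix is a self-adjoint $N\times N$ random matrix $X_N=\frac1{\sqrt N}(x_{i,j})$ with $x_{i,j}=\overline{x_{j,i}}$, $E(x_{i,j})=0$, $\{x_{i,j}\}_{i<j}\cup\{x_{i,i}\}_i$ independent, the $x_{i,j}$ ($i<j$) identically distributed and $R$-diagonal with cumulant sequence $(\beta_n)_n$, and the $x_{i,i}$ identically distributed $N(0,\beta_2)$. With $m=\sum m_i$, let $\gamma\in S_m$ be the permutation with cycles $(1,\dots,m_1)\cdots(m_1+\cdots+m_{r-1}+1,\dots,m)$. $NC_2(m_1,\dots,m_r)$ is the set of permutations $\pi\in S_m$ all of whose cycles have exactly 2 elements such that $\pi\vee\gamma=1_m$ (i.e. the subgroup generated by $\pi$ and $\gamma$ acts transitively on $\{1,\dots,m\}$)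 and $\#(\pi)+\#(\gamma)+\#(\pi^{-1}\gamma)=m+2$, where $\#$ is the number of cycles. *)

theory Defs
  imports
    "HOL-Probability.Probability"
    "HOL-Combinatorics.Combinatorics"
    "HOL-Algebra.Sym_Groups"
    "Jordan_Normal_Form.Matrix"
begin

text \<open>Joint classical cumulant of the listed random variables: the moment-cumulant formula
  inverted over the lattice of partitions of the positions.\<close>
definition cumulant :: "'a measure \<Rightarrow> ('a \<Rightarrow> complex) list \<Rightarrow> complex" where
  "cumulant M Xs = (\<Sum>P | partition_on {..<length Xs} P.
     (- 1) ^ (card P - 1) * fact (card P - 1) *
     (\<Prod>B\<in>P. integral\<^sup>L M (\<lambda>\<omega>. \<Prod>i\<in>B. (Xs ! i) \<omega>)))"

definition conj_rv :: "('a \<Rightarrow> complex) \<Rightarrow> 'a \<Rightarrow> complex" where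
  "conj_rv x = (\<lambda>\<omega>. cnj (x \<omega>))"

text \<open>Classical cumulants are symmetric in their arguments, so a cumulant in \<open>x\<close> and its conjugate
  is one of \<open>k\<^sub>2\<^sub>n(x, conj x, \<dots>, x, conj x)\<close> exactly when the two letters occur equally often. The
  letters are given by a boolean word, so that real \<open>x\<close> causes no ambiguity.\<close>
definition R_diagonal :: "'a measure \<Rightarrow> ('a \<Rightarrow> complex) \<Rightarrow> bool" where
  "R_diagonal M x \<longleftrightarrow>
     x \<in> borel_measurable M \<and>
     (\<forall>n. integrable M (\<lambda>\<omega>. cmod (x \<omega>) ^ n)) \<and>
     (\<forall>w::bool list. w \<noteq> [] \<longrightarrow> count_list w True \<noteq> count_list w False \<longrightarrow>
        cumulant M (map (\<lambda>b. if b then x else conj_rv x) w) = 0)"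

text \<open>The values are real by symmetry of the cumulant; the entries of \<open>\<beta>\<close> at odd indices and at
  \<open>0\<close> carry no information.\<close>
definition cumulant_sequence :: "'a measure \<Rightarrow> ('a \<Rightarrow> complex) \<Rightarrow> (nat \<Rightarrow> real) \<Rightarrow> bool" where
  "cumulant_sequence M x \<beta> \<longleftrightarrow>
     (\<forall>n\<ge>1. cumulant M (concat (replicate n [x, conj_rv x])) = complex_of_real (\<beta> (2 * n)))"

text \<open>\<open>normal_density\<close> takes a standard deviation, here the second parameter is the variance.\<close>
definition normal_law :: "real \<Rightarrow> real \<Rightarrow> real measure" where
  "normal_law \<mu> v =
     (if v = 0 then return borel \<mu> else density lborel (normal_density \<mu> (sqrt v)))"

definition std_complex_gaussian :: "'a measure \<Rightarrow> ('a \<Rightarrow> complex) \<Rightarrow> bool" where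
  "std_complex_gaussian M x \<longleftrightarrow>
     distributed M lborel x (\<lambda>z. ennreal (exp (- (cmod z)\<^sup>2) / pi))"

definition complex_wigner ::
    "'a measure \<Rightarrow> nat \<Rightarrow> (nat \<Rightarrow> real) \<Rightarrow> (nat \<Rightarrow> nat \<Rightarrow> 'a \<Rightarrow> complex) \<Rightarrow> ('a \<Rightarrow> complex mat) \<Rightarrow> bool"
  where
  "complex_wigner M N \<beta> x X \<longleftrightarrow>
     (\<forall>\<omega>\<in>space M. X \<omega> = mat N N (\<lambda>(i, j). x i j \<omega> / complex_of_real (sqrt (real N)))) \<and>
     (\<forall>i<N. \<forall>j<N. \<forall>\<omega>\<in>space M. x i j \<omega> = cnj (x j i \<omega>)) \<and>
     (\<forall>i<N. \<forall>j<N. integrable M (x i j) \<and> integral\<^sup>L M (x i j) = 0) \<and>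
     prob_space.indep_vars M (\<lambda>_. borel) (\<lambda>(i, j). x i j) {(i, j). i \<le> j \<and> j < N} \<and>
     (\<forall>i j k l. i < j \<and> j < N \<and> k < l \<and> l < N \<longrightarrow>
        distr M borel (x i j) = distr M borel (x k l)) \<and>
     (\<forall>i j. i < j \<and> j < N \<longrightarrow> R_diagonal M (x i j) \<and> cumulant_sequence M (x i j) \<beta>) \<and>
     (\<forall>i<N. distr M borel (\<lambda>\<omega>. Re (x i i \<omega>)) = normal_law 0 (\<beta> 2))"

definition GUE :: "'a measure \<Rightarrow> nat \<Rightarrow> ('a \<Rightarrow> complex mat) \<Rightarrow> bool" where
  "GUE M N X \<longleftrightarrow>
     (\<exists>x. complex_wigner M N (\<lambda>n. if n = 2 then 1 else 0) x X \<and>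
        (\<forall>i j. i < j \<and> j < N \<longrightarrow> std_complex_gaussian M (x i j)))"

definition Tr :: "complex mat \<Rightarrow> complex" where
  "Tr A = (\<Sum>i<dim_row A. A $$ (i, i))"

fun consecutive_cycles :: "nat \<Rightarrow> nat list \<Rightarrow> nat \<Rightarrow> nat" where
  "consecutive_cycles s [] = id"
| "consecutive_cycles s (m # ms) = cycle_of_list [s + 1..<s + m + 1] \<circ> consecutive_cycles (s + m) ms"

definition gamma_perm :: "nat list \<Rightarrow> nat \<Rightarrow> nat" where
  "gamma_perm ms = consecutive_cycles 0 ms"

text \<open>Fixed points in \<open>{1..m}\<close> count as cycles.\<close>
definition num_cycles :: "nat \<Rightarrow> (nat \<Rightarrow> nat) \<Rightarrow> nat" where
  "num_cycles m \<pi> = card (orbit \<pi> ` {1..m})"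

definition transitive_pair :: "nat \<Rightarrow> (nat \<Rightarrow> nat) \<Rightarrow> (nat \<Rightarrow> nat) \<Rightarrow> bool" where
  "transitive_pair m \<pi> \<gamma> \<longleftrightarrow>
     (\<forall>i\<in>{1..m}. \<forall>j\<in>{1..m}. \<exists>\<sigma>\<in>generate (sym_group m) {\<pi>, \<gamma>}. \<sigma> i = j)"

definition NC2 :: "nat list \<Rightarrow> (nat \<Rightarrow> nat) set" where
  "NC2 ms = (let m = sum_list ms; \<gamma> = gamma_perm ms in
     {\<pi>. \<pi> permutes {1..m} \<and>
          (\<forall>i\<in>{1..m}. card (orbit \<pi> i) = 2) \<and>
          transitive_pair m \<pi> \<gamma> \<and>
          num_cycles m \<pi> + num_cycles m \<gamma> + num_cycles m (inv_into UNIV \<pi> \<circ> \<gamma>) = m + 2})"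

end

theory Submission
  imports Defs "HOL-Library.Z2" "HOL-Library.Function_Algebras"
begin

text \<open>
  By Wick's formula a mixed moment of traces is \<open>N\<close> to the power \<open>- m / 2\<close> times the sum of
  \<open>N\<close> to the number of cycles of \<open>\<pi> \<circ> \<gamma>\<close> over all pairings \<open>\<pi>\<close> of \<open>{1..m}\<close>. A product of moments
  over the blocks of a partition only sees the pairings that respect the partition, so the Moebius
  weights in the cumulant cancel all pairings except those for which \<open>\<pi>\<close> and \<open>\<gamma>\<close> generate a
  transitive group. For these the genus inequality bounds the power of \<open>N\<close>, and equality holds exactly
  for the elements of \<open>NC\<^sub>2\<close>.

  Wick's formula is obtained from Gaussian integration by parts, which for a standard complex Gaussian
  reads \<open>E (z ^ (m + 1) * w ^ n) = n * E (z ^ m * w ^ (n - 1))\<close> with \<open>w\<close> the conjugate of \<open>z\<close>.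
  The genus inequality is proved by counting functions with values in the field with two elements: the
  functions \<open>f\<close> with \<open>f \<circ> \<pi> = f \<circ> \<gamma>\<close> are mapped by \<open>f \<mapsto> f \<circ> \<pi> - f\<close> into the intersection of the
  images of the two coboundary maps of \<open>\<pi>\<close> and \<open>\<gamma>\<close>.
\<close>

section \<open>Gaussian integration by parts\<close>

text \<open>Everything is exact for fixed N. A transitive pairing \<pi> contributes N to the power c
  - m/2, where c counts the cycles of \<pi> \<circ> \<gamma>. Since m/2 is the number of cycles of
  \<pi>, the prefactor with power r - 2 leaves the exponent -(m + 2 - #\<pi> - r - c), so the limit
  is that of a finite sum of powers of 1/N, without error term. Cycles appear as free indices: two
  entries have covariance 1 exactly when their index pairs are swaps of each other, which forces
  index functions to be constant along \<gamma> \<circ> \<pi>. The obstacle in Wick's formula is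
  that an entry and its mirror image are dependent; independence holds only between unordered index
  pairs. The one-variable identity is therefore lifted to a recursion removing one pair of positions
  at a time, which is also the recursion that counts pairings. In the genus inequality the
  two-element field removes signs and lets cardinalities replace dimensions. The 2 in m + 2 stands
  for two losses of a factor 2: the constant functions are killed by coboundary maps, and functions
  of odd support are not sums of coboundaries.\<close>

lemma Complex_measurable [measurable]:
  "(\<lambda>(x, y). Complex x y) \<in> borel_measurable (borel \<Otimes>\<^sub>M borel)"
proof -
  have "(\<lambda>(x, y). Complex x y) = (\<lambda>p. complex_of_real (fst p) + \<i> * complex_of_real (snd p))"
    by (auto simp: fun_eq_iff complex_eq_iff)
  then show ?thesis by simp
qed

text \<open>Both measures agree on boxes, which determine Lebesgue measure. The product form lets
  the density of the complex Gaussian be split into two real densities and makes Fubini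
  available.\<close>

lemma lborel_complex_eq:
  "(lborel :: complex measure) = distr (lborel \<Otimes>\<^sub>M lborel) borel (\<lambda>(x, y). Complex x y)"
proof (rule lborel_eqI)
  have [measurable]: "(\<lambda>(x, y). Complex x y) \<in> borel_measurable (lborel \<Otimes>\<^sub>M lborel)"
    using Complex_measurable by (simp cong: measurable_cong_sets)
  fix l u :: complex
  assume "\<And>b. b \<in> Basis \<Longrightarrow> l \<bullet> b \<le> u \<bullet> b"
  from this[of 1] this[of \<i>] have le: "Re l \<le> Re u" "Im l \<le> Im u"
    by (auto simp: Basis_complex_def)
  have "(\<lambda>(x, y). Complex x y) -` box l u \<inter> space (lborel \<Otimes>\<^sub>M lborel)
      = box (Re l) (Re u) \<times> box (Im l) (Im u)"
    by (auto simp: box_def Basis_complex_def space_pair_measure)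
  then have "emeasure (distr (lborel \<Otimes>\<^sub>M lborel) borel (\<lambda>(x, y). Complex x y)) (box l u)
      = emeasure (lborel \<Otimes>\<^sub>M lborel) (box (Re l) (Re u) \<times> box (Im l) (Im u))"
    by (subst emeasure_distr) auto
  also have "\<dots> = ennreal ((Re u - Re l) * (Im u - Im l))"
    using le by (simp add: lborel.emeasure_pair_measure_Times ennreal_mult)
  also have "(Re u - Re l) * (Im u - Im l) = (\<Prod>b\<in>Basis. (u - l) \<bullet> b)"
    by (simp add: Basis_complex_def)
  finally show "emeasure (distr (lborel \<Otimes>\<^sub>M lborel) borel (\<lambda>(x, y). Complex x y)) (box l u)
    = ennreal (\<Prod>b\<in>Basis. (u - l) \<bullet> b)" .
qed simp

lemma pderiv_sum_finite: "finite A \<Longrightarrow> pderiv (\<Sum>i\<in>A. f i) = (\<Sum>i\<in>A. pderiv (f i))"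
  by (induction A rule: finite_induct) (auto simp: pderiv_add)

text \<open>The parameter is a standard deviation, as in \<open>normal_density\<close>: diagonal
  entries have \<sigma> = 1, while real and imaginary parts of a standard complex Gaussian have
  \<sigma> = \<open>sqrt (1/2)\<close>.\<close>

definition gauss :: "real \<Rightarrow> real measure" where
  "gauss \<sigma> = density lborel (normal_density 0 \<sigma>)"

context
  fixes \<sigma> :: real
  assumes \<sigma>: "\<sigma> > 0"
begin

lemma prob_space_gauss: "prob_space (gauss \<sigma>)"
  unfolding gauss_def using \<sigma> by (rule prob_space_normal_density)

lemma sets_gauss [simp, measurable_cong]: "sets (gauss \<sigma>) = sets borel"
  by (simp add: gauss_def)

lemma integrable_gauss_power: "integrable (gauss \<sigma>) (\<lambda>x. x ^ n)"
  using integrable_normal_moment[OF \<sigma>, of 0 n]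
  by (simp add: gauss_def integrable_density normal_density_nonneg)

lemma integral_gauss_power:
  "integral\<^sup>L (gauss \<sigma>) (\<lambda>x. x ^ n) = (\<integral>x. normal_density 0 \<sigma> x * x ^ n \<partial>lborel)"
  by (simp add: gauss_def integral_density normal_density_nonneg)

text \<open>Integration by parts for monomials, read off the explicit moments: odd moments vanish,
  and consecutive even moments have ratio \<open>\<sigma>\<^sup>2 * (2 * k + 1)\<close>. At
  \<open>n = 0\<close> the truncated \<open>n - 1\<close> is multiplied by zero.\<close>

lemma integral_gauss_power_Suc:
  "integral\<^sup>L (gauss \<sigma>) (\<lambda>x. x ^ Suc n) = \<sigma>\<^sup>2 * (real n * integral\<^sup>L (gauss \<sigma>) (\<lambda>x. x ^ (n - 1)))"
proof (cases "even n")
  case True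
  then obtain k where k: "n = 2 * k" by (elim evenE)
  have odd: "integral\<^sup>L (gauss \<sigma>) (\<lambda>x. x ^ (2 * j + 1)) = 0" for j
    using integral_normal_moment_odd[OF \<sigma>, of 0 j] by (simp only: integral_gauss_power diff_zero)
  show ?thesis
  proof (cases k)
    case 0 then show ?thesis using odd[of 0] k by simp
  next
    case (Suc j) then show ?thesis using odd[of k] odd[of j] k by simp
  qed
next
  case False
  then obtain k where k: "n = 2 * k + 1" by (elim oddE)
  have even: "integral\<^sup>L (gauss \<sigma>) (\<lambda>x. x ^ (2 * j)) = fact (2 * j) / ((2 / \<sigma>\<^sup>2) ^ j * fact j)" for j
    using integral_normal_moment_even[OF \<sigma>, of 0 j] by (simp add: integral_gauss_power)
  \<comment> \<open>\<open>D\<close> is the denominator of the moment of order \<open>2 * k\<close>;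
    the next denominator is a multiple of it, so only the ratio remains to be computed.\<close>
  define D where "D = (2 / \<sigma>\<^sup>2) ^ k * fact k"
  have "D \<noteq> 0" using \<sigma> by (simp add: D_def)
  have "fact (2 * Suc k) = (2 * (real k + 1)) * (real (2 * k + 1) * fact (2 * k))"
    by (simp add: algebra_simps)
  moreover have "(2 / \<sigma>\<^sup>2) ^ Suc k * fact (Suc k) = (2 / \<sigma>\<^sup>2) * (real k + 1) * D"
    by (simp add: D_def algebra_simps)
  moreover have "(2 * (real k + 1)) * X / ((2 / \<sigma>\<^sup>2) * (real k + 1) * D) = \<sigma>\<^sup>2 * (X / D)" for X
    using \<sigma> \<open>D \<noteq> 0\<close> by (simp add: divide_simps)
  ultimately have "fact (2 * Suc k) / ((2 / \<sigma>\<^sup>2) ^ Suc k * fact (Suc k))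
    = \<sigma>\<^sup>2 * ((real (2 * k + 1) * fact (2 * k)) / D)"
    by (simp only:)
  then show ?thesis using even[of "Suc k"] even[of k] by (simp add: k D_def)
qed

lemma integrable_gauss_poly:
  fixes p :: "complex poly"
  shows "integrable (gauss \<sigma>) (\<lambda>x. poly p (of_real x))"
  unfolding poly_altdef
  by (intro Bochner_Integration.integrable_sum integrable_mult_right)
     (simp flip: of_real_power add: integrable_gauss_power)

text \<open>Both sides are linear in \<open>p\<close>, so monomials suffice. Polynomials are used
  because \<open>pderiv\<close> supplies the product rule needed for mixed powers.\<close>

lemma integral_gauss_poly_Stein:
  fixes p :: "complex poly"
  shows "(\<integral>x. of_real x * poly p (of_real x) \<partial>gauss \<sigma>)
    = of_real (\<sigma>\<^sup>2) * (\<integral>x. poly (pderiv p) (of_real x) \<partial>gauss \<sigma>)"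
proof -
  have monom: "(\<integral>x. of_real x * poly (monom c n) (of_real x) \<partial>gauss \<sigma>)
    = of_real (\<sigma>\<^sup>2) * (\<integral>x. poly (pderiv (monom c n)) (of_real x) \<partial>gauss \<sigma>)" for c :: complex and n
  proof -
    have "(\<integral>x. of_real x * poly (monom c n) (of_real x) \<partial>gauss \<sigma>)
        = (\<integral>x. c * of_real (x ^ Suc n) \<partial>gauss \<sigma>)"
      by (intro Bochner_Integration.integral_cong) (auto simp: poly_monom mult_ac)
    also have "\<dots> = c * of_real (integral\<^sup>L (gauss \<sigma>) (\<lambda>x. x ^ Suc n))"
      by (simp only: integral_mult_right_zero integral_complex_of_real)
    also have "\<dots> = of_real (\<sigma>\<^sup>2) * ((of_nat n * c) * of_real (integral\<^sup>L (gauss \<sigma>) (\<lambda>x. x ^ (n - 1))))"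
      by (subst integral_gauss_power_Suc) simp
    also have "\<dots> = of_real (\<sigma>\<^sup>2) * (\<integral>x. (of_nat n * c) * of_real (x ^ (n - 1)) \<partial>gauss \<sigma>)"
      by (simp only: integral_mult_right_zero integral_complex_of_real)
    also have "\<dots> = of_real (\<sigma>\<^sup>2) * (\<integral>x. poly (pderiv (monom c n)) (of_real x) \<partial>gauss \<sigma>)"
      by (simp add: poly_monom pderiv_monom)
    finally show ?thesis .
  qed
  define q where "q i = monom (coeff p i) i" for i
  have p: "p = (\<Sum>i\<le>degree p. q i)"
    by (simp add: q_def poly_as_sum_of_monoms)
  have pderiv_p: "pderiv p = (\<Sum>i\<le>degree p. pderiv (q i))"
    using arg_cong[OF p, of pderiv] by (simp add: pderiv_sum_finite)
  have *: "integrable (gauss \<sigma>) (\<lambda>x. of_real x * poly r (of_real x))" for r :: "complex poly"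
    using integrable_gauss_poly[of "[:0, 1:] * r"] by simp
  have "(\<integral>x. of_real x * poly p (of_real x) \<partial>gauss \<sigma>)
      = (\<Sum>i\<le>degree p. \<integral>x. of_real x * poly (q i) (of_real x) \<partial>gauss \<sigma>)"
    by (subst p, subst Bochner_Integration.integral_sum[symmetric])
       (auto simp: poly_sum sum_distrib_left *)
  also have "\<dots> = of_real (\<sigma>\<^sup>2) * (\<Sum>i\<le>degree p. \<integral>x. poly (pderiv (q i)) (of_real x) \<partial>gauss \<sigma>)"
    by (simp add: q_def monom sum_distrib_left)
  also have "(\<Sum>i\<le>degree p. \<integral>x. poly (pderiv (q i)) (of_real x) \<partial>gauss \<sigma>)
      = (\<integral>x. poly (pderiv p) (of_real x) \<partial>gauss \<sigma>)"
    by (subst Bochner_Integration.integral_sum[symmetric])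
       (simp_all add: integrable_gauss_poly pderiv_p poly_sum)
  finally show ?thesis .
qed

text \<open>The truncated exponents are harmless because of the factors \<open>m\<close> and \<open>n\<close>.\<close>

lemma integral_gauss_power_power:
  fixes a b c d :: complex
  shows "(\<integral>x. of_real x * ((a + of_real x * b) ^ m * (c + of_real x * d) ^ n) \<partial>gauss \<sigma>)
    = of_real (\<sigma>\<^sup>2) * (\<integral>x. of_nat m * b * (a + of_real x * b) ^ (m - 1) * (c + of_real x * d) ^ n
        + of_nat n * d * (a + of_real x * b) ^ m * (c + of_real x * d) ^ (n - 1) \<partial>gauss \<sigma>)"
proof -
  have pd: "pderiv ([:a, b:] ^ m) = Polynomial.smult (of_nat m * b) ([:a, b:] ^ (m - 1))" for a b :: complex and m
    by (simp add: pderiv_power pderiv_pCons mult_ac)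
  show ?thesis
    using integral_gauss_poly_Stein[of "[:a, b:] ^ m * [:c, d:] ^ n"]
    by (simp add: pderiv_mult pd algebra_simps)
qed

end

section \<open>From real Gaussians to the complex Gaussian\<close>

lemma cnj_measurable [measurable]: "cnj \<in> borel_measurable borel"
  by (intro borel_measurable_continuous_onI continuous_intros)

text \<open>The squared modulus is the sum of the squares of the coordinates, so the density is a
  product of two normal densities of variance 1/2.\<close>

lemma distr_std_complex_gaussian:
  assumes "std_complex_gaussian M z"
  shows "distr M borel z = distr (gauss (sqrt (1/2)) \<Otimes>\<^sub>M gauss (sqrt (1/2))) borel (\<lambda>(x, y). Complex x y)"
proof -
  let ?f = "\<lambda>z. ennreal (exp (- (cmod z)\<^sup>2) / pi)"
  have [measurable]: "(\<lambda>(x, y). Complex x y) \<in> borel_measurable (lborel \<Otimes>\<^sub>M lborel)"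
    using Complex_measurable by (simp cong: measurable_cong_sets)
  have f: "?f (Complex x y) = ennreal (normal_density 0 (sqrt (1/2)) x) * ennreal (normal_density 0 (sqrt (1/2)) y)"
    for x y
    by (simp add: normal_density_def cmod_def ennreal_mult[symmetric] exp_add[symmetric])
  have "distr M borel z = distr M lborel z"
    by (simp cong: distr_cong)
  also have "\<dots> = density (lborel :: complex measure) ?f"
    using assms by (simp add: std_complex_gaussian_def distributed_def)
  also have "\<dots> = density (distr (lborel \<Otimes>\<^sub>M lborel) borel (\<lambda>(x, y). Complex x y)) ?f"
    by (subst lborel_complex_eq) simp
  also have "\<dots> = distr (density (lborel \<Otimes>\<^sub>M lborel) (\<lambda>p. ?f (case p of (x, y) \<Rightarrow> Complex x y)))
      borel (\<lambda>(x, y). Complex x y)"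
    by (rule density_distr) simp_all
  also have "density (lborel \<Otimes>\<^sub>M lborel) (\<lambda>p. ?f (case p of (x, y) \<Rightarrow> Complex x y))
      = density (lborel \<Otimes>\<^sub>M lborel) (\<lambda>(x, y). ennreal (normal_density 0 (sqrt (1/2)) x) * ennreal (normal_density 0 (sqrt (1/2)) y))"
    by (intro density_cong) (auto simp: f split: prod.splits)
  also have "\<dots> = gauss (sqrt (1/2)) \<Otimes>\<^sub>M gauss (sqrt (1/2))"
    unfolding gauss_def
    by (rule pair_measure_density[symmetric])
       (auto intro!: prob_space_imp_sigma_finite prob_space_normal_density
         simp: sigma_finite_lborel)
  finally show ?thesis .
qed

text \<open>Stein's identity in each real coordinate gives E(x g) = E(dg/dx) / 2 and E(y g) =
  E(dg/dy) / 2. Hence multiplication by z = x + i y acts under the expectation as the Wirtinger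
  derivative in the conjugate variable, which sends \<open>z ^ m * cnj z ^ n\<close> to
  \<open>n * z ^ m * cnj z ^ (n - 1)\<close>.\<close>

lemma std_complex_gaussian_moment:
  assumes "prob_space M" and z: "std_complex_gaussian M z"
    and int: "\<And>n. integrable M (\<lambda>\<omega>. cmod (z \<omega>) ^ n)"
  shows "integrable M (\<lambda>\<omega>. z \<omega> ^ m * cnj (z \<omega>) ^ n)" (is ?I)
    and "(\<integral>\<omega>. z \<omega> ^ Suc m * cnj (z \<omega>) ^ n \<partial>M) = of_nat n * (\<integral>\<omega>. z \<omega> ^ m * cnj (z \<omega>) ^ (n - 1) \<partial>M)"
proof -
  interpret prob_space M by fact
  let ?s = "sqrt (1/2)" let ?G = "gauss ?s" let ?C = "\<lambda>(x, y). Complex x y"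
  have s: "?s > 0" by simp
  interpret G: prob_space ?G by (rule prob_space_gauss[OF s])
  interpret GG: pair_prob_space ?G ?G ..
  have [measurable_cong]: "sets ?G = sets borel" by (simp add: gauss_def)
  have zm [measurable]: "z \<in> borel_measurable M"
    using z by (auto simp: std_complex_gaussian_def distributed_def)
  have [measurable]: "?C \<in> borel_measurable (?G \<Otimes>\<^sub>M ?G)"
    by measurable
  have Iz: "integrable M (\<lambda>\<omega>. z \<omega> ^ m * cnj (z \<omega>) ^ n)" for m n
    by (rule Bochner_Integration.integrable_bound[OF int[of "m + n"]])
       (auto simp: norm_mult norm_power power_add)
  show ?I by (rule Iz)
  have int_G: "integrable (?G \<Otimes>\<^sub>M ?G) (\<lambda>(x, y). Complex x y ^ m * cnj (Complex x y) ^ n)" for m n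
    using Iz[of m n] integrable_distr_eq[of z M borel "\<lambda>w. w ^ m * cnj w ^ n"]
      integrable_distr_eq[of ?C "?G \<Otimes>\<^sub>M ?G" borel "\<lambda>w. w ^ m * cnj w ^ n"]
    by (simp add: distr_std_complex_gaussian[OF z] split_def)
  have E: "(\<integral>\<omega>. f (z \<omega>) \<partial>M) = (\<integral>p. f (Complex (fst p) (snd p)) \<partial>(?G \<Otimes>\<^sub>M ?G))"
    if [measurable]: "f \<in> borel_measurable borel" for f :: "complex \<Rightarrow> complex"
    using integral_distr[of z M borel f] integral_distr[of ?C "?G \<Otimes>\<^sub>M ?G" borel f]
    by (simp add: distr_std_complex_gaussian[OF z] split_def)
  let ?g = "\<lambda>m n x y. Complex x y ^ m * cnj (Complex x y) ^ n"
  let ?J = "\<lambda>m n. \<integral>p. ?g m n (fst p) (snd p) \<partial>(?G \<Otimes>\<^sub>M ?G)"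
  have IJ: "integrable (?G \<Otimes>\<^sub>M ?G) (\<lambda>p. ?g m n (fst p) (snd p))" for m n
    using int_G[of m n] by (simp add: split_def)
  \<comment> \<open>Real and imaginary parts are written through z and its conjugate, so that
    integrability of products with them reduces to that of mixed monomials.\<close>
  have re: "complex_of_real x = (Complex x y + cnj (Complex x y)) / 2"
    and im: "complex_of_real y = \<i> * (cnj (Complex x y) - Complex x y) / 2" for x y
    by (auto simp: complex_eq_iff)
  have Ire: "integrable (?G \<Otimes>\<^sub>M ?G) (\<lambda>p. complex_of_real (fst p) * ?g m n (fst p) (snd p))"
  proof -
    have "complex_of_real x * ?g m n x y = (?g (Suc m) n x y + ?g m (Suc n) x y) / 2" for x y
      by (subst re[of x y]) (simp add: algebra_simps)
    then show ?thesis by (simp only:) (intro integrable_divide_zero Bochner_Integration.integrable_add IJ)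
  qed
  have Iim: "integrable (?G \<Otimes>\<^sub>M ?G) (\<lambda>p. complex_of_real (snd p) * ?g m n (fst p) (snd p))"
  proof -
    have "complex_of_real y * ?g m n x y = \<i> * (?g m (Suc n) x y - ?g (Suc m) n x y) / 2" for x y
      by (subst im[of y x]) (simp add: algebra_simps)
    then show ?thesis
      by (simp only:) (intro integrable_divide_zero integrable_mult_right Bochner_Integration.integrable_diff IJ)
  qed
  \<comment> \<open>The partial derivatives of \<open>?g m n\<close>: z has derivatives 1 and
    \<open>\<i>\<close>, its conjugate 1 and \<open>- \<i>\<close>.\<close>
  let ?dx = "\<lambda>x y. of_nat m * ?g (m - 1) n x y + of_nat n * ?g m (n - 1) x y"
  let ?dy = "\<lambda>x y. of_nat m * \<i> * ?g (m - 1) n x y - of_nat n * \<i> * ?g m (n - 1) x y"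
  have Idx: "integrable (?G \<Otimes>\<^sub>M ?G) (\<lambda>p. ?dx (fst p) (snd p))"
    by (intro integrable_mult_right Bochner_Integration.integrable_add IJ)
  have Idy: "integrable (?G \<Otimes>\<^sub>M ?G) (\<lambda>p. ?dy (fst p) (snd p))"
    by (intro integrable_mult_right Bochner_Integration.integrable_diff IJ)
  have s2: "complex_of_real (?s\<^sup>2) = 1 / 2" by simp
  \<comment> \<open>Fubini in either order: an identity of one-variable integrals, valid for every
    fixed value of the other variable, carries over to the product measure.\<close>
  have swap: "(\<integral>p. f (fst p) (snd p) \<partial>(?G \<Otimes>\<^sub>M ?G)) = c * (\<integral>p. h (fst p) (snd p) \<partial>(?G \<Otimes>\<^sub>M ?G))"
    if "integrable (?G \<Otimes>\<^sub>M ?G) (\<lambda>p. f (fst p) (snd p))" "integrable (?G \<Otimes>\<^sub>M ?G) (\<lambda>p. h (fst p) (snd p))"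
      "(\<forall>y. (\<integral>x. f x y \<partial>?G) = c * (\<integral>x. h x y \<partial>?G)) \<or> (\<forall>x. (\<integral>y. f x y \<partial>?G) = c * (\<integral>y. h x y \<partial>?G))"
    for f h :: "real \<Rightarrow> real \<Rightarrow> complex" and c
    using that(3) GG.integral_snd[of f] GG.integral_snd[of h] GG.integral_fst[of f] GG.integral_fst[of h] that(1,2)
    by (auto simp: split_def)
  have Sx: "(\<integral>p. of_real (fst p) * ?g m n (fst p) (snd p) \<partial>(?G \<Otimes>\<^sub>M ?G))
      = 1 / 2 * (\<integral>p. ?dx (fst p) (snd p) \<partial>(?G \<Otimes>\<^sub>M ?G))"
  proof -
    \<comment> \<open>For fixed y both factors are affine in x, with intercepts
      \<open>\<i> * y\<close> and \<open>- \<i> * y\<close> and slope 1.\<close>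
    have "(\<integral>x. of_real x * ?g m n x y \<partial>?G) = 1 / 2 * (\<integral>x. ?dx x y \<partial>?G)" for y
      using integral_gauss_power_power[OF s, of "\<i> * of_real y" 1 m "- \<i> * of_real y" 1 n, unfolded s2]
      by (simp add: Complex_eq add.commute mult_ac)
    then show ?thesis by (intro swap[OF Ire Idx]) blast
  qed
  have Sy: "(\<integral>p. of_real (snd p) * ?g m n (fst p) (snd p) \<partial>(?G \<Otimes>\<^sub>M ?G))
      = 1 / 2 * (\<integral>p. ?dy (fst p) (snd p) \<partial>(?G \<Otimes>\<^sub>M ?G))"
  proof -
    have "(\<integral>y. of_real y * ?g m n x y \<partial>?G) = 1 / 2 * (\<integral>y. ?dy x y \<partial>?G)" for x
      using integral_gauss_power_power[OF s, of "of_real x" \<i> m "of_real x" "- \<i>" n, unfolded s2]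
      by (simp add: Complex_eq add.commute mult_ac)
    then show ?thesis by (intro swap[OF Iim Idy]) blast
  qed
  have EJ: "(\<integral>\<omega>. z \<omega> ^ m * cnj (z \<omega>) ^ n \<partial>M) = ?J m n" for m n
    by (rule E) measurable
  have "?J (Suc m) n = (\<integral>p. of_real (fst p) * ?g m n (fst p) (snd p) \<partial>(?G \<Otimes>\<^sub>M ?G))
      + \<i> * (\<integral>p. of_real (snd p) * ?g m n (fst p) (snd p) \<partial>(?G \<Otimes>\<^sub>M ?G))"
    by (subst integral_mult_right_zero[symmetric],
        subst Bochner_Integration.integral_add[symmetric, OF Ire integrable_mult_right[OF Iim]])
       (auto intro!: Bochner_Integration.integral_cong simp: Complex_eq algebra_simps)
  \<comment> \<open>In half of \<open>?dx + \<i> * ?dy\<close> the terms with factor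
    \<open>m\<close> cancel, as \<open>\<i> * \<i> = - 1\<close>, and those with factor
    \<open>n\<close> double.\<close>
  also have "\<dots> = of_nat n * ?J m (n - 1)"
    unfolding Sx Sy
    by (subst Bochner_Integration.integral_add[OF integrable_mult_right[OF IJ] integrable_mult_right[OF IJ]],
        subst Bochner_Integration.integral_diff[OF integrable_mult_right[OF IJ] integrable_mult_right[OF IJ]],
        simp only: integral_mult_right_zero)
       (simp add: algebra_simps)
  finally show "(\<integral>\<omega>. z \<omega> ^ Suc m * cnj (z \<omega>) ^ n \<partial>M) = of_nat n * (\<integral>\<omega>. z \<omega> ^ m * cnj (z \<omega>) ^ (n - 1) \<partial>M)"
    by (simp only: EJ)
qed

section \<open>Wick's formula\<close>

text \<open>The existential quantifier over the entries in \<open>GUE\<close> is opened here once,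
  for one fixed size \<open>N\<close>.\<close>

locale gue_entries = prob_space M for M :: "'a measure" +
  fixes N :: nat and x :: "nat \<Rightarrow> nat \<Rightarrow> 'a \<Rightarrow> complex" and X :: "'a \<Rightarrow> complex mat"
  assumes wigner: "complex_wigner M N (\<lambda>n. if n = 2 then 1 else 0) x X"
    and gaussian: "\<And>i j. i < j \<Longrightarrow> j < N \<Longrightarrow> std_complex_gaussian M (x i j)"
begin

text \<open>Taking the index pair as one argument makes conjugation of an entry the map
  \<open>prod.swap\<close> on its index.\<close>

definition ent :: "nat \<times> nat \<Rightarrow> 'a \<Rightarrow> complex" where
  "ent p = x (fst p) (snd p)"

lemma
  assumes "i < N" "j < N"
  shows x_swap: "\<omega> \<in> space M \<Longrightarrow> x j i \<omega> = cnj (x i j \<omega>)"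
    and x_integrable: "integrable M (x i j)"
proof -
  note w = wigner[unfolded complex_wigner_def]
  have "\<forall>i<N. \<forall>j<N. \<forall>\<omega>\<in>space M. x i j \<omega> = cnj (x j i \<omega>)"
    using w by (elim conjE)
  then show "\<omega> \<in> space M \<Longrightarrow> x j i \<omega> = cnj (x i j \<omega>)"
    using assms by blast
  have "\<forall>i<N. \<forall>j<N. integrable M (x i j) \<and> integral\<^sup>L M (x i j) = 0"
    using w by (elim conjE)
  then show "integrable M (x i j)"
    using assms by blast
qed

lemma ent_swap: "p \<in> {..<N} \<times> {..<N} \<Longrightarrow> \<omega> \<in> space M \<Longrightarrow> ent (prod.swap p) \<omega> = cnj (ent p \<omega>)"
  unfolding ent_def by (metis fst_swap snd_swap x_swap mem_Times_iff lessThan_iff)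

text \<open>Representative of the unordered index pair in the upper triangle, where independence is
  assumed. Entries of one class are equal or conjugate; distinct classes are independent.\<close>

definition entry_class :: "nat \<times> nat \<Rightarrow> nat \<times> nat" where
  "entry_class p = (min (fst p) (snd p), max (fst p) (snd p))"

lemma entry_class_eq_iff: "i \<le> j \<Longrightarrow> entry_class p = (i, j) \<longleftrightarrow> p = (i, j) \<or> p = (j, i)"
  by (cases p) (auto simp: entry_class_def min_def max_def split: if_splits)

lemma ent_measurable [measurable]:
  assumes "p \<in> {..<N} \<times> {..<N}" shows "ent p \<in> borel_measurable M"
  using assms x_integrable[of "fst p" "snd p"]
  by (auto simp: ent_def mem_Times_iff dest: borel_measurable_integrable)

text \<open>Diagonal entries are real Gaussians of variance 1, and \<open>(i, i)\<close> is its own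
  swap, so every remaining position is a possible partner of \<open>s\<close>. This is
  \<open>integral_gauss_power_Suc\<close> with its factor written as a sum over the
  partners.\<close>

lemma single_class_Wick_diag:
  assumes "i < N" "finite A" "s \<notin> A" "\<And>k. k \<in> insert s A \<Longrightarrow> e k = (i, i)"
  shows "integrable M (\<lambda>\<omega>. \<Prod>k\<in>A. ent (e k) \<omega>)"
    and "expectation (\<lambda>\<omega>. \<Prod>k\<in>insert s A. ent (e k) \<omega>)
      = (\<Sum>t | t \<in> A \<and> e t = prod.swap (e s). expectation (\<lambda>\<omega>. \<Prod>k\<in>A - {t}. ent (e k) \<omega>))"
proof -
  let ?g = "\<lambda>\<omega>. Re (x i i \<omega>)"
  have [measurable]: "x i i \<in> borel_measurable M"
    using ent_measurable[of "(i, i)"] assms by (simp add: ent_def)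
  \<comment> \<open>The cumulant sequence has the value 1 at 2, and variance 1 is the same as
    standard deviation 1.\<close>
  have d: "distr M borel ?g = gauss 1"
    using wigner assms(1) by (auto simp: complex_wigner_def normal_law_def gauss_def)
  have real: "x i i \<omega> = complex_of_real (?g \<omega>)" if "\<omega> \<in> space M" for \<omega>
    using ent_swap[of "(i, i)" \<omega>] assms(1) that by (auto simp: ent_def complex_eq_iff)
  have I: "integrable M (\<lambda>\<omega>. ?g \<omega> ^ n)" for n
    using integrable_gauss_power[of 1 n] integrable_distr_eq[of ?g M borel "\<lambda>y. y ^ n"] by (simp add: d)
  have E: "expectation (\<lambda>\<omega>. ?g \<omega> ^ n) = integral\<^sup>L (gauss 1) (\<lambda>y. y ^ n)" for n
    using integral_distr[of ?g M borel "\<lambda>y. y ^ n"] by (simp add: d)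
  have P: "(\<Prod>k\<in>B. ent (e k) \<omega>) = complex_of_real (?g \<omega> ^ card B)"
    if "B \<subseteq> insert s A" "\<omega> \<in> space M" for B \<omega>
  proof -
    have "(\<Prod>k\<in>B. ent (e k) \<omega>) = (\<Prod>k\<in>B. x i i \<omega>)"
      using that assms(4) by (intro prod.cong) (auto simp: ent_def)
    then show ?thesis using real that by simp
  qed
  have EP: "expectation (\<lambda>\<omega>. \<Prod>k\<in>B. ent (e k) \<omega>) = complex_of_real (integral\<^sup>L (gauss 1) (\<lambda>y. y ^ card B))"
    if "B \<subseteq> insert s A" for B
    using P[OF that] by (simp only: E[symmetric] integral_complex_of_real cong: Bochner_Integration.integral_cong)
  show "integrable M (\<lambda>\<omega>. \<Prod>k\<in>A. ent (e k) \<omega>)"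
    using I by (subst Bochner_Integration.integrable_cong[OF refl P]) (auto simp del: of_real_power)
  have "expectation (\<lambda>\<omega>. \<Prod>k\<in>insert s A. ent (e k) \<omega>)
      = of_nat (card A) * complex_of_real (integral\<^sup>L (gauss 1) (\<lambda>y. y ^ (card A - 1)))"
    using EP[of "insert s A"] integral_gauss_power_Suc[of 1 "card A"] assms(2,3) by simp
  also have "\<dots> = (\<Sum>t\<in>A. expectation (\<lambda>\<omega>. \<Prod>k\<in>A - {t}. ent (e k) \<omega>))"
  proof -
    have "expectation (\<lambda>\<omega>. \<Prod>k\<in>A - {t}. ent (e k) \<omega>)
        = complex_of_real (integral\<^sup>L (gauss 1) (\<lambda>y. y ^ (card A - 1)))" if "t \<in> A" for t
      using EP[of "A - {t}"] that assms(2) by (auto simp: card_Diff_singleton)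
    then show ?thesis by simp
  qed
  also have "\<dots> = (\<Sum>t | t \<in> A \<and> e t = prod.swap (e s). expectation (\<lambda>\<omega>. \<Prod>k\<in>A - {t}. ent (e k) \<omega>))"
    using assms(4) by (intro sum.cong) auto
  finally show "expectation (\<lambda>\<omega>. \<Prod>k\<in>insert s A. ent (e k) \<omega>)
      = (\<Sum>t | t \<in> A \<and> e t = prod.swap (e s). expectation (\<lambda>\<omega>. \<Prod>k\<in>A - {t}. ent (e k) \<omega>))" .
qed

text \<open>The product depends only on how many positions carry \<open>(i, j)\<close> and how many
  carry \<open>(j, i)\<close>. Integration by parts removes one position of each kind and multiplies
  by the number of available partners, which becomes the sum over \<open>t\<close>.\<close>

lemma single_class_Wick_offdiag:
  assumes "i < j" "j < N" "finite A" "s \<notin> A" "\<And>k. k \<in> insert s A \<Longrightarrow> e k = (i, j) \<or> e k = (j, i)"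
  shows "integrable M (\<lambda>\<omega>. \<Prod>k\<in>A. ent (e k) \<omega>)"
    and "expectation (\<lambda>\<omega>. \<Prod>k\<in>insert s A. ent (e k) \<omega>)
      = (\<Sum>t | t \<in> A \<and> e t = prod.swap (e s). expectation (\<lambda>\<omega>. \<Prod>k\<in>A - {t}. ent (e k) \<omega>))"
proof -
  \<comment> \<open>The boolean names the orientation, so that both orientations of \<open>s\<close>
    are treated by one computation with \<open>b\<close> and \<open>\<not> b\<close>.\<close>
  define c where "c b B = card {k\<in>B. e k = (if b then (i, j) else (j, i))}" for b B
  let ?z = "x i j"
  have "R_diagonal M ?z" using wigner assms(1,2) by (auto simp: complex_wigner_def)
  then have int: "integrable M (\<lambda>\<omega>. cmod (?z \<omega>) ^ n)" for n by (auto simp: R_diagonal_def)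
  note mom = std_complex_gaussian_moment[OF prob_space_axioms gaussian[OF assms(1,2)] int]
  define m where "m a b = expectation (\<lambda>\<omega>. ?z \<omega> ^ a * cnj (?z \<omega>) ^ b)" for a b
  have m1: "m (Suc a) b = of_nat b * m a (b - 1)" for a b
    unfolding m_def by (rule mom(2))
  \<comment> \<open>The companion identity, which removes a conjugate factor first, is the complex
    conjugate of \<open>m1\<close>.\<close>
  have m2: "m a (Suc b) = of_nat a * m (a - 1) b" for a b
  proof -
    have cnj: "m a b = cnj (m b a)" for a b
    proof -
      have "cnj (m b a) = expectation (\<lambda>\<omega>. cnj (?z \<omega> ^ b * cnj (?z \<omega>) ^ a))"
        by (simp only: m_def Bochner_Integration.integral_cnj)
      then show ?thesis by (simp add: m_def mult.commute)
    qed
    show ?thesis using m1[of b a] by (simp add: cnj[of a "Suc b"] cnj[of "a - Suc 0" b])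
  qed
  have P: "(\<Prod>k\<in>B. ent (e k) \<omega>) = ?z \<omega> ^ c True B * cnj (?z \<omega>) ^ c False B"
    if "B \<subseteq> insert s A" "\<omega> \<in> space M" for B \<omega>
  proof -
    have fin: "finite B" using that assms(3) by (auto intro: finite_subset)
    have "(\<Prod>k\<in>B. ent (e k) \<omega>) = (\<Prod>k\<in>B. if e k = (i, j) then ?z \<omega> else cnj (?z \<omega>))"
      using that assms(1,2,5) ent_swap[of "(i, j)" \<omega>]
      by (intro prod.cong refl) (fastforce simp: ent_def)
    also have "\<dots> = ?z \<omega> ^ card {k\<in>B. e k = (i, j)} * cnj (?z \<omega>) ^ card {k\<in>B. e k \<noteq> (i, j)}"
      using fin by (simp add: prod.If_cases Int_def)
    also have "{k\<in>B. e k \<noteq> (i, j)} = {k\<in>B. e k = (j, i)}"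
      using that assms(1,5) by auto
    finally show ?thesis by (simp add: c_def)
  qed
  have EP: "expectation (\<lambda>\<omega>. \<Prod>k\<in>B. ent (e k) \<omega>) = m (c True B) (c False B)"
    if "B \<subseteq> insert s A" for B
    unfolding m_def by (rule Bochner_Integration.integral_cong) (auto simp: P[OF that])
  show "integrable M (\<lambda>\<omega>. \<Prod>k\<in>A. ent (e k) \<omega>)"
    using mom(1) by (subst Bochner_Integration.integrable_cong[OF refl P]) auto
  obtain b where b: "e s = (if b then (i, j) else (j, i))"
    using assms(5)[of s] by (metis insertI1)
  have c1: "c b (insert s A) = Suc (c b A)"
  proof -
    have "{k \<in> insert s A. e k = (if b then (i, j) else (j, i))}
        = insert s {k \<in> A. e k = (if b then (i, j) else (j, i))}" using b by auto
    then show ?thesis using assms(3,4) by (simp add: c_def)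
  qed
  have c2: "c (\<not> b) (insert s A) = c (\<not> b) A"
    using b assms(1) unfolding c_def by (intro arg_cong[of _ _ card]) auto
  let ?T = "{t. t \<in> A \<and> e t = prod.swap (e s)}"
  have T: "?T = {k\<in>A. e k = (if \<not> b then (i, j) else (j, i))}" using b by auto
  \<comment> \<open>Every partner leaves the same two counts, hence all summands coincide.\<close>
  have c3: "c b (A - {t}) = c b A \<and> c (\<not> b) (A - {t}) = c (\<not> b) A - 1" if "t \<in> ?T" for t
  proof
    show "c b (A - {t}) = c b A"
      using that b assms(1) unfolding c_def by (intro arg_cong[of _ _ card]) auto
    have "{k \<in> A - {t}. e k = (if \<not> b then (i, j) else (j, i))}
        = {k \<in> A. e k = (if \<not> b then (i, j) else (j, i))} - {t}" by auto
    then show "c (\<not> b) (A - {t}) = c (\<not> b) A - 1"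
      unfolding c_def using that assms(3) unfolding T by (simp add: card_Diff_singleton)
  qed
  have "expectation (\<lambda>\<omega>. \<Prod>k\<in>insert s A. ent (e k) \<omega>)
      = of_nat (c (\<not> b) A) * (if b then m (c b A) (c (\<not> b) A - 1) else m (c (\<not> b) A - 1) (c b A))"
    using EP[of "insert s A"] c1 c2 by (cases b) (simp_all add: m1 m2)
  also have "\<dots> = (\<Sum>t\<in>?T. expectation (\<lambda>\<omega>. \<Prod>k\<in>A - {t}. ent (e k) \<omega>))"
  proof -
    have "expectation (\<lambda>\<omega>. \<Prod>k\<in>A - {t}. ent (e k) \<omega>)
        = (if b then m (c b A) (c (\<not> b) A - 1) else m (c (\<not> b) A - 1) (c b A))" if "t \<in> ?T" for t
      using EP[of "A - {t}"] c3[OF that] by (cases b) auto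
    then show ?thesis unfolding T c_def by simp
  qed
  finally show "expectation (\<lambda>\<omega>. \<Prod>k\<in>insert s A. ent (e k) \<omega>)
      = (\<Sum>t\<in>?T. expectation (\<lambda>\<omega>. \<Prod>k\<in>A - {t}. ent (e k) \<omega>))" .
qed

lemma single_class_Wick:
  assumes "i \<le> j" "j < N" "finite A" "s \<notin> A" "\<And>k. k \<in> insert s A \<Longrightarrow> entry_class (e k) = (i, j)"
  shows "integrable M (\<lambda>\<omega>. \<Prod>k\<in>A. ent (e k) \<omega>)"
    and "expectation (\<lambda>\<omega>. \<Prod>k\<in>insert s A. ent (e k) \<omega>)
      = (\<Sum>t | t \<in> A \<and> e t = prod.swap (e s). expectation (\<lambda>\<omega>. \<Prod>k\<in>A - {t}. ent (e k) \<omega>))"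
proof (atomize (full), cases "i = j")
  case True
  then have "e k = (i, i)" if "k \<in> insert s A" for k
    using assms(5)[OF that] by (simp add: entry_class_eq_iff)
  then show "integrable M (\<lambda>\<omega>. \<Prod>k\<in>A. ent (e k) \<omega>) \<and> expectation (\<lambda>\<omega>. \<Prod>k\<in>insert s A. ent (e k) \<omega>)
      = (\<Sum>t | t \<in> A \<and> e t = prod.swap (e s). expectation (\<lambda>\<omega>. \<Prod>k\<in>A - {t}. ent (e k) \<omega>))"
    using single_class_Wick_diag[of i A s e] assms True by blast
next
  case False
  then have "e k = (i, j) \<or> e k = (j, i)" if "k \<in> insert s A" for k
    using assms(1) assms(5)[OF that] by (simp add: entry_class_eq_iff)
  then show "integrable M (\<lambda>\<omega>. \<Prod>k\<in>A. ent (e k) \<omega>) \<and> expectation (\<lambda>\<omega>. \<Prod>k\<in>insert s A. ent (e k) \<omega>)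
      = (\<Sum>t | t \<in> A \<and> e t = prod.swap (e s). expectation (\<lambda>\<omega>. \<Prod>k\<in>A - {t}. ent (e k) \<omega>))"
    using single_class_Wick_offdiag[of i j A s e] assms(1-4) False by simp
qed

text \<open>Grouping by \<open>entry_class\<close> produces one factor per class. Each factor
  involves a single entry up to conjugation, so the factors are independent and the expectation
  splits.\<close>

lemma
  assumes S: "finite S" "\<And>k. k \<in> S \<Longrightarrow> e k \<in> {..<N} \<times> {..<N}"
  shows expectation_prod_entries:
      "expectation (\<lambda>\<omega>. \<Prod>k\<in>S. ent (e k) \<omega>)
        = (\<Prod>p\<in>{(i, j). i \<le> j \<and> j < N}. expectation (\<lambda>\<omega>. \<Prod>k | k \<in> S \<and> entry_class (e k) = p. ent (e k) \<omega>))"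
    and integrable_prod_entries: "integrable M (\<lambda>\<omega>. \<Prod>k\<in>S. ent (e k) \<omega>)"
proof -
  let ?I = "{(i, j). i \<le> j \<and> j < N}"
  let ?S = "\<lambda>p. {k. k \<in> S \<and> entry_class (e k) = p}"
  have fin: "finite ?I" by (rule finite_subset[of _ "{..<N} \<times> {..<N}"]) auto
  have key: "entry_class p \<in> ?I" if "p \<in> {..<N} \<times> {..<N}" for p
    using that by (auto simp: entry_class_def)
  \<comment> \<open>The contribution of a class as a function of one random variable; independence
    of the upper triangular entries then passes to these functions.\<close>
  define h where "h p z = (\<Prod>k\<in>?S p. if e k = p then z else cnj z)" for p z
  have h: "(\<Prod>k\<in>?S p. ent (e k) \<omega>) = h p (ent p \<omega>)" if "p \<in> ?I" "\<omega> \<in> space M" for p \<omega>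
    unfolding h_def
  proof (intro prod.cong refl)
    fix k assume k: "k \<in> ?S p"
    obtain i j where p: "p = (i, j)" "i \<le> j" "j < N" using \<open>p \<in> ?I\<close> by auto
    then consider "e k = p" | "e k = prod.swap p"
      using k entry_class_eq_iff[of i j "e k"] by auto
    then show "ent (e k) \<omega> = (if e k = p then ent p \<omega> else cnj (ent p \<omega>))"
    proof cases
      case 2
      then show ?thesis using ent_swap[of p \<omega>] p \<open>\<omega> \<in> space M\<close> by (cases "i = j") simp_all
    qed simp
  qed
  have prod: "(\<Prod>k\<in>S. ent (e k) \<omega>) = (\<Prod>p\<in>?I. h p (ent p \<omega>))" if "\<omega> \<in> space M" for \<omega>
    using prod.group[OF S(1) fin, of "\<lambda>k. entry_class (e k)" "\<lambda>k. ent (e k) \<omega>"] key S(2) h that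
    by (auto simp: image_subset_iff)
  have "indep_vars (\<lambda>_. borel) (\<lambda>p. ent p) ?I"
    using wigner by (simp add: complex_wigner_def ent_def split_def)
  moreover have "h p \<in> borel_measurable borel" for p
    unfolding h_def by measurable
  ultimately have ind: "indep_vars (\<lambda>_. borel) (\<lambda>p \<omega>. h p (ent p \<omega>)) ?I"
    by (intro indep_vars_compose2[where Y = h]) auto
  have int: "integrable M (\<lambda>\<omega>. h p (ent p \<omega>))" if p: "p \<in> ?I" for p
  proof -
    obtain i j where ij: "p = (i, j)" "i \<le> j" "j < N" using p by auto
    have "integrable M (\<lambda>\<omega>. \<Prod>k\<in>?S p. ent (e k) \<omega>)"
    proof (cases "?S p = {}")
      case True then show ?thesis by (simp only: prod.empty) simp
    next
      case False
      then obtain s where s: "s \<in> ?S p" by auto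
      \<comment> \<open>\<open>single_class_Wick\<close> asks for an extra position outside the
        index set. In the option type \<open>None\<close> serves as one, carrying the index
        \<open>(i, j)\<close> itself.\<close>
      define e' where "e' o' = (case o' of None \<Rightarrow> (i, j) | Some k \<Rightarrow> e k)" for o'
      have "integrable M (\<lambda>\<omega>. \<Prod>k\<in>Some ` ?S p. ent (e' k) \<omega>)"
        using ij S by (intro single_class_Wick(1)[of i j _ None]) (auto simp: e'_def entry_class_eq_iff)
      then show ?thesis by (simp add: prod.reindex e'_def)
    qed
    then show ?thesis using h[OF p] by (simp cong: Bochner_Integration.integrable_cong)
  qed
  show "integrable M (\<lambda>\<omega>. \<Prod>k\<in>S. ent (e k) \<omega>)"
    using indep_vars_integrable[OF fin ind int] prod by (simp cong: Bochner_Integration.integrable_cong)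
  have "expectation (\<lambda>\<omega>. \<Prod>k\<in>S. ent (e k) \<omega>) = expectation (\<lambda>\<omega>. \<Prod>p\<in>?I. h p (ent p \<omega>))"
    by (rule Bochner_Integration.integral_cong) (auto simp: prod)
  also have "\<dots> = (\<Prod>p\<in>?I. expectation (\<lambda>\<omega>. h p (ent p \<omega>)))"
    by (rule indep_vars_lebesgue_integral[OF fin ind int])
  also have "\<dots> = (\<Prod>p\<in>?I. expectation (\<lambda>\<omega>. \<Prod>k\<in>?S p. ent (e k) \<omega>))"
    by (intro prod.cong refl Bochner_Integration.integral_cong) (auto simp: h)
  finally show "expectation (\<lambda>\<omega>. \<Prod>k\<in>S. ent (e k) \<omega>)
        = (\<Prod>p\<in>?I. expectation (\<lambda>\<omega>. \<Prod>k\<in>?S p. ent (e k) \<omega>))" .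
qed

text \<open>Only the class of \<open>e s\<close> is affected: every admissible partner lies in it,
  so the single-class identity is applied to that factor and the other factors are carried along
  unchanged.\<close>

theorem Wick_recursion:
  assumes S: "finite S" "s \<notin> S" "\<And>k. k \<in> insert s S \<Longrightarrow> e k \<in> {..<N} \<times> {..<N}"
  shows "expectation (\<lambda>\<omega>. \<Prod>k\<in>insert s S. ent (e k) \<omega>)
      = (\<Sum>t | t \<in> S \<and> e t = prod.swap (e s). expectation (\<lambda>\<omega>. \<Prod>k\<in>S - {t}. ent (e k) \<omega>))"
proof -
  let ?I = "{(i, j). i \<le> j \<and> j < N}"
  define F where "F S p = expectation (\<lambda>\<omega>. \<Prod>k | k \<in> S \<and> entry_class (e k) = p. ent (e k) \<omega>)" for S p
  have fin: "finite ?I" by (rule finite_subset[of _ "{..<N} \<times> {..<N}"]) auto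
  have E: "expectation (\<lambda>\<omega>. \<Prod>k\<in>B. ent (e k) \<omega>) = (\<Prod>p\<in>?I. F B p)" if "B \<subseteq> insert s S" for B
    unfolding F_def using that S by (intro expectation_prod_entries) (auto intro: finite_subset)
  obtain i j where p0: "entry_class (e s) = (i, j)" "i \<le> j" "j < N"
    using S(3)[of s] by (auto simp: entry_class_def)
  let ?p = "(i, j)"
  have pI: "?p \<in> ?I" using p0 by auto
  let ?T = "{t. t \<in> S \<and> e t = prod.swap (e s)}"
  have T: "entry_class (e t) = ?p" if "t \<in> ?T" for t
    using that p0 by (auto simp: entry_class_def min.commute max.commute)
  let ?A = "{k. k \<in> S \<and> entry_class (e k) = ?p}"
  have "F (insert s S) ?p = expectation (\<lambda>\<omega>. \<Prod>k\<in>insert s ?A. ent (e k) \<omega>)"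
    unfolding F_def using p0 by (intro arg_cong[of _ _ expectation] ext prod.cong) auto
  also have "\<dots> = (\<Sum>t | t \<in> ?A \<and> e t = prod.swap (e s). expectation (\<lambda>\<omega>. \<Prod>k\<in>?A - {t}. ent (e k) \<omega>))"
    using p0 S by (intro single_class_Wick(2)[of i j]) auto
  also have "\<dots> = (\<Sum>t\<in>?T. F (S - {t}) ?p)"
    unfolding F_def
    by (intro sum.cong arg_cong[of _ _ expectation] ext prod.cong) (use T in auto)
  finally have Fp: "F (insert s S) ?p = (\<Sum>t\<in>?T. F (S - {t}) ?p)" .
  have Fq: "F (S - {t}) q = F (insert s S) q" if "q \<noteq> ?p" "t \<in> ?T" for q t
    unfolding F_def using that T[of t] p0
    by (intro arg_cong[of _ _ expectation] ext prod.cong) auto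
  have "expectation (\<lambda>\<omega>. \<Prod>k\<in>insert s S. ent (e k) \<omega>) = (\<Prod>p\<in>?I. F (insert s S) p)"
    by (rule E) simp
  also have "\<dots> = F (insert s S) ?p * (\<Prod>p\<in>?I - {?p}. F (insert s S) p)"
    by (rule prod.remove[OF fin pI])
  also have "\<dots> = (\<Sum>t\<in>?T. F (S - {t}) ?p * (\<Prod>p\<in>?I - {?p}. F (insert s S) p))"
    by (simp only: Fp sum_distrib_right)
  also have "\<dots> = (\<Sum>t\<in>?T. F (S - {t}) ?p * (\<Prod>p\<in>?I - {?p}. F (S - {t}) p))"
    using Fq by (intro sum.cong refl arg_cong2[of _ _ _ _ times] prod.cong) auto
  also have "\<dots> = (\<Sum>t\<in>?T. \<Prod>p\<in>?I. F (S - {t}) p)"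
    by (intro sum.cong refl prod.remove[OF fin pI, symmetric])
  also have "\<dots> = (\<Sum>t\<in>?T. expectation (\<lambda>\<omega>. \<Prod>k\<in>S - {t}. ent (e k) \<omega>))"
    by (intro sum.cong refl E[symmetric]) auto
  finally show ?thesis .
qed

end

section \<open>Combinatorics of pairings\<close>

definition pairings :: "'k set \<Rightarrow> ('k \<Rightarrow> 'k) set" where
  "pairings S = {\<pi>. (\<forall>k. \<pi> (\<pi> k) = k) \<and> (\<forall>k. \<pi> k \<noteq> k \<longleftrightarrow> k \<in> S)}"

lemma
  assumes "\<pi> \<in> pairings S"
  shows pairings_invol: "\<pi> (\<pi> k) = k"
    and pairings_fixed: "\<pi> k = k \<longleftrightarrow> k \<notin> S"
    and pairings_in_iff: "\<pi> k \<in> S \<longleftrightarrow> k \<in> S"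
    and pairings_permutes: "\<pi> permutes S"
proof -
  show *: "\<pi> (\<pi> k) = k" "\<pi> k = k \<longleftrightarrow> k \<notin> S" for k using assms by (auto simp: pairings_def)
  show "\<pi> k \<in> S \<longleftrightarrow> k \<in> S" using *[of k] *[of "\<pi> k"] by metis
  show "\<pi> permutes S" unfolding permutes_def using * by metis
qed

lemma finite_pairings: "finite S \<Longrightarrow> finite (pairings S)"
  by (rule finite_subset[OF _ finite_permutations[of S]]) (auto dest: pairings_permutes)

text \<open>\<open>\<pi>\<close> fixes \<open>s\<close> and \<open>t\<close>, so composing with
  their transposition adds the pair and alters nothing else. The reverse operation is
  \<open>pairings_removeI\<close>; together they give the bijection behind the counting
  recursion.\<close>

lemma pairings_insertI:
  assumes "\<pi> \<in> pairings (S - {t})" "t \<in> S" "s \<notin> S"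
  shows "Transposition.transpose s t \<circ> \<pi> \<in> pairings (insert s S)"
proof -
  note [simp] = pairings_invol[OF assms(1)]
  have fx: "\<pi> k = k \<longleftrightarrow> k \<notin> S - {t}" for k by (rule pairings_fixed[OF assms(1)])
  have inn: "\<pi> k \<in> S - {t} \<longleftrightarrow> k \<in> S - {t}" for k by (rule pairings_in_iff[OF assms(1)])
  have ne: "s \<noteq> t" using assms by auto
  have st: "\<pi> s = s" "\<pi> t = t" using fx assms by auto
  have eq: "(Transposition.transpose s t \<circ> \<pi>) k = (if k = s then t else if k = t then s else \<pi> k)" for k
  proof (cases "k = s \<or> k = t")
    case False
    then have "\<pi> k \<noteq> s" "\<pi> k \<noteq> t" using st by (metis pairings_invol[OF assms(1)])+
    then show ?thesis using False by simp
  qed (use st in auto)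
  have inv_st: "\<pi> k = s \<longleftrightarrow> k = s" "\<pi> k = t \<longleftrightarrow> k = t" for k
    using st by (metis pairings_invol[OF assms(1)])+
  show ?thesis
    unfolding pairings_def mem_Collect_eq eq
  proof (intro conjI allI)
    fix k
    show "(if (if k = s then t else if k = t then s else \<pi> k) = s then t
        else if (if k = s then t else if k = t then s else \<pi> k) = t then s
        else \<pi> (if k = s then t else if k = t then s else \<pi> k)) = k"
      using ne st inv_st by auto
    show "((if k = s then t else if k = t then s else \<pi> k) \<noteq> k) = (k \<in> insert s S)"
      using ne fx[of k] assms by auto
  qed
qed

lemma pairings_removeI:
  assumes "\<pi> \<in> pairings S" "s \<in> S"
  shows "Transposition.transpose s (\<pi> s) \<circ> \<pi> \<in> pairings (S - {s, \<pi> s})"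
proof -
  note [simp] = pairings_invol[OF assms(1)]
  have fx: "\<pi> k = k \<longleftrightarrow> k \<notin> S" for k by (rule pairings_fixed[OF assms(1)])
  have eq: "(Transposition.transpose s (\<pi> s) \<circ> \<pi>) k = (if k = s \<or> k = \<pi> s then k else \<pi> k)" for k
    by (auto simp: Transposition.transpose_def) (metis pairings_invol[OF assms(1)])+
  have inv_s: "\<pi> k = s \<longleftrightarrow> k = \<pi> s" "\<pi> k = \<pi> s \<longleftrightarrow> k = s" for k
    by (metis pairings_invol[OF assms(1)])+
  show ?thesis
    unfolding pairings_def mem_Collect_eq eq
    using fx by (simp add: inv_s)
qed

text \<open>These index the nonzero terms of Wick's formula: the covariance of two entries is 1 if
  their index pairs are swaps of each other and 0 otherwise.\<close>

definition compatible_pairings :: "('k \<Rightarrow> 'b \<times> 'b) \<Rightarrow> 'k set \<Rightarrow> ('k \<Rightarrow> 'k) set" where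
  "compatible_pairings e S = {\<pi> \<in> pairings S. \<forall>k\<in>S. e (\<pi> k) = prod.swap (e k)}"

lemma compatible_pairings_empty: "compatible_pairings e {} = {id}"
  by (auto simp: compatible_pairings_def pairings_def fun_eq_iff)

lemma finite_compatible_pairings: "finite S \<Longrightarrow> finite (compatible_pairings e S)"
  by (simp add: compatible_pairings_def finite_pairings)

text \<open>Classify by the partner \<open>t\<close> of \<open>s\<close> and delete the pair. The
  resulting recursion is that of \<open>Wick_recursion\<close>, which is why the two sides of Wick's
  formula agree.\<close>

lemma card_compatible_pairings_insert:
  assumes "finite S" "s \<notin> S"
  shows "card (compatible_pairings e (insert s S))
    = (\<Sum>t | t \<in> S \<and> e t = prod.swap (e s). card (compatible_pairings e (S - {t})))"
proof -
  let ?T = "{t. t \<in> S \<and> e t = prod.swap (e s)}"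
  have "bij_betw (\<lambda>(t, \<pi>). Transposition.transpose s t \<circ> \<pi>) (SIGMA t:?T. compatible_pairings e (S - {t}))
      (compatible_pairings e (insert s S))"
  proof (rule bij_betw_byWitness[where f' = "\<lambda>\<pi>. (\<pi> s, Transposition.transpose s (\<pi> s) \<circ> \<pi>)"])
    have st: "\<pi> s = s" "\<pi> t = t" if "\<pi> \<in> pairings (S - {t})" for \<pi> t
      using pairings_fixed[OF that] assms by auto
    show "\<forall>a\<in>SIGMA t:?T. compatible_pairings e (S - {t}).
        (\<lambda>\<pi>. (\<pi> s, Transposition.transpose s (\<pi> s) \<circ> \<pi>)) ((\<lambda>(t, \<pi>). Transposition.transpose s t \<circ> \<pi>) a) = a"
    proof clarsimp
      fix t \<pi> assume "t \<in> S" "\<pi> \<in> compatible_pairings e (S - {t})"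
      then have "\<pi> s = s" using st(1)[of \<pi> t] by (simp add: compatible_pairings_def)
      then show "Transposition.transpose s t (\<pi> s) = t
          \<and> Transposition.transpose s (Transposition.transpose s t (\<pi> s)) \<circ> (Transposition.transpose s t \<circ> \<pi>) = \<pi>"
        by (simp add: fun_eq_iff)
    qed
    show "\<forall>a'\<in>compatible_pairings e (insert s S).
        (\<lambda>(t, \<pi>). Transposition.transpose s t \<circ> \<pi>) ((\<lambda>\<pi>. (\<pi> s, Transposition.transpose s (\<pi> s) \<circ> \<pi>)) a') = a'"
      by (auto simp: fun_eq_iff)
    show "(\<lambda>(t, \<pi>). Transposition.transpose s t \<circ> \<pi>) ` (SIGMA t:?T. compatible_pairings e (S - {t}))
        \<subseteq> compatible_pairings e (insert s S)"
    proof clarsimp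
      fix t \<pi> assume t: "t \<in> S" "e t = prod.swap (e s)" "\<pi> \<in> compatible_pairings e (S - {t})"
      then have \<pi>: "\<pi> \<in> pairings (S - {t})" by (simp add: compatible_pairings_def)
      have "e ((Transposition.transpose s t \<circ> \<pi>) k) = prod.swap (e k)" if "k \<in> insert s S" for k
      proof (cases "k = s \<or> k = t")
        case True then show ?thesis using st[OF \<pi>] t by auto
      next
        case False
        then have k: "k \<in> S - {t}" using that by auto
        then have "\<pi> k \<in> S - {t}" using pairings_in_iff[OF \<pi>] by simp
        then have "(Transposition.transpose s t \<circ> \<pi>) k = \<pi> k" using assms by (auto simp: Transposition.transpose_def)
        then show ?thesis using t(3) k by (simp add: compatible_pairings_def)
      qed
      then show "Transposition.transpose s t \<circ> \<pi> \<in> compatible_pairings e (insert s S)"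
        unfolding compatible_pairings_def using pairings_insertI[OF \<pi> t(1) assms(2)] by auto
    qed
    show "(\<lambda>\<pi>. (\<pi> s, Transposition.transpose s (\<pi> s) \<circ> \<pi>)) ` compatible_pairings e (insert s S)
        \<subseteq> (SIGMA t:?T. compatible_pairings e (S - {t}))"
    proof (rule image_subsetI)
      fix \<pi> assume "\<pi> \<in> compatible_pairings e (insert s S)"
      then have \<pi>: "\<pi> \<in> pairings (insert s S)"
        and c: "\<And>k. k \<in> insert s S \<Longrightarrow> e (\<pi> k) = prod.swap (e k)"
        by (auto simp: compatible_pairings_def)
      have s: "\<pi> s \<noteq> s" "\<pi> s \<in> insert s S"
        using pairings_fixed[OF \<pi>, of s] pairings_in_iff[OF \<pi>, of s] by auto
      have "insert s S - {s, \<pi> s} = S - {\<pi> s}" using assms by auto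
      then have p: "Transposition.transpose s (\<pi> s) \<circ> \<pi> \<in> pairings (S - {\<pi> s})"
        using pairings_removeI[OF \<pi>, of s] by simp
      have "e ((Transposition.transpose s (\<pi> s) \<circ> \<pi>) k) = prod.swap (e k)" if k: "k \<in> S - {\<pi> s}" for k
      proof -
        have "\<pi> k \<noteq> s" "\<pi> k \<noteq> \<pi> s"
          using k assms(2) pairings_invol[OF \<pi>] by (metis DiffE insertI1)+
        then show ?thesis using c[of k] k by simp
      qed
      then show "(\<pi> s, Transposition.transpose s (\<pi> s) \<circ> \<pi>) \<in> (SIGMA t:?T. compatible_pairings e (S - {t}))"
        using s c[of s] p by (auto simp: compatible_pairings_def)
    qed
  qed
  then have "card (compatible_pairings e (insert s S))
      = card (SIGMA t:?T. compatible_pairings e (S - {t}))"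
    by (simp add: bij_betw_same_card)
  also have "\<dots> = (\<Sum>t\<in>?T. card (compatible_pairings e (S - {t})))"
    using assms by (intro card_SigmaI) (auto intro: finite_compatible_pairings)
  finally show ?thesis .
qed

text \<open>The form in which a product over blocks is counted: \<open>F\<close> is meant to be a
  disjoint family, and only positions in a common member may be paired.\<close>

definition block_compatible_pairings :: "('k \<Rightarrow> 'b \<times> 'b) \<Rightarrow> 'k set set \<Rightarrow> ('k \<Rightarrow> 'k) set" where
  "block_compatible_pairings e F = {\<pi> \<in> compatible_pairings e (\<Union>F). \<forall>B\<in>F. \<pi> ` B \<subseteq> B}"

lemma perm_restrict_compatible_pairings:
  assumes "\<pi> \<in> compatible_pairings e T" "S \<subseteq> T" "\<pi> ` S \<subseteq> S"
  shows "perm_restrict \<pi> S \<in> compatible_pairings e S"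
proof -
  have \<pi>: "\<pi> \<in> pairings T" using assms by (simp add: compatible_pairings_def)
  show ?thesis
    unfolding compatible_pairings_def pairings_def mem_Collect_eq
  proof (intro conjI allI ballI)
    fix k
    show "perm_restrict \<pi> S (perm_restrict \<pi> S k) = k"
      using assms(3) pairings_invol[OF \<pi>, of k] by (auto simp: perm_restrict_def)
    show "(perm_restrict \<pi> S k \<noteq> k) = (k \<in> S)"
      using assms(2) pairings_fixed[OF \<pi>, of k] by (auto simp: perm_restrict_def)
    show "e (perm_restrict \<pi> S k) = prod.swap (e k)" if "k \<in> S"
      using that assms(1,2) by (auto simp: perm_restrict_def compatible_pairings_def)
  qed
qed

lemma compose_compatible_pairings:
  assumes "\<sigma> \<in> compatible_pairings e A" "\<tau> \<in> compatible_pairings e B" "A \<inter> B = {}"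
  shows "\<sigma> \<circ> \<tau> \<in> compatible_pairings e (A \<union> B)"
    and "k \<in> A \<Longrightarrow> (\<sigma> \<circ> \<tau>) k = \<sigma> k" and "k \<notin> A \<Longrightarrow> (\<sigma> \<circ> \<tau>) k = \<tau> k"
proof -
  have p: "\<sigma> \<in> pairings A" "\<tau> \<in> pairings B" using assms by (auto simp: compatible_pairings_def)
  have inn: "\<sigma> k \<in> A \<longleftrightarrow> k \<in> A" "\<tau> k \<in> B \<longleftrightarrow> k \<in> B"
    and fx: "\<sigma> k = k \<longleftrightarrow> k \<notin> A" "\<tau> k = k \<longleftrightarrow> k \<notin> B"
    and inv: "\<sigma> (\<sigma> k) = k" "\<tau> (\<tau> k) = k" for k
    using pairings_in_iff[OF p(1)] pairings_in_iff[OF p(2)] pairings_fixed[OF p(1)] pairings_fixed[OF p(2)]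
      pairings_invol[OF p(1)] pairings_invol[OF p(2)] by auto
  show A: "(\<sigma> \<circ> \<tau>) k = \<sigma> k" if "k \<in> A" for k
    using that assms(3) fx(2)[of k] by auto
  show nA: "(\<sigma> \<circ> \<tau>) k = \<tau> k" if "k \<notin> A" for k
    using that assms(3) fx[of k] fx(1)[of "\<tau> k"] inn(2)[of k] by auto
  have eq: "(\<sigma> \<circ> \<tau>) = (\<lambda>k. if k \<in> A then \<sigma> k else \<tau> k)"
    using A nA by auto
  have tA: "\<tau> k \<in> A \<longleftrightarrow> k \<in> A" for k
    using inn(2)[of k] fx(2)[of k] assms(3) by (metis disjoint_iff)
  show "\<sigma> \<circ> \<tau> \<in> compatible_pairings e (A \<union> B)"
    unfolding eq compatible_pairings_def pairings_def
    using assms(1,2) by (auto simp: inn fx inv tA compatible_pairings_def)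
qed

text \<open>Split off one member: restricting a pairing to it and to the rest is inverse to
  composing pairings with disjoint supports. \<open>perm_restrict\<close> extends by the identity,
  so the restrictions are again pairings of their own sets.\<close>

lemma card_block_compatible_pairings:
  assumes "finite F" "\<And>B. B \<in> F \<Longrightarrow> finite B" "disjoint F"
  shows "card (block_compatible_pairings e F) = (\<Prod>B\<in>F. card (compatible_pairings e B))"
  using assms
proof (induction F rule: finite_induct)
  case empty
  then show ?case by (simp add: block_compatible_pairings_def compatible_pairings_empty)
next
  case (insert B F)
  have dj: "B \<inter> \<Union>F = {}" using insert.prems(2) insert.hyps(2)
    by (auto simp: pairwise_insert disjnt_iff)
  have "bij_betw (\<lambda>(\<sigma>, \<tau>). \<sigma> \<circ> \<tau>) (compatible_pairings e B \<times> block_compatible_pairings e F)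
      (block_compatible_pairings e (insert B F))"
  proof (rule bij_betw_byWitness[where f' = "\<lambda>\<pi>. (perm_restrict \<pi> B, perm_restrict \<pi> (\<Union>F))"])
    have fx: "\<tau> k = k \<longleftrightarrow> k \<notin> S" "\<tau> k \<in> S \<longleftrightarrow> k \<in> S" if "\<tau> \<in> compatible_pairings e S" for \<tau> S k
      using that pairings_fixed[of \<tau> S] pairings_in_iff[of \<tau> S] by (auto simp: compatible_pairings_def)
    show "\<forall>a\<in>compatible_pairings e B \<times> block_compatible_pairings e F.
        (\<lambda>\<pi>. (perm_restrict \<pi> B, perm_restrict \<pi> (\<Union>F))) ((\<lambda>(\<sigma>, \<tau>). \<sigma> \<circ> \<tau>) a) = a"
    proof clarsimp
      fix \<sigma> \<tau> assume st: "\<sigma> \<in> compatible_pairings e B" "\<tau> \<in> block_compatible_pairings e F"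
      then have t: "\<tau> \<in> compatible_pairings e (\<Union>F)" by (simp add: block_compatible_pairings_def)
      note c = compose_compatible_pairings(2,3)[OF st(1) t dj]
      show "perm_restrict (\<sigma> \<circ> \<tau>) B = \<sigma> \<and> perm_restrict (\<sigma> \<circ> \<tau>) (\<Union>F) = \<tau>"
      proof (intro conjI ext)
        fix k
        show "perm_restrict (\<sigma> \<circ> \<tau>) B k = \<sigma> k"
          using c(1)[of k] fx(1)[OF st(1), of k] unfolding perm_restrict_def by presburger
        show "perm_restrict (\<sigma> \<circ> \<tau>) (\<Union>F) k = \<tau> k"
          using c(2)[of k] fx(1)[OF t, of k] dj unfolding perm_restrict_def
          by (metis disjoint_iff)
      qed
    qed
    show "\<forall>a'\<in>block_compatible_pairings e (insert B F).
        (\<lambda>(\<sigma>, \<tau>). \<sigma> \<circ> \<tau>) ((\<lambda>\<pi>. (perm_restrict \<pi> B, perm_restrict \<pi> (\<Union>F))) a') = a'"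
    proof
      fix \<pi> assume "\<pi> \<in> block_compatible_pairings e (insert B F)"
      then have p: "\<pi> \<in> compatible_pairings e (B \<union> \<Union>F)" "\<And>C. C \<in> insert B F \<Longrightarrow> \<pi> ` C \<subseteq> C"
        unfolding block_compatible_pairings_def Union_insert by blast+
      then have sub: "\<pi> ` B \<subseteq> B" "\<pi> ` \<Union>F \<subseteq> \<Union>F" by blast+
      note r = perm_restrict_compatible_pairings[OF p(1) _ sub(1)] perm_restrict_compatible_pairings[OF p(1) _ sub(2)]
      note c = compose_compatible_pairings(2,3)[OF r(1) r(2) dj]
      have "(perm_restrict \<pi> B \<circ> perm_restrict \<pi> (\<Union>F)) k = \<pi> k" for k
      proof (cases "k \<in> B")
        case True
        with c(1)[of k] show ?thesis by (simp add: perm_restrict_def)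
      next
        case False
        with c(2)[of k] fx(1)[OF p(1), of k] show ?thesis by (auto simp: perm_restrict_def)
      qed
      then show "(\<lambda>(\<sigma>, \<tau>). \<sigma> \<circ> \<tau>) ((\<lambda>\<pi>. (perm_restrict \<pi> B, perm_restrict \<pi> (\<Union>F))) \<pi>) = \<pi>"
        by auto
    qed
    show "(\<lambda>(\<sigma>, \<tau>). \<sigma> \<circ> \<tau>) ` (compatible_pairings e B \<times> block_compatible_pairings e F)
        \<subseteq> block_compatible_pairings e (insert B F)"
    proof clarsimp
      fix \<sigma> \<tau> assume st: "\<sigma> \<in> compatible_pairings e B" "\<tau> \<in> block_compatible_pairings e F"
      then have t: "\<tau> \<in> compatible_pairings e (\<Union>F)" "\<And>C. C \<in> F \<Longrightarrow> \<tau> ` C \<subseteq> C"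
        by (simp_all add: block_compatible_pairings_def)
      note c = compose_compatible_pairings[OF st(1) t(1) dj]
      have "(\<sigma> \<circ> \<tau>) k \<in> C" if "C \<in> insert B F" "k \<in> C" for C k
      proof (cases "k \<in> B")
        case True
        then have "C = B" using that dj by auto
        then show ?thesis using c(2)[OF True] fx(2)[OF st(1), of k] True by simp
      next
        case False
        then show ?thesis using c(3)[OF False] t(2)[of C] that by auto
      qed
      then show "\<sigma> \<circ> \<tau> \<in> block_compatible_pairings e (insert B F)"
        using c(1) by (auto simp: block_compatible_pairings_def)
    qed
    show "(\<lambda>\<pi>. (perm_restrict \<pi> B, perm_restrict \<pi> (\<Union>F))) ` block_compatible_pairings e (insert B F)
        \<subseteq> compatible_pairings e B \<times> block_compatible_pairings e F"
    proof (rule image_subsetI)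
      fix \<pi> assume "\<pi> \<in> block_compatible_pairings e (insert B F)"
      then have p: "\<pi> \<in> compatible_pairings e (B \<union> \<Union>F)" "\<And>C. C \<in> insert B F \<Longrightarrow> \<pi> ` C \<subseteq> C"
        unfolding block_compatible_pairings_def Union_insert by blast+
      then have sub: "\<pi> ` B \<subseteq> B" "\<pi> ` \<Union>F \<subseteq> \<Union>F" by blast+
      note r = perm_restrict_compatible_pairings[OF p(1) _ sub(1)] perm_restrict_compatible_pairings[OF p(1) _ sub(2)]
      have "perm_restrict \<pi> (\<Union>F) ` C \<subseteq> C" if "C \<in> F" for C
        using p(2)[of C] that by (auto simp: perm_restrict_def)
      then show "(perm_restrict \<pi> B, perm_restrict \<pi> (\<Union>F)) \<in> compatible_pairings e B \<times> block_compatible_pairings e F"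
        using r by (auto simp: block_compatible_pairings_def)
    qed
  qed
  from bij_betw_same_card[OF this] show ?case
    using insert by (simp add: card_cartesian_product pairwise_insert)
qed

context gue_entries
begin

text \<open>Induction over proper subsets, since the recursion removes two positions at a time; the
  empty product matches the identity as the only pairing of the empty set.\<close>

theorem Wick_formula:
  assumes "finite S" "\<And>k. k \<in> S \<Longrightarrow> e k \<in> {..<N} \<times> {..<N}"
  shows "expectation (\<lambda>\<omega>. \<Prod>k\<in>S. ent (e k) \<omega>) = of_nat (card (compatible_pairings e S))"
  using assms
proof (induction S rule: finite_psubset_induct)
  case (psubset S)
  show ?case
  proof (cases "S = {}")
    case True then show ?thesis by (simp add: compatible_pairings_empty prob_space)
  next
    case False
    then obtain s T where S: "S = insert s T" "s \<notin> T" by (metis ex_in_conv mk_disjoint_insert)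
    have "finite T" using S psubset.hyps by simp
    have "expectation (\<lambda>\<omega>. \<Prod>k\<in>T - {t}. ent (e k) \<omega>) = of_nat (card (compatible_pairings e (T - {t})))" for t
      using S psubset.prems by (intro psubset.IH) auto
    then show ?thesis
      unfolding S(1) using S psubset.prems \<open>finite T\<close>
      by (subst Wick_recursion) (auto simp: card_compatible_pairings_insert)
  qed
qed

end

section \<open>Traces of powers\<close>

text \<open>\<open>cycle_of_list\<close> is a product of adjacent transpositions; the outermost one
  sends the wrapped value \<open>a + 1\<close> of the shorter cycle on to \<open>a\<close>.\<close>

lemma cycle_of_list_upt:
  "cycle_of_list [a..<a + Suc n] k = (if k < a \<or> a + n < k then k else if k = a + n then a else Suc k)"
proof (induction n arbitrary: a)
  case (Suc n)
  have "[a..<a + Suc (Suc n)] = a # Suc a # [Suc (Suc a)..<Suc a + Suc n]"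
    by (simp add: upt_conv_Cons)
  moreover have "[Suc a..<Suc a + Suc n] = Suc a # [Suc (Suc a)..<Suc a + Suc n]"
    by (simp add: upt_conv_Cons)
  ultimately have "cycle_of_list [a..<a + Suc (Suc n)] k
      = Transposition.transpose a (Suc a) (cycle_of_list [Suc a..<Suc a + Suc n] k)"
    by simp
  then show ?case unfolding Suc.IH by (auto simp: Transposition.transpose_def)
qed auto

definition block :: "nat list \<Rightarrow> nat \<Rightarrow> nat set" where
  "block ms j = {sum_list (take j ms) + 1..sum_list (take j ms) + ms ! j}"

lemma consecutive_cycles_outside:
  "k \<le> s \<or> s + sum_list ms < k \<Longrightarrow> consecutive_cycles s ms k = k"
proof (induction ms arbitrary: s)
  case (Cons m ms)
  have "cycle_of_list [s + 1..<s + m + 1] k = k"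
    using Cons.prems by (intro id_outside_supp) auto
  moreover have "consecutive_cycles (s + m) ms k = k"
    using Cons.prems by (intro Cons.IH) auto
  ultimately show ?case by simp
qed simp

text \<open>Each position is moved only by the cycle of its own block; all other cycles fix it. The
  shift \<open>s\<close> stays general for the induction.\<close>

lemma consecutive_cycles_block:
  assumes "j < length ms" "k \<in> {s + sum_list (take j ms) + 1..s + sum_list (take j ms) + ms ! j}"
  shows "consecutive_cycles s ms k =
    (if k = s + sum_list (take j ms) + ms ! j then s + sum_list (take j ms) + 1 else Suc k)"
  using assms
proof (induction ms arbitrary: s j)
  case (Cons m ms)
  show ?case
  proof (cases j)
    case 0
    then have k: "s + 1 \<le> k" "k \<le> s + m" using Cons.prems by auto
    then obtain n where m: "m = Suc n" by (cases m) auto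
    have "consecutive_cycles (s + m) ms k = k"
      using k by (intro consecutive_cycles_outside) auto
    then show ?thesis using 0 k m cycle_of_list_upt[of "s + 1" n k] by (auto simp del: upt_Suc)
  next
    case (Suc i)
    have le: "sum_list (take i ms) + ms ! i \<le> sum_list ms"
      using Cons.prems Suc by (metis Suc_less_eq append_take_drop_id elem_le_sum_list id_take_nth_drop
        length_Cons le_add1 nat_add_left_cancel_le sum_list.Cons sum_list.append)
    have "consecutive_cycles (s + m) ms k
        = (if k = s + m + sum_list (take i ms) + ms ! i then s + m + sum_list (take i ms) + 1 else Suc k)"
      using Cons.prems Suc by (intro Cons.IH) (auto simp: add.assoc)
    moreover have "cycle_of_list [s + 1..<s + m + 1] k' = k'" if "s + m < k'" for k'
      using that by (intro id_outside_supp) auto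
    ultimately show ?thesis using Suc Cons.prems by (auto simp: add.assoc)
  qed
qed simp

lemma gamma_perm_block:
  assumes "j < length ms" "k \<in> block ms j"
  shows "gamma_perm ms k =
    (if k = sum_list (take j ms) + ms ! j then sum_list (take j ms) + 1 else Suc k)"
  using consecutive_cycles_block[of j ms k 0] assms by (simp add: gamma_perm_def block_def)

lemma gamma_perm_in_block: "j < length ms \<Longrightarrow> k \<in> block ms j \<Longrightarrow> gamma_perm ms k \<in> block ms j"
  by (subst gamma_perm_block) (auto simp: block_def)

lemma take_sum_list_mono:
  fixes ms :: "nat list"
  shows "i \<le> j \<Longrightarrow> sum_list (take i ms) \<le> sum_list (take j ms)"
  by (metis le_add1 le_add_diff_inverse sum_list.append take_add)

lemma block_disjoint:
  assumes "i < length ms" "j < length ms" "i \<noteq> j"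
  shows "block ms i \<inter> block ms j = {}"
proof -
  have *: "block ms i \<inter> block ms j = {}" if "i < j" "i < length ms" for i j
    using take_sum_list_mono[of "Suc i" j ms] that by (auto simp: block_def take_Suc_conv_app_nth)
  show ?thesis using *[of i j] *[of j i] assms by (cases "i < j") auto
qed

lemma UN_block: "(\<Union>j<length ms. block ms j) = {1..sum_list ms}"
proof -
  have "(\<Union>j<n. block ms j) = {1..sum_list (take n ms)}" if "n \<le> length ms" for n
    using that
  proof (induction n)
    case (Suc n)
    then have "{..<Suc n} = insert n {..<n}" "n < length ms" by auto
    then show ?case using Suc by (auto simp: block_def take_Suc_conv_app_nth)
  qed simp
  from this[of "length ms"] show ?thesis by simp
qed

section \<open>Sums over index functions\<close>

lemma sum_PiE_insert:
  assumes "x \<notin> S"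
  shows "(\<Sum>f\<in>PiE (insert x S) T. g f) = (\<Sum>y\<in>T x. \<Sum>f\<in>PiE S T. g (f(x := y)))"
proof -
  have "(\<Sum>f\<in>PiE (insert x S) T. g f) = (\<Sum>(y, f)\<in>T x \<times> PiE S T. g (f(x := y)))"
    using assms inj_combinator[OF assms, of T]
    by (simp add: PiE_insert_eq sum.reindex split_def o_def)
  then show ?thesis by (simp add: sum.cartesian_product)
qed

text \<open>A function on \<open>A \<union> B\<close> is a pair of functions on the two disjoint
  sets; the locality assumptions allow one glued function to be inserted into both factors.\<close>

lemma sum_PiE_Un:
  fixes g h :: "('k \<Rightarrow> 'v) \<Rightarrow> 'c :: comm_semiring_1"
  assumes "A \<inter> B = {}"
    and g: "\<And>f f'. (\<And>k. k \<in> A \<Longrightarrow> f k = f' k) \<Longrightarrow> g f = g f'"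
    and h: "\<And>f f'. (\<And>k. k \<in> B \<Longrightarrow> f k = f' k) \<Longrightarrow> h f = h f'"
  shows "(\<Sum>f\<in>PiE A T. g f) * (\<Sum>f\<in>PiE B T. h f) = (\<Sum>f\<in>PiE (A \<union> B) T. g f * h f)"
proof -
  have "(\<Sum>f\<in>PiE A T. g f) * (\<Sum>f\<in>PiE B T. h f) = (\<Sum>(f, f')\<in>PiE A T \<times> PiE B T. g f * h f')"
    by (simp add: sum_product sum.cartesian_product)
  also have "\<dots> = (\<Sum>f\<in>PiE (A \<union> B) T. g f * h f)"
  proof (rule sum.reindex_bij_witness[where i = "\<lambda>f. (restrict f A, restrict f B)"
        and j = "\<lambda>(f, f') k. if k \<in> A then f k else f' k"])
    fix a assume "a \<in> PiE A T \<times> PiE B T"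
    then obtain f f' where a: "a = (f, f')" "f \<in> PiE A T" "f' \<in> PiE B T" by auto
    let ?u = "\<lambda>k. if k \<in> A then f k else f' k"
    have u: "(case a of (f, f') \<Rightarrow> \<lambda>k. if k \<in> A then f k else f' k) = ?u" using a by simp
    have "restrict ?u A = f" using a by (auto simp: fun_eq_iff PiE_def extensional_def)
    moreover have "restrict ?u B = f'" using a assms(1)
      by (auto simp: fun_eq_iff PiE_def extensional_def)
    ultimately show "(restrict (case a of (f, f') \<Rightarrow> \<lambda>k. if k \<in> A then f k else f' k) A,
        restrict (case a of (f, f') \<Rightarrow> \<lambda>k. if k \<in> A then f k else f' k) B) = a"
      unfolding u using a by simp
    show "(case a of (f, f') \<Rightarrow> \<lambda>k. if k \<in> A then f k else f' k) \<in> PiE (A \<union> B) T"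
      unfolding u using a by (auto simp: PiE_def extensional_def Pi_def)
    have "g ?u = g f" "h ?u = h f'"
      using assms(1) by (auto intro!: g h)
    then show "g (case a of (f, f') \<Rightarrow> \<lambda>k. if k \<in> A then f k else f' k)
        * h (case a of (f, f') \<Rightarrow> \<lambda>k. if k \<in> A then f k else f' k) = (case a of (f, f') \<Rightarrow> g f * h f')"
      unfolding u using a by simp
  next
    fix f assume f: "f \<in> PiE (A \<union> B) T"
    then show "(case (restrict f A, restrict f B) of (f, f') \<Rightarrow> \<lambda>k. if k \<in> A then f k else f' k) = f"
      by (auto simp: fun_eq_iff PiE_def extensional_def)
    show "(restrict f A, restrict f B) \<in> PiE A T \<times> PiE B T"
      using f by auto
  qed
  finally show ?thesis .
qed

text \<open>Serves to turn a product of traces, each a sum over index functions on its own block,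
  into one sum over index functions on all positions.\<close>

lemma prod_sum_PiE_UN:
  fixes g :: "'i \<Rightarrow> ('k \<Rightarrow> 'v) \<Rightarrow> 'c :: comm_semiring_1"
  assumes "finite B"
    and "\<And>i j. i \<in> B \<Longrightarrow> j \<in> B \<Longrightarrow> i \<noteq> j \<Longrightarrow> S i \<inter> S j = {}"
    and g: "\<And>i f f'. i \<in> B \<Longrightarrow> (\<And>k. k \<in> S i \<Longrightarrow> f k = f' k) \<Longrightarrow> g i f = g i f'"
  shows "(\<Prod>i\<in>B. \<Sum>f\<in>PiE (S i) T. g i f) = (\<Sum>f\<in>PiE (\<Union>i\<in>B. S i) T. \<Prod>i\<in>B. g i f)"
  using assms
proof (induction B rule: finite_induct)
  case (insert i B)
  have IH: "(\<Prod>i\<in>B. \<Sum>f\<in>PiE (S i) T. g i f) = (\<Sum>f\<in>PiE (\<Union>i\<in>B. S i) T. \<Prod>i\<in>B. g i f)"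
  proof (rule insert.IH)
    show "S i \<inter> S j = {}" if "i \<in> B" "j \<in> B" "i \<noteq> j" for i j
      using insert.prems(1)[of i j] that by simp
    show "g j f = g j f'" if "j \<in> B" "\<And>k. k \<in> S j \<Longrightarrow> f k = f' k" for j f f'
      using insert.prems(2)[of j f f'] that by simp
  qed
  have "(\<Prod>i\<in>insert i B. \<Sum>f\<in>PiE (S i) T. g i f)
      = (\<Sum>f\<in>PiE (S i) T. g i f) * (\<Sum>f\<in>PiE (\<Union>i\<in>B. S i) T. \<Prod>i\<in>B. g i f)"
    using insert.hyps by (simp add: IH)
  also have "\<dots> = (\<Sum>f\<in>PiE (S i \<union> (\<Union>i\<in>B. S i)) T. g i f * (\<Prod>i\<in>B. g i f))"
  proof (rule sum_PiE_Un)
    show "S i \<inter> (\<Union>i\<in>B. S i) = {}"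
      using insert.prems(1)[of i] insert.hyps(2) by blast
    show "(\<And>k. k \<in> S i \<Longrightarrow> f k = f' k) \<Longrightarrow> g i f = g i f'" for f f'
      using insert.prems(2)[of i f f'] by simp
    show "(\<Prod>i\<in>B. g i f) = (\<Prod>i\<in>B. g i f')" if "\<And>k. k \<in> (\<Union>i\<in>B. S i) \<Longrightarrow> f k = f' k" for f f'
      using that by (intro prod.cong refl insert.prems(2)) auto
  qed
  finally show ?case using insert.hyps by simp
qed simp

text \<open>Sum over paths from \<open>a\<close> to \<open>b\<close>. The endpoints are set by
  function update, so only the \<open>n\<close> interior vertices are summed over; the offset
  \<open>s\<close> numbers the factors like the positions of a block.\<close>

lemma pow_mat_entry_paths:
  fixes A :: "'c :: comm_semiring_1 mat"
  assumes "A \<in> carrier_mat N N" "a < N" "b < N"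
  shows "(A ^\<^sub>m Suc n) $$ (a, b) = (\<Sum>i\<in>PiE {Suc s..<Suc s + n} (\<lambda>_. {..<N}).
    \<Prod>k\<in>{s..s + n}. A $$ ((i(s := a, Suc s + n := b)) k, (i(s := a, Suc s + n := b)) (Suc k)))"
  using assms(3)
proof (induction n arbitrary: b)
  case 0
  then show ?case using assms by simp
next
  case (Suc n)
  let ?P = "\<lambda>i. \<Prod>k\<in>{s..s + n}. A $$ (i k, i (Suc k))"
  have c: "A ^\<^sub>m Suc n \<in> carrier_mat N N" using assms(1) by (rule pow_carrier_mat)
  have "(A ^\<^sub>m Suc (Suc n)) $$ (a, b) = (\<Sum>c\<in>{..<N}. (A ^\<^sub>m Suc n) $$ (a, c) * A $$ (c, b))"
    using assms Suc.prems c by (simp add: scalar_prod_def lessThan_atLeast0 del: pow_mat.simps(2) add: pow_mat.simps(2)[of A "Suc n"])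
  also have "\<dots> = (\<Sum>c\<in>{..<N}. \<Sum>i\<in>PiE {Suc s..<Suc s + n} (\<lambda>_. {..<N}).
      ?P (i(s := a, Suc s + n := c)) * A $$ (c, b))"
    by (intro sum.cong refl) (simp only: lessThan_iff Suc.IH sum_distrib_right)
  \<comment> \<open>The new interior vertex \<open>c\<close> sits at \<open>Suc s + n\<close>, the
    endpoint of the shorter path.\<close>
  also have "\<dots> = (\<Sum>c\<in>{..<N}. \<Sum>i\<in>PiE {Suc s..<Suc s + n} (\<lambda>_. {..<N}).
      \<Prod>k\<in>{s..s + Suc n}. A $$ ((i(Suc s + n := c, s := a, Suc s + Suc n := b)) k,
        (i(Suc s + n := c, s := a, Suc s + Suc n := b)) (Suc k)))"
  proof (intro sum.cong refl)
    fix c i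
    let ?j = "i(Suc s + n := c, s := a, Suc s + Suc n := b)"
    have "{s..s + Suc n} = insert (s + Suc n) {s..s + n}" by auto
    then have "(\<Prod>k\<in>{s..s + Suc n}. A $$ (?j k, ?j (Suc k)))
        = A $$ (?j (s + Suc n), ?j (Suc (s + Suc n))) * (\<Prod>k\<in>{s..s + n}. A $$ (?j k, ?j (Suc k)))"
      by simp
    also have "(\<Prod>k\<in>{s..s + n}. A $$ (?j k, ?j (Suc k))) = ?P (i(s := a, Suc s + n := c))"
      by (intro prod.cong refl arg_cong[of _ _ "index_mat A"] arg_cong2[of _ _ _ _ Pair]) auto
    also have "A $$ (?j (s + Suc n), ?j (Suc (s + Suc n))) = A $$ (c, b)"
      by simp
    finally show "?P (i(s := a, Suc s + n := c)) * A $$ (c, b)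
        = (\<Prod>k\<in>{s..s + Suc n}. A $$ (?j k, ?j (Suc k)))" by (simp only: mult.commute)
  qed
  also have "\<dots> = (\<Sum>i\<in>PiE (insert (Suc s + n) {Suc s..<Suc s + n}) (\<lambda>_. {..<N}).
      \<Prod>k\<in>{s..s + Suc n}. A $$ ((i(s := a, Suc s + Suc n := b)) k,
        (i(s := a, Suc s + Suc n := b)) (Suc k)))"
    by (subst sum_PiE_insert) auto
  also have "insert (Suc s + n) {Suc s..<Suc s + n} = {Suc s..<Suc s + Suc n}" by auto
  finally show ?case .
qed

text \<open>Closing the path identifies its last vertex with the first, so the successor of the last
  position wraps around to \<open>s\<close>, as in a cycle of \<open>gamma_perm\<close>.\<close>

lemma trace_pow_mat:
  fixes A :: "complex mat"
  assumes "A \<in> carrier_mat N N"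
  shows "Tr (A ^\<^sub>m Suc n) = (\<Sum>i\<in>PiE {s..s + n} (\<lambda>_. {..<N}).
    \<Prod>k\<in>{s..s + n}. A $$ (i k, i (if k = s + n then s else Suc k)))"
proof -
  have c: "A ^\<^sub>m Suc n \<in> carrier_mat N N" using assms by (rule pow_carrier_mat)
  then have "Tr (A ^\<^sub>m Suc n) = (\<Sum>a<N. (A ^\<^sub>m Suc n) $$ (a, a))"
    unfolding Tr_def by auto
  also have "\<dots> = (\<Sum>a<N. \<Sum>i\<in>PiE {Suc s..<Suc s + n} (\<lambda>_. {..<N}).
      \<Prod>k\<in>{s..s + n}. A $$ ((i(s := a)) k, (i(s := a)) (if k = s + n then s else Suc k)))"
  proof (intro sum.cong refl)
    fix a assume a: "a \<in> {..<N}"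
    show "(A ^\<^sub>m Suc n) $$ (a, a) = (\<Sum>i\<in>PiE {Suc s..<Suc s + n} (\<lambda>_. {..<N}).
      \<Prod>k\<in>{s..s + n}. A $$ ((i(s := a)) k, (i(s := a)) (if k = s + n then s else Suc k)))"
      using a
      by (subst pow_mat_entry_paths[OF assms, of a a n s])
         (auto intro!: sum.cong prod.cong arg_cong[of _ _ "index_mat A"])
  qed
  also have "\<dots> = (\<Sum>i\<in>PiE (insert s {Suc s..<Suc s + n}) (\<lambda>_. {..<N}).
      \<Prod>k\<in>{s..s + n}. A $$ (i k, i (if k = s + n then s else Suc k)))"
    by (subst sum_PiE_insert) auto
  also have "insert s {Suc s..<Suc s + n} = {s..s + n}" by auto
  finally show ?thesis .
qed

text \<open>A positive exponent matters here: for exponent zero the trace is \<open>N\<close>, while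
  an empty block contributes 1.\<close>

lemma trace_pow_mat_block:
  fixes A :: "complex mat"
  assumes "A \<in> carrier_mat N N" "j < length ms" "ms ! j \<ge> 1"
  shows "Tr (A ^\<^sub>m (ms ! j)) = (\<Sum>i\<in>PiE (block ms j) (\<lambda>_. {..<N}).
    \<Prod>k\<in>block ms j. A $$ (i k, i (gamma_perm ms k)))"
proof -
  let ?s = "sum_list (take j ms) + 1"
  obtain n where n: "ms ! j = Suc n" using assms(3) by (cases "ms ! j") auto
  have b: "block ms j = {?s..?s + n}" by (auto simp: block_def n)
  have "gamma_perm ms k = (if k = ?s + n then ?s else Suc k)" if "k \<in> block ms j" for k
    using gamma_perm_block[OF assms(2) that] n by simp
  then show ?thesis
    unfolding n trace_pow_mat[OF assms(1), of n ?s] b[symmetric]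
    by (intro sum.cong prod.cong refl) simp
qed

text \<open>The index of the matrix entry at position \<open>k\<close> in the trace expansion:
  consecutive entries inside a trace share an index.\<close>

definition index_pairs :: "nat list \<Rightarrow> (nat \<Rightarrow> nat) \<Rightarrow> nat \<Rightarrow> nat \<times> nat" where
  "index_pairs ms i k = (i k, i (gamma_perm ms k))"

context gue_entries
begin

lemma X_entry: "\<omega> \<in> space M \<Longrightarrow> a < N \<Longrightarrow> b < N \<Longrightarrow> X \<omega> $$ (a, b) = ent (a, b) \<omega> / complex_of_real (sqrt N)"
  and X_carrier: "\<omega> \<in> space M \<Longrightarrow> X \<omega> \<in> carrier_mat N N"
proof -
  have "\<forall>\<omega>\<in>space M. X \<omega> = mat N N (\<lambda>(i, j). x i j \<omega> / complex_of_real (sqrt (real N)))"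
    using wigner[unfolded complex_wigner_def] by (elim conjE)
  then show "\<omega> \<in> space M \<Longrightarrow> a < N \<Longrightarrow> b < N \<Longrightarrow> X \<omega> $$ (a, b) = ent (a, b) \<omega> / complex_of_real (sqrt N)"
    "\<omega> \<in> space M \<Longrightarrow> X \<omega> \<in> carrier_mat N N"
    by (auto simp: ent_def)
qed

text \<open>The set \<open>S\<close> is closed under \<open>gamma_perm\<close>, so an index function
  on \<open>S\<close> determines every entry involved and Wick's formula applies. The power of
  \<open>sqrt N\<close> collects one normalising factor per position.\<close>

lemma expectation_prod_traces:
  assumes B: "B \<subseteq> {..<length ms}" and pos: "\<And>m. m \<in> set ms \<Longrightarrow> m \<ge> 1"
  defines "S \<equiv> \<Union>j\<in>B. block ms j"
  shows "expectation (\<lambda>\<omega>. \<Prod>j\<in>B. Tr (X \<omega> ^\<^sub>m (ms ! j)))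
    = (\<Sum>i\<in>PiE S (\<lambda>_. {..<N}). of_nat (card (compatible_pairings (index_pairs ms i) S)))
        / complex_of_real (sqrt N) ^ card S"
proof -
  let ?c = "complex_of_real (sqrt N)"
  have finB: "finite B" using B by (auto intro: finite_subset)
  have finS: "finite S" unfolding S_def using finB by (auto simp: block_def)
  have disj: "block ms i \<inter> block ms j = {}" if "i \<in> B" "j \<in> B" "i \<noteq> j" for i j
    using that B by (intro block_disjoint) auto
  have gS: "gamma_perm ms k \<in> S" if "k \<in> S" for k
    using that B gamma_perm_in_block[of _ ms k] unfolding S_def by blast
  have "(\<Prod>j\<in>B. Tr (X \<omega> ^\<^sub>m (ms ! j))) = (\<Sum>i\<in>PiE S (\<lambda>_. {..<N}). (\<Prod>k\<in>S. ent (index_pairs ms i k) \<omega>) / ?c ^ card S)"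
    if \<omega>: "\<omega> \<in> space M" for \<omega>
  proof -
    have "(\<Prod>j\<in>B. Tr (X \<omega> ^\<^sub>m (ms ! j))) = (\<Prod>j\<in>B. \<Sum>i\<in>PiE (block ms j) (\<lambda>_. {..<N}).
        \<Prod>k\<in>block ms j. X \<omega> $$ index_pairs ms i k)"
      using B pos unfolding index_pairs_def
      by (intro prod.cong refl trace_pow_mat_block[OF X_carrier[OF \<omega>]]) auto
    also have "\<dots> = (\<Sum>i\<in>PiE S (\<lambda>_. {..<N}). \<Prod>j\<in>B. \<Prod>k\<in>block ms j. X \<omega> $$ index_pairs ms i k)"
      unfolding S_def
    proof (rule prod_sum_PiE_UN[OF finB disj])
      show "(\<Prod>k\<in>block ms j. X \<omega> $$ index_pairs ms f k) = (\<Prod>k\<in>block ms j. X \<omega> $$ index_pairs ms f' k)"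
        if "j \<in> B" "\<And>k. k \<in> block ms j \<Longrightarrow> f k = f' k" for j f f'
        using that B gamma_perm_in_block unfolding index_pairs_def by (intro prod.cong refl) auto
    qed
    also have "\<dots> = (\<Sum>i\<in>PiE S (\<lambda>_. {..<N}). \<Prod>k\<in>S. X \<omega> $$ index_pairs ms i k)"
      unfolding S_def using disj finB
      by (intro sum.cong refl prod.UNION_disjoint[symmetric]) (auto simp: block_def)
    also have "\<dots> = (\<Sum>i\<in>PiE S (\<lambda>_. {..<N}). (\<Prod>k\<in>S. ent (index_pairs ms i k) \<omega>) / ?c ^ card S)"
    proof (intro sum.cong refl)
      fix i assume i: "i \<in> PiE S (\<lambda>_. {..<N})"
      have "(\<Prod>k\<in>S. X \<omega> $$ index_pairs ms i k) = (\<Prod>k\<in>S. ent (index_pairs ms i k) \<omega> / ?c)"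
        using i gS unfolding index_pairs_def by (intro prod.cong refl X_entry[OF \<omega>]) auto
      then show "(\<Prod>k\<in>S. X \<omega> $$ index_pairs ms i k) = (\<Prod>k\<in>S. ent (index_pairs ms i k) \<omega>) / ?c ^ card S"
        by (simp add: prod_dividef)
    qed
    finally show ?thesis .
  qed
  then have "expectation (\<lambda>\<omega>. \<Prod>j\<in>B. Tr (X \<omega> ^\<^sub>m (ms ! j)))
      = expectation (\<lambda>\<omega>. \<Sum>i\<in>PiE S (\<lambda>_. {..<N}). (\<Prod>k\<in>S. ent (index_pairs ms i k) \<omega>) / ?c ^ card S)"
    by (intro Bochner_Integration.integral_cong) auto
  also have "\<dots> = (\<Sum>i\<in>PiE S (\<lambda>_. {..<N}). expectation (\<lambda>\<omega>. \<Prod>k\<in>S. ent (index_pairs ms i k) \<omega>) / ?c ^ card S)"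
  proof (subst Bochner_Integration.integral_sum)
    fix i assume i: "i \<in> PiE S (\<lambda>_. {..<N})"
    have "index_pairs ms i k \<in> {..<N} \<times> {..<N}" if "k \<in> S" for k
      using i gS[OF that] that by (auto simp: index_pairs_def)
    then show "integrable M (\<lambda>\<omega>. (\<Prod>k\<in>S. ent (index_pairs ms i k) \<omega>) / ?c ^ card S)"
      by (intro integrable_divide_zero integrable_prod_entries[OF finS])
  qed simp
  also have "\<dots> = (\<Sum>i\<in>PiE S (\<lambda>_. {..<N}). of_nat (card (compatible_pairings (index_pairs ms i) S)) / ?c ^ card S)"
  proof (intro sum.cong refl arg_cong2[of _ _ _ _ divide] Wick_formula[OF finS])
    show "index_pairs ms i k \<in> {..<N} \<times> {..<N}" if "i \<in> PiE S (\<lambda>_. {..<N})" "k \<in> S" for i k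
      using that gS[OF that(2)] by (auto simp: index_pairs_def)
  qed
  finally show ?thesis by (simp add: sum_divide_distrib)
qed

end

section \<open>Moebius inversion over partitions\<close>

text \<open>Value of the Moebius function of the partition lattice between a partition into
  \<open>k\<close> blocks and the one-block partition, the weight in
  \<open>cumulant\<close>.\<close>

definition moebius_weight :: "nat \<Rightarrow> complex" where
  "moebius_weight k = (- 1) ^ (k - 1) * fact (k - 1)"

text \<open>A partition of \<open>insert x A\<close> is a partition of \<open>A\<close> together
  with a place for \<open>x\<close>: a block \<open>b\<close> to join, or \<open>b = {}\<close> for
  a new singleton. The code \<open>{}\<close> is unambiguous because it is never a block.
  Conversely, delete \<open>x\<close> and discard a block that becomes empty.\<close>

lemma bij_betw_partition_on_insert:
  assumes "x \<notin> A"
  shows "bij_betw (\<lambda>(P, b). insert (insert x b) (P - {b}))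
    (SIGMA P:{P. partition_on A P}. insert {} P) {P. partition_on (insert x A) P}"
proof (rule bij_betw_byWitness[where
    f' = "\<lambda>P. ((\<lambda>B. B - {x}) ` P - {{}}, \<Union>{B \<in> P. x \<in> B} - {x})"])
  show "\<forall>a\<in>SIGMA P:{P. partition_on A P}. insert {} P.
     (\<lambda>P. ((\<lambda>B. B - {x}) ` P - {{}}, \<Union>{B \<in> P. x \<in> B} - {x})) ((\<lambda>(P, b). insert (insert x b) (P - {b})) a) = a"
  proof
    fix a assume "a \<in> (SIGMA P:{P. partition_on A P}. insert {} P)"
    then obtain P b where a: "a = (P, b)" and P: "partition_on A P" and b: "b \<in> insert {} P"
      by auto
    have x: "x \<notin> B" if "B \<in> P" for B using that assms partition_onD1[OF P] by auto
    have ne: "{} \<notin> P" using partition_onD3[OF P] .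
    have xb: "x \<notin> b" using b x by auto
    have "(\<lambda>B. B - {x}) ` (P - {b}) = (\<lambda>B. B) ` (P - {b})"
      using x by (intro image_cong) auto
    then have "(\<lambda>B. B - {x}) ` insert (insert x b) (P - {b}) - {{}} = P"
      using b xb ne by auto
    moreover have "{B \<in> insert (insert x b) (P - {b}). x \<in> B} = {insert x b}"
      using x by auto
    ultimately show "(\<lambda>P. ((\<lambda>B. B - {x}) ` P - {{}}, \<Union>{B \<in> P. x \<in> B} - {x}))
        ((\<lambda>(P, b). insert (insert x b) (P - {b})) a) = a"
      using xb unfolding a by simp
  qed
  \<comment> \<open>Normal form of a partition in the target: the block of \<open>x\<close>, written
    \<open>insert x b\<close>, and the remaining blocks \<open>Q\<close>.\<close>
  have decomp: "\<exists>b Q. P = insert (insert x b) Q \<and> x \<notin> b \<and> (\<forall>B\<in>Q. x \<notin> B \<and> B \<inter> b = {} \<and> B \<noteq> {})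
      \<and> disjoint Q \<and> A = b \<union> \<Union>Q" if P: "partition_on (insert x A) P" for P
  proof -
    obtain p where p: "p \<in> P" "x \<in> p" using partition_onD1[OF P] by auto
    have d: "B \<inter> p = {}" if "B \<in> P" "B \<noteq> p" for B
      using partition_onD2[OF P] that p by (auto simp: disjoint_def)
    have "P = insert (insert x (p - {x})) (P - {p})" using p insert_absorb[of x p] by auto
    moreover have "\<forall>B\<in>P - {p}. x \<notin> B \<and> B \<inter> (p - {x}) = {} \<and> B \<noteq> {}"
      using d p partition_onD3[OF P] by fastforce
    moreover have "disjoint (P - {p})"
      using partition_onD2[OF P] by (auto simp: disjoint_def)
    moreover have "A = (p - {x}) \<union> \<Union>(P - {p})"
    proof
      show "A \<subseteq> (p - {x}) \<union> \<Union>(P - {p})" using partition_onD1[OF P] assms by blast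
      have "y \<noteq> x" if "B \<in> P - {p}" "y \<in> B" for y B using d[of B] p that by auto
      then show "(p - {x}) \<union> \<Union>(P - {p}) \<subseteq> A" using partition_onD1[OF P] p by blast
    qed
    ultimately show ?thesis by (intro exI[of _ "p - {x}"] exI[of _ "P - {p}"]) auto
  qed
  have inv: "(\<lambda>B. B - {x}) ` insert (insert x b) Q - {{}} = Q \<union> ({b} - {{}})
      \<and> \<Union>{B \<in> insert (insert x b) Q. x \<in> B} - {x} = b"
    if "x \<notin> b" "\<forall>B\<in>Q. x \<notin> B \<and> B \<inter> b = {} \<and> B \<noteq> {}" for b Q
  proof -
    have "(\<lambda>B. B - {x}) ` Q = (\<lambda>B. B) ` Q" using that by (intro image_cong) auto
    moreover have "{B \<in> insert (insert x b) Q. x \<in> B} = {insert x b}" using that by auto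
    ultimately show ?thesis using that by auto
  qed
  show "\<forall>a'\<in>{P. partition_on (insert x A) P}. (\<lambda>(P, b). insert (insert x b) (P - {b}))
      ((\<lambda>P. ((\<lambda>B. B - {x}) ` P - {{}}, \<Union>{B \<in> P. x \<in> B} - {x})) a') = a'"
  proof (intro ballI, unfold mem_Collect_eq)
    fix P assume "partition_on (insert x A) P"
    from decomp[OF this] obtain b Q where P: "P = insert (insert x b) Q" and *: "x \<notin> b"
      "\<forall>B\<in>Q. x \<notin> B \<and> B \<inter> b = {} \<and> B \<noteq> {}" by auto
    have "b \<notin> Q" using * by auto
    then show "(\<lambda>(P, b). insert (insert x b) (P - {b}))
      ((\<lambda>P. ((\<lambda>B. B - {x}) ` P - {{}}, \<Union>{B \<in> P. x \<in> B} - {x})) P) = P"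
      unfolding P using inv[OF *] by auto
  qed
  show "(\<lambda>(P, b). insert (insert x b) (P - {b})) ` (SIGMA P:{P. partition_on A P}. insert {} P)
      \<subseteq> {P. partition_on (insert x A) P}"
  proof clarify
    fix P b assume P: "partition_on A P" and b: "b \<in> insert {} P"
    have d: "b \<inter> B = {}" if "B \<in> P - {b}" for B
      using partition_onD2[OF P] b that by (auto simp: disjoint_def)
    have bA: "b \<subseteq> A" using partition_onD1[OF P] b by auto
    have "disjnt (insert x b) (\<Union>(P - {b}))"
      using d assms partition_onD1[OF P] by (auto simp: disjnt_iff)
    moreover have "partition_on (insert x A - insert x b) (P - {b})"
    proof (rule partition_onI)
      show "\<Union>(P - {b}) = insert x A - insert x b"
        using d assms partition_onD1[OF P] by blast
      show "disjnt p q" if "p \<in> P - {b}" "q \<in> P - {b}" "p \<noteq> q" for p q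
        using partition_onD2[OF P] that by (auto simp: pairwise_def)
      show "{} \<notin> P - {b}" using partition_onD3[OF P] by auto
    qed
    ultimately show "partition_on (insert x A) (insert (insert x b) (P - {b}))"
      using bA by (auto simp: partition_on_insert)
  qed
  show "(\<lambda>P. ((\<lambda>B. B - {x}) ` P - {{}}, \<Union>{B \<in> P. x \<in> B} - {x})) ` {P. partition_on (insert x A) P}
      \<subseteq> (SIGMA P:{P. partition_on A P}. insert {} P)"
  proof (rule image_subsetI, unfold mem_Collect_eq)
    fix P assume "partition_on (insert x A) P"
    from decomp[OF this] obtain b Q where P: "P = insert (insert x b) Q" and *: "x \<notin> b"
      "\<forall>B\<in>Q. x \<notin> B \<and> B \<inter> b = {} \<and> B \<noteq> {}" and Q: "disjoint Q" "A = b \<union> \<Union>Q" by auto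
    have "partition_on A (Q \<union> ({b} - {{}}))"
    proof (cases "b = {}")
      case False
      have "disjnt b (\<Union>Q)" using *(2) by (auto simp: disjnt_iff)
      moreover have "partition_on (A - b) Q"
      proof (rule partition_onI)
        show "\<Union>Q = A - b" using *(2) Q(2) by blast
        show "disjnt p q" if "p \<in> Q" "q \<in> Q" "p \<noteq> q" for p q
          using Q(1) that by (auto simp: pairwise_def)
        show "{} \<notin> Q" using *(2) by blast
      qed
      ultimately have "partition_on A (insert b Q)"
        using False Q(2) by (simp add: partition_on_insert)
      then show ?thesis using False by simp
    next
      case True
      then show ?thesis using * Q by (auto simp: partition_on_def)
    qed
    then show "((\<lambda>B. B - {x}) ` P - {{}}, \<Union>{B \<in> P. x \<in> B} - {x}) \<in> (SIGMA P:{P. partition_on A P}. insert {} P)"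
      unfolding P using inv[OF *] by auto
  qed
qed

text \<open>A partition into k blocks extends by a new element in one way to k + 1 blocks and in k
  ways to k blocks, and for positive k the weight of k + 1 is -k times that of k. Everything cancels
  unless the smaller set is empty.\<close>

lemma sum_moebius_weight:
  assumes "finite A" "A \<noteq> {}"
  shows "(\<Sum>P | partition_on A P. moebius_weight (card P)) = (if card A = 1 then 1 else 0)"
proof -
  obtain x A' where A: "A = insert x A'" "x \<notin> A'" using assms(2) by (metis ex_in_conv mk_disjoint_insert)
  have fin: "finite A'" using assms A by simp
  have "(\<Sum>P | partition_on A P. moebius_weight (card P))
      = (\<Sum>(P, b)\<in>(SIGMA P:{P. partition_on A' P}. insert {} P). moebius_weight (card (insert (insert x b) (P - {b}))))"
    unfolding A(1)
    by (subst sum.reindex_bij_betw[OF bij_betw_partition_on_insert[OF A(2)], symmetric]) (simp add: split_def)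
  also have "\<dots> = (\<Sum>P | partition_on A' P. \<Sum>b\<in>insert {} P. moebius_weight (card (insert (insert x b) (P - {b}))))"
    using finitely_many_partition_on[OF fin] finite_elements[OF fin] by (subst sum.Sigma) auto
  also have "\<dots> = (\<Sum>P | partition_on A' P. moebius_weight (Suc (card P)) + of_nat (card P) * moebius_weight (card P))"
  proof (intro sum.cong refl)
    fix P assume "P \<in> {P. partition_on A' P}"
    then have P: "partition_on A' P" by simp
    have fP: "finite P" using finite_elements[OF fin P] .
    have x: "insert x b \<notin> P" for b using A(2) partition_onD1[OF P] by auto
    \<comment> \<open>Joining a block keeps the number of blocks; the choice \<open>{}\<close> is
      not in \<open>P\<close> and adds one.\<close>
    have "card (insert (insert x b) (P - {b})) = (if b \<in> P then card P else Suc (card P))" for b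
      using fP x[of b] card_gt_0_iff[of P] by (auto simp: card_insert_if)
    moreover have card_x: "card (insert {x} P) = Suc (card P)" using fP x[of "{}"] by simp
    ultimately show "(\<Sum>b\<in>insert {} P. moebius_weight (card (insert (insert x b) (P - {b}))))
        = moebius_weight (Suc (card P)) + of_nat (card P) * moebius_weight (card P)"
      using fP partition_onD3[OF P] by (subst sum.insert) (simp_all add: card_x)
  qed
  also have "\<dots> = (\<Sum>P | partition_on A' P. if A' = {} then 1 else 0)"
  proof (intro sum.cong refl)
    fix P assume "P \<in> {P. partition_on A' P}"
    then have P: "partition_on A' P" by simp
    have "card P = 0 \<longleftrightarrow> A' = {}"
      using finite_elements[OF fin P] partition_onD1[OF P] P by (cases "A' = {}") (auto simp: partition_on_empty)
    then show "moebius_weight (Suc (card P)) + of_nat (card P) * moebius_weight (card P) = (if A' = {} then 1 else 0)"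
      by (cases "card P") (auto simp: moebius_weight_def algebra_simps)
  qed
  also have "\<dots> = (if card A = 1 then 1 else 0)"
    using A fin by (cases "A' = {}") (auto simp: partition_on_empty)
  finally show ?thesis .
qed

text \<open>Partitions whose blocks are unions of fibres of \<open>q\<close> are the preimages of
  the partitions of its image, with the same number of blocks.\<close>

lemma sum_moebius_weight_coarser:
  assumes "finite A" "A \<noteq> {}"
  shows "(\<Sum>P | partition_on A P \<and> (\<forall>B\<in>P. \<forall>a\<in>B. \<forall>a'\<in>A. q a = q a' \<longrightarrow> a' \<in> B). moebius_weight (card P))
    = (if card (q ` A) = 1 then 1 else 0)"
proof -
  let ?D = "{P. partition_on A P \<and> (\<forall>B\<in>P. \<forall>a\<in>B. \<forall>a'\<in>A. q a = q a' \<longrightarrow> a' \<in> B)}"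
  let ?f = "\<lambda>b. {a \<in> A. q a \<in> b}"
  have qf: "q ` ?f b = b" if "b \<subseteq> q ` A" for b using that by auto
  have "(\<Sum>P\<in>?D. moebius_weight (card P)) = (\<Sum>P | partition_on (q ` A) P. moebius_weight (card P))"
  proof (rule sum.reindex_bij_witness[where i = "\<lambda>P. ?f ` P" and j = "\<lambda>P. (`) q ` P"])
    fix P assume P: "P \<in> ?D"
    then have pP: "partition_on A P" by simp
    have sub: "B \<subseteq> A" if "B \<in> P" for B using that partition_onD1[OF pP] by auto
    have fq: "?f (q ` B) = B" if "B \<in> P" for B
    proof
      show "?f (q ` B) \<subseteq> B"
      proof
        fix a assume "a \<in> ?f (q ` B)"
        then obtain a' where "a' \<in> B" "q a' = q a" "a \<in> A" by auto
        then show "a \<in> B" using P that by blast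
      qed
      show "B \<subseteq> ?f (q ` B)" using sub[OF that] by auto
    qed
    then show "?f ` (`) q ` P = P" by (simp add: image_image)
    have "partition_on (q ` A) ((`) q ` P)"
    proof (rule partition_onI)
      show "\<Union>((`) q ` P) = q ` A" using partition_onD1[OF pP] by auto
      show "{} \<notin> (`) q ` P" using partition_onD3[OF pP] by auto
      fix p p' assume p: "p \<in> (`) q ` P" "p' \<in> (`) q ` P" "p \<noteq> p'"
      then obtain B B' where B: "p = q ` B" "p' = q ` B'" "B \<in> P" "B' \<in> P" by auto
      then have "B \<inter> B' = {}" using p partition_onD2[OF pP] by (auto simp: disjoint_def)
      then have "q a \<noteq> q a'" if "a \<in> B" "a' \<in> B'" for a a'
        using that P B(3) sub[OF B(4)] by blast
      then show "disjnt p p'" unfolding B disjnt_iff by blast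
    qed
    then show "(`) q ` P \<in> {P. partition_on (q ` A) P}" by simp
    have "inj_on ((`) q) P" by (rule inj_on_inverseI[where g = ?f]) (rule fq)
    then show "moebius_weight (card ((`) q ` P)) = moebius_weight (card P)"
      by (simp add: card_image)
  next
    fix P assume "P \<in> {P. partition_on (q ` A) P}"
    then have pP: "partition_on (q ` A) P" by simp
    have sub: "b \<subseteq> q ` A" if "b \<in> P" for b using that partition_onD1[OF pP] by auto
    show "(`) q ` ?f ` P = P" using qf[OF sub] by (simp add: image_image)
    have "partition_on A (?f ` P)"
    proof (rule partition_onI)
      show "\<Union>(?f ` P) = A" using partition_onD1[OF pP] by auto
      have "?f b \<noteq> {}" if "b \<in> P" for b
        using qf[OF sub[OF that]] partition_onD3[OF pP] that by (metis image_empty)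
      then show "{} \<notin> ?f ` P" by blast
      fix p p' assume p: "p \<in> ?f ` P" "p' \<in> ?f ` P" "p \<noteq> p'"
      then obtain b b' where b: "p = ?f b" "p' = ?f b'" "b \<in> P" "b' \<in> P" by auto
      then have "b \<inter> b' = {}" using p partition_onD2[OF pP] by (auto simp: disjoint_def)
      then show "disjnt p p'" using b by (auto simp: disjnt_iff)
    qed
    then show "?f ` P \<in> ?D" by auto
  qed
  also have "\<dots> = (if card (q ` A) = 1 then 1 else 0)"
    using assms by (intro sum_moebius_weight) auto
  finally show ?thesis .
qed

section \<open>Orbits of the generated group and the blocks they join\<close>

definition linked :: "nat list \<Rightarrow> (nat \<Rightarrow> nat) \<Rightarrow> nat \<Rightarrow> nat \<Rightarrow> bool" where
  "linked ms \<pi> k l \<longleftrightarrow> (\<exists>\<sigma>\<in>generate (sym_group (sum_list ms)) {\<pi>, gamma_perm ms}. \<sigma> k = l)"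

context
  fixes ms :: "nat list" and \<pi> :: "nat \<Rightarrow> nat"
  assumes pos: "\<And>m. m \<in> set ms \<Longrightarrow> m \<ge> 1" and ne: "ms \<noteq> []"
    and \<pi>: "\<pi> permutes {1..sum_list ms}" and \<gamma>: "gamma_perm ms permutes {1..sum_list ms}"
begin

lemma linked_refl: "linked ms \<pi> k k"
  unfolding linked_def using generate.one[of "sym_group (sum_list ms)"] by (metis id_apply sym_group_one)

lemma linked_trans: "linked ms \<pi> j k \<Longrightarrow> linked ms \<pi> k l \<Longrightarrow> linked ms \<pi> j l"
  unfolding linked_def
proof (elim bexE)
  fix \<sigma> \<tau> assume "\<sigma> \<in> generate (sym_group (sum_list ms)) {\<pi>, gamma_perm ms}" "\<sigma> j = k"
    "\<tau> \<in> generate (sym_group (sum_list ms)) {\<pi>, gamma_perm ms}" "\<tau> k = l"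
  then show "\<exists>\<sigma>\<in>generate (sym_group (sum_list ms)) {\<pi>, gamma_perm ms}. \<sigma> j = l"
    using generate.eng[of \<tau> "sym_group (sum_list ms)" "{\<pi>, gamma_perm ms}" \<sigma>]
    by (intro bexI[of _ "\<tau> \<circ> \<sigma>"]) (auto simp: sym_group_mult)
qed

lemma generators_carrier: "{\<pi>, gamma_perm ms} \<subseteq> carrier (sym_group (sum_list ms))"
  using \<pi> \<gamma> by (simp add: sym_group_carrier)

lemma linked_sym: "linked ms \<pi> k l \<Longrightarrow> linked ms \<pi> l k"
  unfolding linked_def
proof (elim bexE)
  let ?G = "sym_group (sum_list ms)"
  interpret group ?G by (rule sym_group_is_group)
  fix \<sigma> assume s: "\<sigma> \<in> generate ?G {\<pi>, gamma_perm ms}" "\<sigma> k = l"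
  then have c: "\<sigma> \<in> carrier ?G" using generate_in_carrier[OF generators_carrier] by blast
  then have p: "\<sigma> permutes {1..sum_list ms}" by (simp add: sym_group_carrier)
  have "inv\<^bsub>?G\<^esub> \<sigma> \<in> generate ?G {\<pi>, gamma_perm ms}"
    using generate_m_inv_closed[OF generators_carrier s(1)] .
  moreover have "(inv\<^bsub>?G\<^esub> \<sigma>) l = k"
    using c s(2) p by (metis permutes_inverses(2) sym_group_inv_equality)
  ultimately show "\<exists>\<sigma>\<in>generate ?G {\<pi>, gamma_perm ms}. \<sigma> l = k" by blast
qed

lemma linked_step: "linked ms \<pi> k (\<pi> k)" "linked ms \<pi> k (gamma_perm ms k)"
  unfolding linked_def by (auto intro: generate.incl)

text \<open>Induction over the generated group. Inverses of generators are covered because an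
  injective map of a finite set into itself is onto, so its inverse preserves the set too.\<close>

lemma linked_invariant:
  assumes "linked ms \<pi> k l" "k \<in> T" "T \<subseteq> {1..sum_list ms}" "\<pi> ` T \<subseteq> T" "gamma_perm ms ` T \<subseteq> T"
  shows "l \<in> T"
proof -
  obtain \<sigma> where \<sigma>: "\<sigma> \<in> generate (sym_group (sum_list ms)) {\<pi>, gamma_perm ms}" "\<sigma> k = l"
    using assms(1) by (auto simp: linked_def)
  have fin: "finite T" using assms(3) by (rule finite_subset) simp
  from \<sigma>(1) have "\<sigma> ` T \<subseteq> T"
  proof induction
    case (inv h)
    then have h: "h permutes {1..sum_list ms}" "h ` T \<subseteq> T" using \<pi> \<gamma> assms by auto
    then have "h ` T = T"
      using fin by (metis endo_inj_surj permutes_inj_on)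
    then have "(inv_into UNIV h) ` T \<subseteq> T"
      using permutes_inverses(2)[OF h(1)] by (metis image_inv_f_f permutes_inj[OF h(1)] subset_refl)
    then show ?case using h(1) by (simp add: sym_group_carrier)
  qed (use assms in \<open>auto simp: sym_group_one sym_group_mult\<close>)
  then show ?thesis using \<sigma>(2) assms(2) by auto
qed

definition block_start :: "nat \<Rightarrow> nat" where
  "block_start j = sum_list (take j ms) + 1"

lemma block_start_in: "j < length ms \<Longrightarrow> block_start j \<in> block ms j"
  using pos[OF nth_mem, of j] by (simp add: block_def block_start_def)

text \<open>Steps of \<open>gamma_perm\<close> lead from the start of a block to all its elements,
  so one representative per block decides all links.\<close>

lemma linked_block_start: "j < length ms \<Longrightarrow> k \<in> block ms j \<Longrightarrow> linked ms \<pi> (block_start j) k"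
proof -
  assume j: "j < length ms" and "k \<in> block ms j"
  then have n: "k = block_start j + (k - block_start j)" "k - block_start j < ms ! j"
    by (auto simp: block_def block_start_def)
  have "linked ms \<pi> (block_start j) (block_start j + n)" if "n < ms ! j" for n
    using that
  proof (induction n)
    case 0 show ?case using linked_refl by simp
  next
    case (Suc n)
    have "gamma_perm ms (block_start j + n) = block_start j + Suc n"
      using Suc.prems by (subst gamma_perm_block[OF j]) (auto simp: block_def block_start_def)
    then show ?case using linked_trans[OF Suc.IH linked_step(2)] Suc.prems by simp
  qed
  from this[OF n(2)] show ?thesis using n(1) by simp
qed

lemma obtain_block: "k \<in> {1..sum_list ms} \<Longrightarrow> \<exists>j<length ms. k \<in> block ms j"
  using UN_block[of ms] by blast

text \<open>As a function of the block number \<open>j\<close>, this plays the role of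
  \<open>q\<close> in \<open>sum_moebius_weight_coarser\<close>: its fibres are the sets of blocks
  joined by the generated group.\<close>

definition link_class :: "nat \<Rightarrow> nat set" where
  "link_class j = {k. linked ms \<pi> (block_start j) k}"

lemma link_class_eq_iff: "link_class i = link_class j \<longleftrightarrow> linked ms \<pi> (block_start i) (block_start j)"
proof
  assume "link_class i = link_class j"
  then show "linked ms \<pi> (block_start i) (block_start j)"
    unfolding link_class_def using linked_refl[of "block_start j"] by blast
next
  assume "linked ms \<pi> (block_start i) (block_start j)"
  then show "link_class i = link_class j"
    unfolding link_class_def using linked_trans linked_sym by blast
qed

text \<open>A union of blocks is always invariant under \<open>gamma_perm\<close>. Invariance under
  \<pi> thus makes it a union of orbits of the generated group, which contains every block linked to
  one of its own.\<close>

lemma respects_iff_coarser: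
  assumes "partition_on {..<length ms} P"
  shows "(\<forall>B\<in>P. \<pi> ` (\<Union>j\<in>B. block ms j) \<subseteq> (\<Union>j\<in>B. block ms j)) \<longleftrightarrow>
    (\<forall>B\<in>P. \<forall>a\<in>B. \<forall>a'\<in>{..<length ms}. link_class a = link_class a' \<longrightarrow> a' \<in> B)"
proof -
  have "(\<pi> ` (\<Union>j\<in>B. block ms j) \<subseteq> (\<Union>j\<in>B. block ms j)) \<longleftrightarrow>
      (\<forall>a\<in>B. \<forall>a'\<in>{..<length ms}. link_class a = link_class a' \<longrightarrow> a' \<in> B)" if "B \<in> P" for B
  proof -
    have B: "B \<subseteq> {..<length ms}" using that partition_onD1[OF assms] by auto
    let ?S = "\<Union>j\<in>B. block ms j"
    have S: "?S \<subseteq> {1..sum_list ms}" using B UN_block[of ms] by blast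
    have "gamma_perm ms k \<in> ?S" if "k \<in> ?S" for k
      using that B gamma_perm_in_block[of _ ms k] by blast
    then have \<gamma>S: "gamma_perm ms ` ?S \<subseteq> ?S" by blast
    show ?thesis
    proof (intro iffI ballI impI)
      fix a a' assume inv: "\<pi> ` ?S \<subseteq> ?S" and a: "a \<in> B" "a' \<in> {..<length ms}" "link_class a = link_class a'"
      have "linked ms \<pi> (block_start a) (block_start a')" using a by (simp add: link_class_eq_iff)
      moreover have "block_start a \<in> ?S" using a B block_start_in[of a] by blast
      ultimately have "block_start a' \<in> ?S" using linked_invariant[OF _ _ S inv \<gamma>S] by blast
      then obtain b where "b \<in> B" "block_start a' \<in> block ms b" by auto
      then show "a' \<in> B" using block_disjoint[of a' ms b] block_start_in[of a'] a B by auto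
    next
      assume c: "\<forall>a\<in>B. \<forall>a'\<in>{..<length ms}. link_class a = link_class a' \<longrightarrow> a' \<in> B"
      show "\<pi> ` ?S \<subseteq> ?S"
      proof (rule image_subsetI)
        fix k assume k: "k \<in> ?S"
        then obtain a where a: "a \<in> B" "k \<in> block ms a" by auto
        have "\<pi> k \<in> {1..sum_list ms}" using k S \<pi> by (metis permutes_in_image subsetD)
        then obtain a' where a': "a' < length ms" "\<pi> k \<in> block ms a'" using obtain_block by blast
        have "linked ms \<pi> (block_start a) (block_start a')"
          using linked_block_start[of a k] linked_block_start[of a' "\<pi> k"] linked_step(1)[of k] a a' B
          by (meson lessThan_iff linked_sym linked_trans subsetD)
        then have "a' \<in> B" using c a a' by (simp add: link_class_eq_iff)
        then show "\<pi> k \<in> ?S" using a' by blast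
      qed
    qed
  qed
  then show ?thesis by simp
qed

text \<open>Each block lies in one orbit, so transitivity can be tested on block starts.
  Nonemptiness of \<open>ms\<close> gives at least one class.\<close>

lemma transitive_pair_iff: "transitive_pair (sum_list ms) \<pi> (gamma_perm ms) \<longleftrightarrow> card (link_class ` {..<length ms}) = 1"
proof -
  have "transitive_pair (sum_list ms) \<pi> (gamma_perm ms) \<longleftrightarrow> (\<forall>i\<in>{1..sum_list ms}. \<forall>j\<in>{1..sum_list ms}. linked ms \<pi> i j)"
    by (simp add: transitive_pair_def linked_def)
  also have "\<dots> \<longleftrightarrow> (\<forall>a<length ms. \<forall>b<length ms. link_class a = link_class b)"
  proof (intro iffI allI impI ballI)
    fix a b assume *: "\<forall>i\<in>{1..sum_list ms}. \<forall>j\<in>{1..sum_list ms}. linked ms \<pi> i j" "a < length ms" "b < length ms"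
    have "block_start a \<in> {1..sum_list ms}" "block_start b \<in> {1..sum_list ms}"
      using block_start_in[OF *(2)] block_start_in[OF *(3)] *(2,3) UN_block[of ms] by blast+
    then show "link_class a = link_class b" using * by (simp add: link_class_eq_iff)
  next
    fix k l assume *: "\<forall>a<length ms. \<forall>b<length ms. link_class a = link_class b"
      "k \<in> {1..sum_list ms}" "l \<in> {1..sum_list ms}"
    obtain a b where ab: "a < length ms" "k \<in> block ms a" "b < length ms" "l \<in> block ms b"
      using obtain_block *(2,3) by meson
    have "linked ms \<pi> (block_start a) (block_start b)" using * ab link_class_eq_iff by blast
    then show "linked ms \<pi> k l"
      using linked_block_start[OF ab(1,2)] linked_block_start[OF ab(3,4)] linked_sym linked_trans by blast
  qed
  also have "\<dots> \<longleftrightarrow> card (link_class ` {..<length ms}) = 1"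
  proof
    assume *: "\<forall>a<length ms. \<forall>b<length ms. link_class a = link_class b"
    then have "link_class a = link_class 0" if "a < length ms" for a
      using that ne by (metis length_greater_0_conv)
    then have "link_class ` {..<length ms} = {link_class 0}" 
    proof -
      have "link_class ` {..<length ms} = (\<lambda>_. link_class 0) ` {..<length ms}"
        using \<open>\<And>a. a < length ms \<Longrightarrow> link_class a = link_class 0\<close> by (intro image_cong) auto
      also have "\<dots> = {link_class 0}" using ne by (simp add: image_constant_conv lessThan_empty_iff)
      finally show ?thesis .
    qed
    then show "card (link_class ` {..<length ms}) = 1" by simp
  next
    assume "card (link_class ` {..<length ms}) = 1"
    then obtain c where "link_class ` {..<length ms} = {c}" by (auto simp: card_1_singleton_iff)
    then show "\<forall>a<length ms. \<forall>b<length ms. link_class a = link_class b" by (metis imageI lessThan_iff singletonD)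
  qed
  finally show ?thesis .
qed

text \<open>For fixed \<pi> the respected partitions are those coarser than the partition into link
  classes, so the Moebius sum detects whether there is just one class. This is the cancellation that
  leaves only transitive pairings.\<close>

lemma sum_moebius_weight_respects:
  "(\<Sum>P | partition_on {..<length ms} P \<and> (\<forall>B\<in>P. \<pi> ` (\<Union>j\<in>B. block ms j) \<subseteq> (\<Union>j\<in>B. block ms j)).
      moebius_weight (card P)) = (if transitive_pair (sum_list ms) \<pi> (gamma_perm ms) then 1 else 0)"
proof -
  have "{P. partition_on {..<length ms} P \<and> (\<forall>B\<in>P. \<pi> ` (\<Union>j\<in>B. block ms j) \<subseteq> (\<Union>j\<in>B. block ms j))}
      = {P. partition_on {..<length ms} P \<and>
        (\<forall>B\<in>P. \<forall>a\<in>B. \<forall>a'\<in>{..<length ms}. link_class a = link_class a' \<longrightarrow> a' \<in> B)}"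
    by (rule Collect_cong) (use respects_iff_coarser in \<open>simp cong: conj_cong\<close>)
  then show ?thesis
    using sum_moebius_weight_coarser[of "{..<length ms}" link_class] ne
    by (simp add: transitive_pair_iff lessThan_empty_iff)
qed

end

section \<open>The genus inequality\<close>

lemma self_in_orbit: "finite S \<Longrightarrow> \<sigma> permutes S \<Longrightarrow> k \<in> orbit \<sigma> k"
  by (intro permutation_self_in_orbit) (auto simp: permutation_permutes)

lemma orbit_eq: "finite S \<Longrightarrow> \<sigma> permutes S \<Longrightarrow> l \<in> orbit \<sigma> k \<Longrightarrow> orbit \<sigma> l = orbit \<sigma> k"
  by (metis cyclic_on_orbit orbit_cyclic_eq3 permutation_permutes)

text \<open>Invariant functions are constant on orbits, so they correspond to functions on the set
  of orbits. The value \<open>d\<close> fixes the function off \<open>S\<close>; it is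
  \<open>0\<close> for bit functions and \<open>undefined\<close> for index functions in
  \<open>PiE\<close>.\<close>

lemma card_invariant_functions:
  assumes "finite S" "\<sigma> permutes S"
  shows "card {f. (\<forall>k\<in>S. f k \<in> T \<and> f (\<sigma> k) = f k) \<and> (\<forall>k. k \<notin> S \<longrightarrow> f k = d)}
    = card T ^ card (orbit \<sigma> ` S)"
proof -
  let ?O = "orbit \<sigma> ` S"
  let ?F = "{f. (\<forall>k\<in>S. f k \<in> T \<and> f (\<sigma> k) = f k) \<and> (\<forall>k. k \<notin> S \<longrightarrow> f k = d)}"
  have const: "f l = f k" if "f \<in> ?F" "k \<in> S" "l \<in> orbit \<sigma> k" for f k l
  proof -
    have "l \<in> S \<and> f l = f k" using that(3)
    proof induction
      case base
      then show ?case using that assms(2) by (auto simp: permutes_in_image)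
    next
      case (step y)
      then show ?case using that assms(2) by (auto simp: permutes_in_image)
    qed
    then show ?thesis by simp
  qed
  have self: "k \<in> orbit \<sigma> k" for k by (rule self_in_orbit[OF assms])
  have some: "(SOME l. l \<in> orbit \<sigma> k) \<in> orbit \<sigma> k" for k
    using self[of k] by (rule someI)
  have orbit_sub: "l \<in> S" if "l \<in> orbit \<sigma> k" "k \<in> S" for k l
    using permutes_orbit_subset[OF assms(2)] that by blast
  have "bij_betw (\<lambda>h k. if k \<in> S then h (orbit \<sigma> k) else d) (PiE ?O (\<lambda>_. T)) ?F"
  proof (rule bij_betw_byWitness[where f' = "\<lambda>f. restrict (\<lambda>P. f (SOME l. l \<in> P)) ?O"])
    show "\<forall>h\<in>PiE ?O (\<lambda>_. T). restrict (\<lambda>P. (\<lambda>k. if k \<in> S then h (orbit \<sigma> k) else d) (SOME l. l \<in> P)) ?O = h"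
    proof (intro ballI ext)
      fix h P assume h: "h \<in> PiE ?O (\<lambda>_. T)"
      show "restrict (\<lambda>P. (\<lambda>k. if k \<in> S then h (orbit \<sigma> k) else d) (SOME l. l \<in> P)) ?O P = h P"
      proof (cases "P \<in> ?O")
        case True
        then obtain k where "k \<in> S" "P = orbit \<sigma> k" by auto
        then show ?thesis using some[of k] orbit_sub[of "SOME l. l \<in> P" k] orbit_eq[OF assms] by auto
      next
        case False
        then show ?thesis using h by (auto simp: PiE_def extensional_def)
      qed
    qed
    show "\<forall>f\<in>?F. (\<lambda>k. if k \<in> S then restrict (\<lambda>P. f (SOME l. l \<in> P)) ?O (orbit \<sigma> k) else d) = f"
      using const some by (auto simp: fun_eq_iff)
    show "(\<lambda>h k. if k \<in> S then h (orbit \<sigma> k) else d) ` PiE ?O (\<lambda>_. T) \<subseteq> ?F"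
    proof (rule image_subsetI)
      fix h assume h: "h \<in> PiE ?O (\<lambda>_. T)"
      have "orbit \<sigma> (\<sigma> k) = orbit \<sigma> k" for k
        by (rule orbit_eq[OF assms]) (rule orbit.base)
      then show "(\<lambda>k. if k \<in> S then h (orbit \<sigma> k) else d) \<in> ?F"
        using h assms(2) by (auto simp: permutes_in_image)
    qed
    show "(\<lambda>f. restrict (\<lambda>P. f (SOME l. l \<in> P)) ?O) ` ?F \<subseteq> PiE ?O (\<lambda>_. T)"
    proof (rule image_subsetI, rule restrict_PiE_iff[THEN iffD2], rule ballI)
      fix f P assume "f \<in> ?F" "P \<in> ?O"
      then obtain k where "k \<in> S" "P = orbit \<sigma> k" by auto
      then show "f (SOME l. l \<in> P) \<in> T"
        using const[of f k "SOME l. l \<in> P"] some[of k] \<open>f \<in> ?F\<close> by auto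
    qed
  qed
  from bij_betw_same_card[OF this] show ?thesis using assms(1) by (simp add: card_PiE)
qed

text \<open>First isomorphism theorem as a count: all fibres over the image are translates of the
  kernel. Closure under differences is the subgroup condition.\<close>

lemma card_additive_image:
  fixes \<phi> :: "'a :: ab_group_add \<Rightarrow> 'b :: ab_group_add"
  assumes "finite G" and diff: "\<And>x y. x \<in> G \<Longrightarrow> y \<in> G \<Longrightarrow> x - y \<in> G"
    and \<phi>: "\<And>x y. x \<in> G \<Longrightarrow> y \<in> G \<Longrightarrow> \<phi> (x - y) = \<phi> x - \<phi> y"
  shows "card G = card (\<phi> ` G) * card {x \<in> G. \<phi> x = 0}"
proof -
  \<comment> \<open>Sums come from differences alone, as \<open>(y - y) - y\<close> is the negative
    of \<open>y\<close>.\<close>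
  have plus: "x + y \<in> G" if "x \<in> G" "y \<in> G" for x y
    using diff[of x "(y - y) - y"] diff[of y y] diff[of "y - y" y] that by simp
  have fiber: "card {x \<in> G. \<phi> x = \<phi> z} = card {x \<in> G. \<phi> x = 0}" if z: "z \<in> G" for z
  proof (rule bij_betw_same_card[of "\<lambda>x. x - z"], rule bij_betw_byWitness[where f' = "\<lambda>x. x + z"])
    have "\<phi> (x + z) = \<phi> z" if "x \<in> G" "\<phi> x = 0" for x
      using \<phi>[of "x + z" z] plus[OF that(1) z] z that by simp
    then show "(\<lambda>x. x + z) ` {x \<in> G. \<phi> x = 0} \<subseteq> {x \<in> G. \<phi> x = \<phi> z}"
      using plus z by auto
  qed (use diff \<phi> z in auto)
  have "card G = (\<Sum>y\<in>\<phi> ` G. card {x \<in> G. \<phi> x = y})"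
    using sum.group[of G "\<phi> ` G" \<phi> "\<lambda>_. 1 :: nat"] assms(1) by simp
  also have "\<dots> = (\<Sum>y\<in>\<phi> ` G. card {x \<in> G. \<phi> x = 0})"
    using fiber by (intro sum.cong) auto
  finally show ?thesis by simp
qed

text \<open>These rules turn addition of bits into exclusive or, out of reach of the group rules.\<close>

declare minus_bit_def [simp del] uminus_bit_def [simp del] add_bit_eq_xor [simp del]

lemma bit_add_self: "a + a = (0 :: bit)" and bit_diff: "a - b = a + (b :: bit)"
  by (simp add: add_bit_eq_xor) (simp add: minus_bit_def)

lemma bit_fun_add_self [simp]: "f + f = (0 :: 'k \<Rightarrow> bit)"
  by (simp add: fun_eq_iff bit_add_self)

lemma bit_fun_diff: "f - g = (f + g :: 'k \<Rightarrow> bit)"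
  by (simp add: fun_eq_iff bit_diff)

text \<open>With m = \<open>card S\<close>, the kernels of the two coboundary maps consist of the
  functions constant on cycles, so their images \<open>A\<close> and \<open>B\<close> have sizes 2
  to the powers m - #\<pi> and m - #\<gamma>. For \<open>H = A + B\<close> one has |A| |B| = |H| |A
  \<inter> B|. Transitivity enters twice: \<open>H\<close> has index at most 2 among all functions,
  and on the invariant functions of the third permutation the kernel of \<open>\<alpha>\<close> has
  at most two elements. It is phrased through invariant subsets, the form in which both uses need
  it.\<close>

theorem genus_bound:
  assumes S: "finite S" "S \<noteq> {}" and \<pi>: "\<pi> permutes S" and \<gamma>: "\<gamma> permutes S"
    and trans: "\<And>T. T \<subseteq> S \<Longrightarrow> T \<noteq> {} \<Longrightarrow> \<pi> ` T \<subseteq> T \<Longrightarrow> \<gamma> ` T \<subseteq> T \<Longrightarrow> T = S"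
  shows "card (orbit \<pi> ` S) + card (orbit \<gamma> ` S) + card (orbit (inv_into UNIV \<pi> \<circ> \<gamma>) ` S) \<le> card S + 2"
proof -
  let ?q = "inv_into UNIV \<pi>"
  define G where "G = {f :: 'a \<Rightarrow> bit. \<forall>k. k \<notin> S \<longrightarrow> f k = 0}"
  \<comment> \<open>The inverse of \<pi> is used so that, on functions invariant under
    \<open>?q \<circ> \<gamma>\<close>, \<open>\<alpha> f\<close> agrees with
    \<open>\<beta> (f \<circ> ?q)\<close>.\<close>
  define \<alpha> where "\<alpha> f = f - (f \<circ> ?q)" for f :: "'a \<Rightarrow> bit"
  define \<beta> where "\<beta> f = (f \<circ> \<gamma>) - f" for f :: "'a \<Rightarrow> bit"
  have q: "?q permutes S" using \<pi> by (rule permutes_inv)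
  have q\<gamma>: "(?q \<circ> \<gamma>) permutes S" using \<gamma> q by (rule permutes_compose)
  have q1: "?q (\<pi> k) = k" "\<pi> (?q k) = k" for k using permutes_inverses[OF \<pi>] by auto
  have inS: "\<gamma> k \<in> S \<longleftrightarrow> k \<in> S" "?q k \<in> S \<longleftrightarrow> k \<in> S" "\<pi> k \<in> S \<longleftrightarrow> k \<in> S" for k
    using \<gamma> q \<pi> by (simp_all add: permutes_in_image)
  have inv_card: "card {f \<in> G. \<forall>k. f (\<sigma> k) = f k} = 2 ^ card (orbit \<sigma> ` S)" if "\<sigma> permutes S" for \<sigma>
  proof -
    have "{f \<in> G. \<forall>k. f (\<sigma> k) = f k}
        = {f. (\<forall>k\<in>S. f k \<in> UNIV \<and> f (\<sigma> k) = f k) \<and> (\<forall>k. k \<notin> S \<longrightarrow> f k = 0)}"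
      unfolding G_def using permutes_not_in[OF that] by auto
    moreover have "card (UNIV :: bit set) = 2"
    proof -
      have "(UNIV :: bit set) = {0, 1}" using bit_not_zero_iff by auto
      moreover have "card {0, 1 :: bit} = 2" by simp
      ultimately show ?thesis by (simp only:)
    qed
    ultimately show ?thesis using card_invariant_functions[OF S(1) that, of "UNIV :: bit set" 0] by simp
  qed
  \<comment> \<open>The identity permutation has one orbit per point, so the count of invariant
    functions also gives the size of \<open>G\<close>.\<close>
  have cardG: "card G = 2 ^ card S"
  proof -
    have "orbit id x = {x}" for x :: 'a by (simp add: orbit_eq_singleton_iff)
    then have "card (orbit id ` S) = card S" by (simp add: card_image inj_on_def)
    then show ?thesis using inv_card[OF permutes_id] by simp
  qed
  then have finG: "finite G" by (intro card_ge_0_finite) simp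
  have Gdiff: "f - g \<in> G" if "f \<in> G" "g \<in> G" for f g using that by (auto simp: G_def)
  have \<alpha>G: "\<alpha> f \<in> G" and \<beta>G: "\<beta> f \<in> G" if "f \<in> G" for f
    using that inS by (auto simp: G_def \<alpha>_def \<beta>_def)
  have \<alpha>_diff: "\<alpha> (f - g) = \<alpha> f - \<alpha> g" and \<beta>_diff: "\<beta> (f - g) = \<beta> f - \<beta> g" for f g
    by (auto simp: \<alpha>_def \<beta>_def fun_eq_iff)
  define A where "A = \<alpha> ` G"
  define B where "B = \<beta> ` G"
  have fin: "finite A" "finite B" using finG by (auto simp: A_def B_def)
  have Adiff: "f - g \<in> A" if "f \<in> A" "g \<in> A" for f g
    using that Gdiff unfolding A_def by (auto simp flip: \<alpha>_diff)
  have Bdiff: "f - g \<in> B" if "f \<in> B" "g \<in> B" for f g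
    using that Gdiff unfolding B_def by (auto simp flip: \<beta>_diff)
  have "{f \<in> G. \<alpha> f = 0} = {f \<in> G. \<forall>k. f (\<pi> k) = f k}"
    unfolding \<alpha>_def fun_eq_iff by (auto simp: q1) (metis q1)+
  then have cardA: "2 ^ card S = card A * 2 ^ card (orbit \<pi> ` S)"
    using card_additive_image[of G \<alpha>] finG Gdiff \<alpha>_diff inv_card[OF \<pi>] cardG by (simp add: A_def)
  have "{f \<in> G. \<beta> f = 0} = {f \<in> G. \<forall>k. f (\<gamma> k) = f k}"
    by (auto simp: \<beta>_def fun_eq_iff)
  then have cardB: "2 ^ card S = card B * 2 ^ card (orbit \<gamma> ` S)"
    using card_additive_image[of G \<beta>] finG Gdiff \<beta>_diff inv_card[OF \<gamma>] cardG by (simp add: B_def)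
  define H where "H = (\<lambda>(a, b). a + b) ` (A \<times> B)"
  have cardH: "card A * card B = card H * card (A \<inter> B)"
  proof -
    have "card (A \<times> B) = card H * card {p \<in> A \<times> B. (\<lambda>(a, b). a + b) p = 0}"
      unfolding H_def
      using fin Adiff Bdiff by (intro card_additive_image) auto
    \<comment> \<open>In characteristic 2 a sum vanishes exactly on the diagonal, so the kernel of
      addition is a copy of \<open>A \<inter> B\<close>.\<close>
    moreover have "{p \<in> A \<times> B. (\<lambda>(a, b). a + b) p = 0} = (\<lambda>a. (a, a)) ` (A \<inter> B)"
    proof -
      have "a + b = 0 \<longleftrightarrow> a = b" for a b :: "'a \<Rightarrow> bit"
        by (metis bit_fun_diff eq_iff_diff_eq_0)
      then show ?thesis by auto
    qed
    moreover have "card ((\<lambda>a. (a, a)) ` (A \<inter> B)) = card (A \<inter> B)"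
      by (rule card_image) (simp add: inj_on_def)
    ultimately show ?thesis by (simp add: card_cartesian_product)
  qed
  have H_iff: "f \<in> H \<longleftrightarrow> (\<exists>a\<in>A. \<exists>b\<in>B. f = a + b)" for f
    unfolding H_def by force
  have Hdiff: "f - g \<in> H" if fg: "f \<in> H" "g \<in> H" for f g
  proof -
    obtain a b where 1: "a \<in> A" "b \<in> B" "f = a + b" using fg(1) H_iff by auto
    obtain a' b' where 2: "a' \<in> A" "b' \<in> B" "g = a' + b'" using fg(2) H_iff by auto
    have "f - g = (a - a') + (b - b')" by (simp add: 1 2 algebra_simps)
    then show ?thesis unfolding H_iff using Adiff[OF 1(1) 2(1)] Bdiff[OF 1(2) 2(2)] by blast
  qed
  have "0 \<in> G" by (simp add: G_def)
  then have *: "\<alpha> 0 \<in> A" "\<beta> 0 \<in> B" unfolding A_def B_def by blast+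
  have AB0: "0 \<in> A" "0 \<in> B" using Adiff[OF *(1) *(1)] Bdiff[OF *(2) *(2)] by simp_all
  then have H0: "0 \<in> H" unfolding H_iff by (metis add.left_neutral)
  have Hadd: "f + g \<in> H" if "f \<in> H" "g \<in> H" for f g
    using Hdiff[OF that] by (simp only: bit_fun_diff)
  have AH: "f \<in> H" if "f \<in> A \<or> f \<in> B" for f
    using that AB0 unfolding H_iff by (metis add.left_neutral add.right_neutral)
  obtain x0 where x0: "x0 \<in> S" using S(2) by auto
  \<comment> \<open>Point masses. Modulo \<open>H\<close> they all agree with the one at
    \<open>x0\<close>, which is how transitivity bounds the index of \<open>H\<close>.\<close>
  define \<delta> where "\<delta> x = (\<lambda>k. if k = x then 1 else 0 :: bit)" for x :: 'a
  have \<delta>G: "\<delta> x \<in> G" if "x \<in> S" for x using that by (auto simp: \<delta>_def G_def)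
  have \<delta>: "\<delta> x + \<delta> x0 \<in> H" if "x \<in> S" for x
  proof -
    \<comment> \<open>Invariance of this set comes from \<open>\<alpha> (\<delta> x)\<close> and
      \<open>\<beta> (\<delta> (\<gamma> x))\<close>, which are the sums of
      \<open>\<delta> x\<close> with the point masses at \<open>\<pi> x\<close> and
      \<open>\<gamma> x\<close>.\<close>
    let ?T = "{x \<in> S. \<delta> x + \<delta> x0 \<in> H}"
    have "?T = S"
    proof (rule trans)
      show "?T \<noteq> {}" using x0 H0 by auto
      show "\<pi> ` ?T \<subseteq> ?T"
      proof (rule image_subsetI)
        fix x assume x: "x \<in> ?T"
        have "\<delta> x \<circ> ?q = \<delta> (\<pi> x)" using q1 by (auto simp: \<delta>_def fun_eq_iff)
        then have "\<delta> x + \<delta> (\<pi> x) \<in> H"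
          using AH[of "\<alpha> (\<delta> x)"] \<delta>G x by (auto simp: A_def) (simp add: \<alpha>_def bit_fun_diff)
        then have "(\<delta> x + \<delta> (\<pi> x)) + (\<delta> x + \<delta> x0) \<in> H" using x Hadd by blast
        moreover have "(\<delta> x + \<delta> (\<pi> x)) + (\<delta> x + \<delta> x0) = \<delta> (\<pi> x) + \<delta> x0"
          by (simp add: fun_eq_iff add_ac)
        ultimately show "\<pi> x \<in> ?T" using x inS by simp
      qed
      show "\<gamma> ` ?T \<subseteq> ?T"
      proof (rule image_subsetI)
        fix x assume x: "x \<in> ?T"
        have "\<delta> (\<gamma> x) \<circ> \<gamma> = \<delta> x" using permutes_inj[OF \<gamma>] by (auto simp: \<delta>_def fun_eq_iff inj_eq)
        then have "\<delta> x + \<delta> (\<gamma> x) \<in> H"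
          using AH[of "\<beta> (\<delta> (\<gamma> x))"] \<delta>G[of "\<gamma> x"] x inS by (auto simp: B_def) (simp add: \<beta>_def bit_fun_diff)
        then have "(\<delta> x + \<delta> (\<gamma> x)) + (\<delta> x + \<delta> x0) \<in> H" using x Hadd by blast
        moreover have "(\<delta> x + \<delta> (\<gamma> x)) + (\<delta> x + \<delta> x0) = \<delta> (\<gamma> x) + \<delta> x0"
          by (simp add: fun_eq_iff add_ac)
        ultimately show "\<gamma> x \<in> ?T" using x inS by simp
      qed
    qed auto
    then show ?thesis using that by blast
  qed
  \<comment> \<open>Adding a point toggles between \<open>H\<close> and its coset through
    \<open>\<delta> x0\<close>, so the two together contain every indicator function, that is, all
    of \<open>G\<close>.\<close>
  have cover: "(\<lambda>x. if x \<in> U then 1 else 0) \<in> H \<union> (\<lambda>h. h + \<delta> x0) ` H" if "finite U" "U \<subseteq> S" for U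
    using that
  proof (induction U rule: finite_induct)
    case empty
    then show ?case using H0 by (simp add: zero_fun_def)
  next
    case (insert x U)
    let ?u = "\<lambda>U x. if x \<in> U then 1 else 0 :: bit"
    have eq: "?u (insert x U) = (\<delta> x + \<delta> x0) + (?u U + \<delta> x0)"
      using insert.hyps by (auto simp: fun_eq_iff \<delta>_def)
    have d: "\<delta> x + \<delta> x0 \<in> H" using \<delta> insert.prems by auto
    consider "?u U \<in> H" | h where "h \<in> H" "?u U = h + \<delta> x0"
      using insert.IH insert.prems by blast
    then show ?case
    proof cases
      case 1
      have "?u (insert x U) = ((\<delta> x + \<delta> x0) + ?u U) + \<delta> x0" by (simp only: eq add.assoc)
      then show ?thesis using Hadd[OF d 1] by blast
    next
      case 2
      have "?u (insert x U) = (\<delta> x + \<delta> x0) + h"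
        by (simp only: eq 2(2) add.assoc bit_fun_add_self add_0_right)
      then show ?thesis using Hadd[OF d 2(1)] by simp
    qed
  qed
  have "G \<subseteq> H \<union> (\<lambda>h. h + \<delta> x0) ` H"
  proof
    fix f assume f: "f \<in> G"
    have "f = (\<lambda>x. if x \<in> {k\<in>S. f k = 1} then 1 else 0)"
      using f by (auto simp: fun_eq_iff G_def)
    then show "f \<in> H \<union> (\<lambda>h. h + \<delta> x0) ` H"
      using cover[of "{k\<in>S. f k = 1}"] S(1) by simp
  qed
  then have "card G \<le> card (H \<union> (\<lambda>h. h + \<delta> x0) ` H)"
    using fin by (intro card_mono) (auto simp: H_def)
  also have "\<dots> \<le> card H + card H"
    using fin by (intro order.trans[OF card_Un_le] add_mono card_image_le) (auto simp: H_def)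
  finally have G_le: "2 ^ card S \<le> 2 * card H" by (simp add: cardG)
  let ?W = "{f \<in> G. \<forall>k. f ((?q \<circ> \<gamma>) k) = f k}"
  have cardW: "card ?W = 2 ^ card (orbit (?q \<circ> \<gamma>) ` S)" using inv_card[OF q\<gamma>] .
  have W: "card ?W = card (\<alpha> ` ?W) * card {f \<in> ?W. \<alpha> f = 0}"
    using finG Gdiff \<alpha>_diff by (intro card_additive_image) auto
  \<comment> \<open>Invariance says \<open>f \<circ> ?q \<circ> \<gamma> = f\<close>, so both
    coboundary maps produce the same function, from \<open>f\<close> and from
    \<open>f \<circ> ?q\<close>.\<close>
  have "\<alpha> ` ?W \<subseteq> A \<inter> B"
  proof (rule image_subsetI)
    fix f assume f: "f \<in> ?W"
    have "\<alpha> f = \<beta> (f \<circ> ?q)" using f by (auto simp: \<alpha>_def \<beta>_def fun_eq_iff)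
    moreover have "f \<circ> ?q \<in> G" using f inS by (auto simp: G_def)
    ultimately show "\<alpha> f \<in> A \<inter> B" using f unfolding A_def B_def by blast
  qed
  then have W1: "card (\<alpha> ` ?W) \<le> card (A \<inter> B)" using fin by (intro card_mono) auto
  \<comment> \<open>A function in this kernel is invariant under both permutations, so its support
    is empty or all of \<open>S\<close>.\<close>
  have "{f \<in> ?W. \<alpha> f = 0} \<subseteq> {0, \<lambda>k. if k \<in> S then 1 else 0}"
  proof
    fix f assume f: "f \<in> {f \<in> ?W. \<alpha> f = 0}"
    have f1: "f (?q k) = f k" for k
      using f by (auto simp: \<alpha>_def fun_eq_iff)
    have f\<pi>: "f (\<pi> k) = f k" for k using f1[of "\<pi> k"] by (simp add: q1)
    have f\<gamma>: "f (\<gamma> k) = f k" for k using f f1[of "\<gamma> k"] by auto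
    have fS: "f k = 0" if "k \<notin> S" for k using f that by (auto simp: G_def)
    show "f \<in> {0, \<lambda>k. if k \<in> S then 1 else 0}"
    proof (cases "{k\<in>S. f k = 1} = {}")
      case True
      then have "f = 0" using fS by (auto simp: fun_eq_iff)
      then show ?thesis by simp
    next
      case False
      then have "{k\<in>S. f k = 1} = S"
        using f\<pi> f\<gamma> inS by (intro trans) auto
      then have "f = (\<lambda>k. if k \<in> S then 1 else 0)" using fS by (auto simp: fun_eq_iff)
      then show ?thesis by simp
    qed
  qed
  then have "card {f \<in> ?W. \<alpha> f = 0} \<le> card {0, (\<lambda>k. if k \<in> S then 1 else 0 :: bit)}"
    by (intro card_mono) auto
  also have "\<dots> \<le> 2" by (simp add: card_insert_if)
  finally have "card ?W \<le> card (A \<inter> B) * 2" using W W1 by (simp add: mult_le_mono)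
  \<comment> \<open>The two factors 2, from the constant functions and from the index of
    \<open>H\<close>, make the 4 that becomes the summand 2 in the exponent.\<close>
  then have "2 ^ card (orbit (?q \<circ> \<gamma>) ` S) * 2 ^ card S \<le> (card (A \<inter> B) * 2) * (2 * card H)"
    unfolding cardW using G_le by (rule mult_le_mono)
  also have "\<dots> = 4 * (card A * card B)" by (simp add: cardH)
  finally have "2 ^ card (orbit (?q \<circ> \<gamma>) ` S) * 2 ^ card S * (2 ^ card (orbit \<pi> ` S) * 2 ^ card (orbit \<gamma> ` S))
      \<le> 4 * (card A * card B) * (2 ^ card (orbit \<pi> ` S) * 2 ^ card (orbit \<gamma> ` S))"
    by (rule mult_right_mono) simp
  also have "\<dots> = 4 * (2 ^ card S * 2 ^ card S)"
    unfolding cardA[symmetric] by (subst (1) cardA, subst (1) cardB) (simp add: mult_ac)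
  finally have "(2 :: nat) ^ (card (orbit (?q \<circ> \<gamma>) ` S) + card S + card (orbit \<pi> ` S) + card (orbit \<gamma> ` S))
      \<le> 2 ^ (2 + card S + card S)"
    by (simp add: power_add mult_ac)
  then show ?thesis by (subst (asm) power_increasing_iff) auto
qed

section \<open>Cumulants of traces\<close>

lemma consecutive_cycles_permutes: "consecutive_cycles s ms permutes {s + 1..s + sum_list ms}"
proof (induction ms arbitrary: s)
  case (Cons m ms)
  have "cycle_of_list [s + 1..<s + m + 1] permutes set [s + 1..<s + m + 1]"
    by (rule cycle_permutes)
  then have "cycle_of_list [s + 1..<s + m + 1] permutes {s + 1..s + sum_list (m # ms)}"
    by (rule permutes_subset) auto
  moreover have "consecutive_cycles (s + m) ms permutes {s + 1..s + sum_list (m # ms)}"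
    by (rule permutes_subset[OF Cons.IH]) auto
  ultimately show ?case
    unfolding consecutive_cycles.simps by (intro permutes_compose)
qed (simp add: permutes_id)

lemma gamma_perm_permutes: "gamma_perm ms permutes {1..sum_list ms}"
  using consecutive_cycles_permutes[of 0 ms] by (simp add: gamma_perm_def)

lemma orbit_gamma_perm:
  assumes "j < length ms" "k \<in> block ms j"
  shows "orbit (gamma_perm ms) k = block ms j"
proof -
  let ?s = "sum_list (take j ms) + 1"
  note orbit_eq' = orbit_eq[OF finite_atLeastAtMost gamma_perm_permutes]
  have reach: "?s + n \<in> orbit (gamma_perm ms) ?s" if "n < ms ! j" for n
    using that
  proof (induction n)
    case 0
    show ?case using self_in_orbit[OF finite_atLeastAtMost gamma_perm_permutes, of ?s] by simp
  next
    case (Suc n)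
    have "gamma_perm ms (?s + n) = ?s + Suc n"
      using Suc.prems by (subst gamma_perm_block[OF assms(1)]) (auto simp: block_def)
    then show ?case using orbit.step[OF Suc.IH] Suc.prems by simp
  qed
  have *: "l \<in> orbit (gamma_perm ms) ?s" if "l \<in> block ms j" for l
  proof -
    have "l - ?s < ms ! j" "?s + (l - ?s) = l" using that by (auto simp: block_def)
    then show ?thesis using reach[of "l - ?s"] by simp
  qed
  have "orbit (gamma_perm ms) k = orbit (gamma_perm ms) ?s"
    using *[OF assms(2)] by (rule orbit_eq')
  moreover have "l \<in> block ms j" if "l \<in> orbit (gamma_perm ms) k" for l
    using that by induction (auto intro: gamma_perm_in_block assms)
  ultimately show ?thesis using * by auto
qed

text \<open>The cycles are the blocks, and distinct blocks could coincide only if both were empty,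
  which positive entries of \<open>ms\<close> exclude.\<close>

lemma num_cycles_gamma_perm:
  assumes "\<And>m. m \<in> set ms \<Longrightarrow> m \<ge> 1"
  shows "card (orbit (gamma_perm ms) ` {1..sum_list ms}) = length ms"
proof -
  have ne: "block ms j \<noteq> {}" if "j < length ms" for j
    using assms[OF nth_mem[OF that]] by (simp add: block_def)
  have "orbit (gamma_perm ms) ` {1..sum_list ms} = block ms ` {..<length ms}"
  proof
    show "orbit (gamma_perm ms) ` {1..sum_list ms} \<subseteq> block ms ` {..<length ms}"
      unfolding UN_block[symmetric] using orbit_gamma_perm by auto
    show "block ms ` {..<length ms} \<subseteq> orbit (gamma_perm ms) ` {1..sum_list ms}"
    proof (rule image_subsetI)
      fix j assume j: "j \<in> {..<length ms}"
      then obtain k where k: "k \<in> block ms j" using ne by auto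
      then have "k \<in> {1..sum_list ms}" using j UN_block[of ms] by blast
      then show "block ms j \<in> orbit (gamma_perm ms) ` {1..sum_list ms}"
        using orbit_gamma_perm[of j ms k] j k by (intro image_eqI[of _ _ k]) auto
    qed
  qed
  moreover have "inj_on (block ms) {..<length ms}"
    using block_disjoint ne by (intro inj_onI) fastforce
  ultimately show ?thesis by (simp add: card_image)
qed

section \<open>Cycle counts of pairings\<close>

lemma
  assumes "\<pi> \<in> pairings S" "k \<in> S"
  shows orbit_pairing: "orbit \<pi> k = {k, \<pi> k}" and card_orbit_pairing: "card (orbit \<pi> k) = 2"
proof -
  have inv: "\<pi> (\<pi> l) = l" for l by (rule pairings_invol[OF assms(1)])
  have "l \<in> {k, \<pi> k}" if "l \<in> orbit \<pi> k" for l
    using that by induction (auto simp: inv)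
  moreover have "\<pi> k \<in> orbit \<pi> k" by (rule orbit.base)
  moreover from orbit.step[OF this] have "k \<in> orbit \<pi> k" by (simp add: inv)
  ultimately show "orbit \<pi> k = {k, \<pi> k}" by blast
  then show "card (orbit \<pi> k) = 2"
    using pairings_fixed[OF assms(1), of k] assms(2) by (auto simp: card_insert_if)
qed

text \<open>Connects the involutions used for counting with the description by two-element cycles in
  \<open>NC2\<close>.\<close>

lemma pairings_eq_card_orbit:
  "pairings S = {\<pi>. \<pi> permutes S \<and> (\<forall>k\<in>S. card (orbit \<pi> k) = 2)}"
proof (intro equalityI subsetI)
  fix \<pi> assume "\<pi> \<in> {\<pi>. \<pi> permutes S \<and> (\<forall>k\<in>S. card (orbit \<pi> k) = 2)}"
  then have \<pi>: "\<pi> permutes S" "\<And>k. k \<in> S \<Longrightarrow> card (orbit \<pi> k) = 2" by auto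
  have S: "\<pi> k \<noteq> k \<and> \<pi> (\<pi> k) = k" if "k \<in> S" for k
  proof -
    have ne: "\<pi> k \<noteq> k"
    proof
      assume "\<pi> k = k"
      then have "orbit \<pi> k = {k}" by (simp add: orbit_eq_singleton_iff)
      then show False using \<pi>(2)[OF that] by simp
    qed
    have ne2: "\<pi> (\<pi> k) \<noteq> \<pi> k" using ne permutes_inj[OF \<pi>(1)] by (auto dest: injD)
    have o1: "\<pi> k \<in> orbit \<pi> k" by (rule orbit.base)
    have o2: "\<pi> (\<pi> k) \<in> orbit \<pi> k" by (rule orbit.step[OF o1])
    have o3: "\<pi> (\<pi> (\<pi> k)) \<in> orbit \<pi> k" by (rule orbit.step[OF o2])
    have fin: "finite (orbit \<pi> k)" using \<pi>(2)[OF that] by (intro card_ge_0_finite) simp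
    have "card {\<pi> k, \<pi> (\<pi> k)} = 2" using ne2 by simp
    then have eq: "orbit \<pi> k = {\<pi> k, \<pi> (\<pi> k)}"
      using o1 o2 \<pi>(2)[OF that] fin by (intro card_subset_eq[symmetric]) auto
    \<comment> \<open>The third iterate lies in the two-element orbit and differs from the second,
      hence equals the first; injectivity then makes \<pi> an involution at
      \<open>k\<close>.\<close>
    have "\<pi> (\<pi> (\<pi> k)) \<noteq> \<pi> (\<pi> k)" using ne2 permutes_inj[OF \<pi>(1)] by (auto dest: injD)
    then have "\<pi> (\<pi> (\<pi> k)) = \<pi> k" using o3 eq by auto
    then show ?thesis using ne permutes_inj[OF \<pi>(1)] by (auto dest: injD)
  qed
  then show "\<pi> \<in> pairings S"
    unfolding pairings_def mem_Collect_eq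
  proof (intro conjI allI)
    fix k
    show "\<pi> (\<pi> k) = k" "(\<pi> k \<noteq> k) = (k \<in> S)"
      using S[of k] permutes_not_in[OF \<pi>(1), of k] by (cases "k \<in> S"; simp)+
  qed
qed (auto simp: card_orbit_pairing pairings_permutes)

lemma two_mult_card_orbits_pairing:
  assumes "\<pi> \<in> pairings S" "finite S"
  shows "2 * card (orbit \<pi> ` S) = card S"
proof -
  have inv: "\<pi> (\<pi> l) = l" for l by (rule pairings_invol[OF assms(1)])
  have U: "\<Union>(orbit \<pi> ` S) = S"
    using orbit_pairing[OF assms(1)] pairings_in_iff[OF assms(1)] by auto
  have "2 * card (orbit \<pi> ` S) = card (\<Union>(orbit \<pi> ` S))"
  proof (rule card_partition)
    fix c1 c2 assume c: "c1 \<in> orbit \<pi> ` S" "c2 \<in> orbit \<pi> ` S" "c1 \<noteq> c2"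
    then obtain k1 k2 where "c1 = orbit \<pi> k1" "c2 = orbit \<pi> k2" by auto
    then show "c1 \<inter> c2 = {}"
      using c(3) orbit_eq[OF assms(2) pairings_permutes[OF assms(1)]] by blast
  qed (use assms U card_orbit_pairing[OF assms(1)] in auto)
  then show ?thesis by (simp add: U)
qed

text \<open>The two compositions are conjugate by the involution \<pi>. The index count produces
  cycles of \<gamma> \<circ> \<pi>, whereas the genus formula counts cycles of the other
  composition.\<close>

lemma orbit_comp_swap:
  assumes "\<And>k. \<pi> (\<pi> k) = k"
  shows "orbit (\<pi> \<circ> \<gamma>) (\<pi> k) = \<pi> ` orbit (\<gamma> \<circ> \<pi>) k"
proof
  show "orbit (\<pi> \<circ> \<gamma>) (\<pi> k) \<subseteq> \<pi> ` orbit (\<gamma> \<circ> \<pi>) k"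
  proof
    fix l assume "l \<in> orbit (\<pi> \<circ> \<gamma>) (\<pi> k)"
    then show "l \<in> \<pi> ` orbit (\<gamma> \<circ> \<pi>) k"
    proof induction
      case base
      show ?case by (rule image_eqI[OF _ orbit.base]) (simp only: comp_apply)
    next
      case (step y)
      from step.IH obtain z where z: "y = \<pi> z" "z \<in> orbit (\<gamma> \<circ> \<pi>) k" by (rule imageE)
      then show ?case by (intro image_eqI[OF _ orbit.step[OF z(2)]]) (simp only: comp_apply z(1))
    qed
  qed
  show "\<pi> ` orbit (\<gamma> \<circ> \<pi>) k \<subseteq> orbit (\<pi> \<circ> \<gamma>) (\<pi> k)"
  proof (rule image_subsetI)
    fix l assume "l \<in> orbit (\<gamma> \<circ> \<pi>) k"
    then show "\<pi> l \<in> orbit (\<pi> \<circ> \<gamma>) (\<pi> k)"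
    proof induction
      case base
      have "\<pi> ((\<gamma> \<circ> \<pi>) k) = (\<pi> \<circ> \<gamma>) (\<pi> k)" by simp
      then show ?case using orbit.base by metis
    next
      case (step y)
      have "\<pi> ((\<gamma> \<circ> \<pi>) y) = (\<pi> \<circ> \<gamma>) (\<pi> y)" by simp
      then show ?case using orbit.step[OF step.IH] by metis
    qed
  qed
qed

text \<open>Compatibility says \<open>i (\<pi> k) = i (\<gamma> k)\<close> and
  \<open>i (\<gamma> (\<pi> k)) = i k\<close>, where \<gamma> is \<open>gamma_perm ms\<close>;
  replacing \<open>k\<close> by \<open>\<pi> k\<close> turns one condition into the other. So
  \<open>i\<close> amounts to a free choice of one value per cycle of \<gamma> \<circ>
  \<pi>.\<close>

lemma card_compatible_index_functions:
  assumes \<pi>: "\<pi> \<in> pairings {1..sum_list ms}"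
  shows "card {i \<in> PiE {1..sum_list ms} (\<lambda>_. {..<N}). \<forall>k\<in>{1..sum_list ms}. index_pairs ms i (\<pi> k) = prod.swap (index_pairs ms i k)}
    = N ^ card (orbit (\<pi> \<circ> gamma_perm ms) ` {1..sum_list ms})"
proof -
  let ?S = "{1..sum_list ms}" and ?\<gamma> = "gamma_perm ms"
  have inv: "\<pi> (\<pi> l) = l" and S: "\<pi> l \<in> ?S \<longleftrightarrow> l \<in> ?S" for l
    using pairings_invol[OF \<pi>] pairings_in_iff[OF \<pi>] by auto
  have p: "\<pi> permutes ?S" by (rule pairings_permutes[OF \<pi>])
  have \<gamma>\<pi>: "(?\<gamma> \<circ> \<pi>) permutes ?S" by (rule permutes_compose[OF p gamma_perm_permutes])
  have "(\<forall>k\<in>?S. index_pairs ms i (\<pi> k) = prod.swap (index_pairs ms i k)) \<longleftrightarrow> (\<forall>k\<in>?S. i ((?\<gamma> \<circ> \<pi>) k) = i k)"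
    (is "?L \<longleftrightarrow> ?R") for i
  proof
    show "?L \<Longrightarrow> ?R" by (simp add: index_pairs_def)
  next
    assume R: ?R
    show ?L
    proof
      fix k assume k: "k \<in> ?S"
      have "i (?\<gamma> (\<pi> k)) = i k" "i (?\<gamma> (\<pi> (\<pi> k))) = i (\<pi> k)"
        using R[rule_format, OF k] R[rule_format, of "\<pi> k"] k S[of k] by auto
      then show "index_pairs ms i (\<pi> k) = prod.swap (index_pairs ms i k)"
        by (simp add: index_pairs_def inv)
    qed
  qed
  then have "{i \<in> PiE ?S (\<lambda>_. {..<N}). \<forall>k\<in>?S. index_pairs ms i (\<pi> k) = prod.swap (index_pairs ms i k)}
    = {i. (\<forall>k\<in>?S. i k \<in> {..<N} \<and> i ((?\<gamma> \<circ> \<pi>) k) = i k) \<and> (\<forall>k. k \<notin> ?S \<longrightarrow> i k = undefined)}"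
    by (auto simp: PiE_def extensional_def Pi_def)
  then have count: "card {i \<in> PiE ?S (\<lambda>_. {..<N}). \<forall>k\<in>?S. index_pairs ms i (\<pi> k) = prod.swap (index_pairs ms i k)}
    = N ^ card (orbit (?\<gamma> \<circ> \<pi>) ` ?S)"
    using card_invariant_functions[OF finite_atLeastAtMost \<gamma>\<pi>, of "{..<N}" undefined] by simp
  have "orbit (\<pi> \<circ> ?\<gamma>) ` (\<pi> ` ?S) = (image \<pi>) ` (orbit (?\<gamma> \<circ> \<pi>) ` ?S)"
    using orbit_comp_swap[OF inv, of ?\<gamma>] by (simp add: image_image)
  then have "card (orbit (\<pi> \<circ> ?\<gamma>) ` ?S) = card ((image \<pi>) ` (orbit (?\<gamma> \<circ> \<pi>) ` ?S))"
    using permutes_image[OF p] by simp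
  also have "\<dots> = card (orbit (?\<gamma> \<circ> \<pi>) ` ?S)"
    using permutes_inj[OF p] by (intro card_image) (simp add: inj_on_def inj_image_eq_iff)
  finally have "card (orbit (\<pi> \<circ> ?\<gamma>) ` ?S) = card (orbit (?\<gamma> \<circ> \<pi>) ` ?S)" .
  with count show ?thesis by simp
qed

text \<open>Compatible pairings of the separate unions of blocks assemble to global pairings that
  respect \<open>P\<close>. Counting index functions for each of these gives a weight that does not
  depend on \<open>P\<close>, and this is what lets the Moebius weights be summed on their
  own.\<close>

lemma partition_prod_compatible_pairings:
  assumes P: "partition_on {..<length ms} P" and pos: "\<And>m. m \<in> set ms \<Longrightarrow> m \<ge> 1"
  shows "(\<Prod>B\<in>P. \<Sum>i\<in>PiE (\<Union>j\<in>B. block ms j) (\<lambda>_. {..<N}).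
      card (compatible_pairings (index_pairs ms i) (\<Union>j\<in>B. block ms j)))
    = (\<Sum>\<pi> | \<pi> \<in> pairings {1..sum_list ms} \<and> (\<forall>B\<in>P. \<pi> ` (\<Union>j\<in>B. block ms j) \<subseteq> (\<Union>j\<in>B. block ms j)).
        N ^ card (orbit (\<pi> \<circ> gamma_perm ms) ` {1..sum_list ms}))"
proof -
  let ?m = "sum_list ms"
  let ?b = "\<lambda>B. \<Union>j\<in>B. block ms j"
  let ?resp = "\<lambda>\<pi>. \<forall>B\<in>P. \<pi> ` ?b B \<subseteq> ?b B"
  have finP: "finite P" using finite_elements[OF _ P] by simp
  have sub: "B \<subseteq> {..<length ms}" if "B \<in> P" for B using that partition_onD1[OF P] by auto
  have fin: "finite (?b B)" if "B \<in> P" for B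
    using finite_subset[OF sub[OF that]] by (auto simp: block_def)
  have disj: "?b B \<inter> ?b C = {}" if "B \<in> P" "C \<in> P" "B \<noteq> C" for B C
  proof -
    have "B \<inter> C = {}" using partition_onD2[OF P] that by (auto simp: disjoint_def)
    then show ?thesis using block_disjoint[of _ ms] sub[OF that(1)] sub[OF that(2)] by blast
  qed
  have ne: "?b B \<noteq> {}" if B: "B \<in> P" for B
  proof -
    obtain j where j: "j \<in> B" using partition_onD3[OF P] B by (metis ex_in_conv)
    then have "j < length ms" using sub[OF B] by auto
    then have "block ms j \<noteq> {}" using pos[OF nth_mem] by (simp add: block_def)
    then show ?thesis using j by blast
  qed
  \<comment> \<open>The unions are disjoint and nonempty, so the product over \<open>P\<close> may
    be read as a product over the family of unions.\<close>
  have inj: "inj_on ?b P"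
  proof (rule inj_onI, rule ccontr)
    fix B C assume BC: "B \<in> P" "C \<in> P" "?b B = ?b C" "B \<noteq> C"
    show False using disj[OF BC(1,2,4)] ne[OF BC(1)] unfolding BC(3) by simp
  qed
  have U: "(\<Union>B\<in>P. ?b B) = {1..?m}"
  proof -
    have "(\<Union>B\<in>P. ?b B) = (\<Union>j\<in>\<Union>P. block ms j)" by blast
    then show ?thesis using partition_onD1[OF P] UN_block[of ms] by simp
  qed
  have "(\<Prod>B\<in>P. \<Sum>i\<in>PiE (?b B) (\<lambda>_. {..<N}). card (compatible_pairings (index_pairs ms i) (?b B)))
      = (\<Sum>i\<in>PiE (\<Union>B\<in>P. ?b B) (\<lambda>_. {..<N}). \<Prod>B\<in>P. card (compatible_pairings (index_pairs ms i) (?b B)))"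
  proof (rule prod_sum_PiE_UN[OF finP disj])
    fix B and f f' :: "nat \<Rightarrow> nat" assume B: "B \<in> P" and eq: "\<And>k. k \<in> ?b B \<Longrightarrow> f k = f' k"
    have "index_pairs ms f k = index_pairs ms f' k" if "k \<in> ?b B" for k
    proof -
      have "gamma_perm ms k \<in> ?b B" using that gamma_perm_in_block[of _ ms k] sub[OF B] by blast
      then show ?thesis using eq that by (simp only: index_pairs_def)
    qed
    then have "compatible_pairings (index_pairs ms f) (?b B) = compatible_pairings (index_pairs ms f') (?b B)"
      unfolding compatible_pairings_def
      by (intro Collect_cong conj_cong refl ball_cong) (simp only: pairings_in_iff)
    then show "card (compatible_pairings (index_pairs ms f) (?b B))
        = card (compatible_pairings (index_pairs ms f') (?b B))" by simp
  qed
  also have "\<dots> = (\<Sum>i\<in>PiE {1..?m} (\<lambda>_. {..<N}). card (block_compatible_pairings (index_pairs ms i) (?b ` P)))"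
  proof -
    have "card (block_compatible_pairings e (?b ` P)) = (\<Prod>B\<in>P. card (compatible_pairings e (?b B)))" for e :: "nat \<Rightarrow> nat \<times> nat"
    proof (subst card_block_compatible_pairings)
      show "disjoint (?b ` P)" using disj by (auto simp: disjoint_def)
    qed (use finP fin inj in \<open>auto simp: prod.reindex\<close>)
    then show ?thesis unfolding U by simp
  qed
  also have "\<dots> = (\<Sum>i\<in>PiE {1..?m} (\<lambda>_. {..<N}). \<Sum>\<pi> | \<pi> \<in> pairings {1..?m} \<and> ?resp \<pi>.
      if \<forall>k\<in>{1..?m}. index_pairs ms i (\<pi> k) = prod.swap (index_pairs ms i k) then 1 else 0)"
  proof (intro sum.cong refl)
    fix i
    have "block_compatible_pairings (index_pairs ms i) (?b ` P)
        = {\<pi> \<in> {\<pi>. \<pi> \<in> pairings {1..?m} \<and> ?resp \<pi>}. \<forall>k\<in>{1..?m}. index_pairs ms i (\<pi> k) = prod.swap (index_pairs ms i k)}"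
      unfolding block_compatible_pairings_def compatible_pairings_def U[symmetric] by auto
    then show "card (block_compatible_pairings (index_pairs ms i) (?b ` P))
        = (\<Sum>\<pi> | \<pi> \<in> pairings {1..?m} \<and> ?resp \<pi>.
      if \<forall>k\<in>{1..?m}. index_pairs ms i (\<pi> k) = prod.swap (index_pairs ms i k) then 1 else 0)"
      by (simp add: sum.If_cases finite_pairings Int_def)
  qed
  \<comment> \<open>Double counting: instead of the pairings compatible with an index function,
    count the index functions compatible with a pairing.\<close>
  also have "\<dots> = (\<Sum>\<pi> | \<pi> \<in> pairings {1..?m} \<and> ?resp \<pi>. \<Sum>i\<in>PiE {1..?m} (\<lambda>_. {..<N}).
      if \<forall>k\<in>{1..?m}. index_pairs ms i (\<pi> k) = prod.swap (index_pairs ms i k) then 1 else 0)"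
    by (rule sum.swap)
  also have "\<dots> = (\<Sum>\<pi> | \<pi> \<in> pairings {1..?m} \<and> ?resp \<pi>. N ^ card (orbit (\<pi> \<circ> gamma_perm ms) ` {1..?m}))"
  proof (intro sum.cong refl)
    fix \<pi> assume "\<pi> \<in> {\<pi>. \<pi> \<in> pairings {1..?m} \<and> ?resp \<pi>}"
    then have "\<pi> \<in> pairings {1..?m}" by simp
    from card_compatible_index_functions[OF this, of N]
    show "(\<Sum>i\<in>PiE {1..?m} (\<lambda>_. {..<N}).
      if \<forall>k\<in>{1..?m}. index_pairs ms i (\<pi> k) = prod.swap (index_pairs ms i k) then 1 else 0)
      = N ^ card (orbit (\<pi> \<circ> gamma_perm ms) ` {1..?m})"
      by (simp add: sum.If_cases finite_PiE Int_def)
  qed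
  finally show ?thesis .
qed

context gue_entries
begin

text \<open>Exchanging the sums over partitions and pairings leaves, for each pairing, its weight
  times the Moebius sum over the partitions it respects. The result is exact at every size.\<close>

theorem cumulant_traces:
  assumes pos: "\<And>m. m \<in> set ms \<Longrightarrow> m \<ge> 1" and ne: "ms \<noteq> []"
  shows "cumulant M (map (\<lambda>m \<omega>. Tr (X \<omega> ^\<^sub>m m)) ms)
    = (\<Sum>\<pi> | \<pi> \<in> pairings {1..sum_list ms} \<and> transitive_pair (sum_list ms) \<pi> (gamma_perm ms).
        of_nat N ^ card (orbit (\<pi> \<circ> gamma_perm ms) ` {1..sum_list ms})) / complex_of_real (sqrt N) ^ sum_list ms"
proof -
  let ?m = "sum_list ms" and ?c = "complex_of_real (sqrt N)"
  let ?b = "\<lambda>B. \<Union>j\<in>B. block ms j"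
  let ?resp = "\<lambda>\<pi> P. \<forall>B\<in>P. \<pi> ` ?b B \<subseteq> ?b B"
  let ?v = "\<lambda>\<pi>. of_nat N ^ card (orbit (\<pi> \<circ> gamma_perm ms) ` {1..?m}) :: complex"
  have finparts: "finite {P. partition_on {..<length ms} P}"
    by (rule finitely_many_partition_on) simp
  have moment: "(\<Prod>B\<in>P. expectation (\<lambda>\<omega>. \<Prod>j\<in>B. (map (\<lambda>m \<omega>. Tr (X \<omega> ^\<^sub>m m)) ms ! j) \<omega>))
      = (\<Sum>\<pi> | \<pi> \<in> pairings {1..?m} \<and> ?resp \<pi> P. ?v \<pi>) / ?c ^ ?m" if P: "partition_on {..<length ms} P" for P
  proof -
    have finP: "finite P" using finite_elements[OF _ P] by simp
    have sub: "B \<subseteq> {..<length ms}" if "B \<in> P" for B using that partition_onD1[OF P] by auto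
    have "(\<Prod>B\<in>P. expectation (\<lambda>\<omega>. \<Prod>j\<in>B. (map (\<lambda>m \<omega>. Tr (X \<omega> ^\<^sub>m m)) ms ! j) \<omega>))
        = (\<Prod>B\<in>P. of_nat (\<Sum>i\<in>PiE (?b B) (\<lambda>_. {..<N}). card (compatible_pairings (index_pairs ms i) (?b B)))
            / ?c ^ card (?b B))"
    proof (intro prod.cong refl)
      fix B assume B: "B \<in> P"
      have "expectation (\<lambda>\<omega>. \<Prod>j\<in>B. (map (\<lambda>m \<omega>. Tr (X \<omega> ^\<^sub>m m)) ms ! j) \<omega>)
          = expectation (\<lambda>\<omega>. \<Prod>j\<in>B. Tr (X \<omega> ^\<^sub>m (ms ! j)))"
        using sub[OF B] by (intro arg_cong[of _ _ expectation] ext prod.cong) auto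
      also have "\<dots> = (\<Sum>i\<in>PiE (?b B) (\<lambda>_. {..<N}). of_nat (card (compatible_pairings (index_pairs ms i) (?b B))))
          / ?c ^ card (?b B)"
        by (rule expectation_prod_traces[OF sub[OF B] pos])
      finally show "expectation (\<lambda>\<omega>. \<Prod>j\<in>B. (map (\<lambda>m \<omega>. Tr (X \<omega> ^\<^sub>m m)) ms ! j) \<omega>)
          = of_nat (\<Sum>i\<in>PiE (?b B) (\<lambda>_. {..<N}). card (compatible_pairings (index_pairs ms i) (?b B)))
            / ?c ^ card (?b B)" by simp
    qed
    also have "\<dots> = of_nat (\<Prod>B\<in>P. \<Sum>i\<in>PiE (?b B) (\<lambda>_. {..<N}). card (compatible_pairings (index_pairs ms i) (?b B)))
        / ?c ^ (\<Sum>B\<in>P. card (?b B))"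
      by (simp add: prod_dividef power_sum)
    \<comment> \<open>The blocks of \<open>P\<close> jointly use every position once, so the
      normalising factors combine to the power \<open>?m\<close> whatever \<open>P\<close>
      is.\<close>
    also have "(\<Sum>B\<in>P. card (?b B)) = card (\<Union>B\<in>P. ?b B)"
    proof (rule card_UN_disjoint[symmetric])
      show "\<forall>B\<in>P. finite (?b B)" using finite_subset[OF sub] by (auto simp: block_def)
      show "\<forall>B\<in>P. \<forall>C\<in>P. B \<noteq> C \<longrightarrow> ?b B \<inter> ?b C = {}"
      proof (intro ballI impI)
        fix B C assume BC: "B \<in> P" "C \<in> P" "B \<noteq> C"
        then have "B \<inter> C = {}" using partition_onD2[OF P] by (auto simp: disjoint_def)
        then show "?b B \<inter> ?b C = {}"
          using block_disjoint[of _ ms] sub[OF BC(1)] sub[OF BC(2)] by blast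
      qed
    qed (rule finP)
    also have "(\<Union>B\<in>P. ?b B) = {1..?m}"
    proof -
      have "(\<Union>B\<in>P. ?b B) = (\<Union>j\<in>\<Union>P. block ms j)" by blast
      then show ?thesis using partition_onD1[OF P] UN_block[of ms] by simp
    qed
    also have "card {1..?m} = ?m" by simp
    also have "(\<Prod>B\<in>P. \<Sum>i\<in>PiE (?b B) (\<lambda>_. {..<N}). card (compatible_pairings (index_pairs ms i) (?b B)))
        = (\<Sum>\<pi> | \<pi> \<in> pairings {1..?m} \<and> ?resp \<pi> P. N ^ card (orbit (\<pi> \<circ> gamma_perm ms) ` {1..?m}))"
      by (rule partition_prod_compatible_pairings[OF P pos])
    finally show ?thesis by (simp only: of_nat_sum of_nat_power)
  qed
  have "cumulant M (map (\<lambda>m \<omega>. Tr (X \<omega> ^\<^sub>m m)) ms)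
      = (\<Sum>P | partition_on {..<length ms} P. moebius_weight (card P) *
          ((\<Sum>\<pi> | \<pi> \<in> pairings {1..?m} \<and> ?resp \<pi> P. ?v \<pi>) / ?c ^ ?m))"
    unfolding cumulant_def moebius_weight_def length_map by (intro sum.cong refl) (simp add: moment)
  also have "\<dots> = (\<Sum>P | partition_on {..<length ms} P. \<Sum>\<pi>\<in>pairings {1..?m}.
      if ?resp \<pi> P then moebius_weight (card P) * ?v \<pi> / ?c ^ ?m else 0)"
  proof (intro sum.cong refl)
    fix P
    have "(\<Sum>\<pi> | \<pi> \<in> pairings {1..?m} \<and> ?resp \<pi> P. ?v \<pi>) = (\<Sum>\<pi>\<in>pairings {1..?m}. if ?resp \<pi> P then ?v \<pi> else 0)"
      by (simp add: sum.If_cases finite_pairings Int_def)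
    then show "moebius_weight (card P) * ((\<Sum>\<pi> | \<pi> \<in> pairings {1..?m} \<and> ?resp \<pi> P. ?v \<pi>) / ?c ^ ?m)
        = (\<Sum>\<pi>\<in>pairings {1..?m}. if ?resp \<pi> P then moebius_weight (card P) * ?v \<pi> / ?c ^ ?m else 0)"
      by (auto simp: sum_distrib_left sum_divide_distrib intro!: sum.cong)
  qed
  also have "\<dots> = (\<Sum>\<pi>\<in>pairings {1..?m}. \<Sum>P | partition_on {..<length ms} P.
      if ?resp \<pi> P then moebius_weight (card P) * ?v \<pi> / ?c ^ ?m else 0)"
    by (rule sum.swap)
  also have "\<dots> = (\<Sum>\<pi>\<in>pairings {1..?m}. if transitive_pair ?m \<pi> (gamma_perm ms) then ?v \<pi> / ?c ^ ?m else 0)"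
  proof (intro sum.cong refl)
    fix \<pi> assume \<pi>: "\<pi> \<in> pairings {1..?m}"
    have "(\<Sum>P | partition_on {..<length ms} P. if ?resp \<pi> P then moebius_weight (card P) * ?v \<pi> / ?c ^ ?m else 0)
        = (\<Sum>P | partition_on {..<length ms} P \<and> ?resp \<pi> P. moebius_weight (card P) * ?v \<pi> / ?c ^ ?m)"
      using finparts by (simp add: sum.If_cases Int_def)
    also have "\<dots> = (\<Sum>P | partition_on {..<length ms} P \<and> ?resp \<pi> P. moebius_weight (card P)) * (?v \<pi> / ?c ^ ?m)"
      by (simp only: sum_distrib_right sum_divide_distrib times_divide_eq_right)
    also have "\<dots> = (if transitive_pair ?m \<pi> (gamma_perm ms) then ?v \<pi> / ?c ^ ?m else 0)"
      by (subst sum_moebius_weight_respects[OF pos ne pairings_permutes[OF \<pi>] gamma_perm_permutes]) simp_all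
    finally show "(\<Sum>P | partition_on {..<length ms} P. if ?resp \<pi> P then moebius_weight (card P) * ?v \<pi> / ?c ^ ?m else 0)
        = (if transitive_pair ?m \<pi> (gamma_perm ms) then ?v \<pi> / ?c ^ ?m else 0)" .
  qed
  also have "\<dots> = (\<Sum>\<pi> | \<pi> \<in> pairings {1..?m} \<and> transitive_pair ?m \<pi> (gamma_perm ms). ?v \<pi> / ?c ^ ?m)"
    by (simp add: sum.If_cases finite_pairings Int_def)
  finally show ?thesis by (simp add: sum_divide_distrib)
qed

end

section \<open>The leading order in the matrix size\<close>

lemma transitive_pairing_genus_bound:
  assumes pos: "\<And>m. m \<in> set ms \<Longrightarrow> m \<ge> 1" and ne: "ms \<noteq> []"
    and \<pi>: "\<pi> \<in> pairings {1..sum_list ms}" and trans: "transitive_pair (sum_list ms) \<pi> (gamma_perm ms)"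
  shows "card (orbit \<pi> ` {1..sum_list ms}) + length ms + card (orbit (\<pi> \<circ> gamma_perm ms) ` {1..sum_list ms})
    \<le> sum_list ms + 2"
proof -
  let ?S = "{1..sum_list ms}"
  note p = pairings_permutes[OF \<pi>]
  \<comment> \<open>A pairing is its own inverse, so the third permutation in
    \<open>genus_bound\<close> is \<open>\<pi> \<circ> gamma_perm ms\<close>.\<close>
  have inv: "inv_into UNIV \<pi> = \<pi>"
    by (rule inv_unique_comp) (auto simp: pairings_invol[OF \<pi>])
  have "1 \<le> sum_list ms"
    by (rule order.trans[OF pos[OF hd_in_set[OF ne]] member_le_sum_list[OF hd_in_set[OF ne]]]) simp
  then have ne': "?S \<noteq> {}" by simp
  have "T = ?S" if T: "T \<subseteq> ?S" "T \<noteq> {}" "\<pi> ` T \<subseteq> T" "gamma_perm ms ` T \<subseteq> T" for T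
  proof
    obtain k where k: "k \<in> T" using T(2) by auto
    show "?S \<subseteq> T"
    proof
      fix l assume "l \<in> ?S"
      then have "linked ms \<pi> k l"
        using trans k T(1) unfolding transitive_pair_def linked_def by blast
      then show "l \<in> T"
        using linked_invariant[OF pos ne p gamma_perm_permutes, of k l T] k T(1,3,4) by simp
    qed
  qed (rule T(1))
  from genus_bound[OF finite_atLeastAtMost ne' p gamma_perm_permutes this]
  show ?thesis
    using num_cycles_gamma_perm[OF pos] inv by simp
qed

lemma NC2_eq:
  assumes "\<And>m. m \<in> set ms \<Longrightarrow> m \<ge> 1"
  shows "NC2 ms = {\<pi> \<in> pairings {1..sum_list ms}. transitive_pair (sum_list ms) \<pi> (gamma_perm ms) \<and>
    card (orbit \<pi> ` {1..sum_list ms}) + length ms + card (orbit (\<pi> \<circ> gamma_perm ms) ` {1..sum_list ms}) = sum_list ms + 2}"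
proof -
  have "inv_into UNIV \<pi> = \<pi>" if "\<pi> \<in> pairings {1..sum_list ms}" for \<pi>
    by (rule inv_unique_comp) (auto simp: pairings_invol[OF that])
  then show ?thesis
    unfolding NC2_def Let_def num_cycles_def pairings_eq_card_orbit[of "{1..sum_list ms}"]
    using num_cycles_gamma_perm[of ms, OF assms] by (intro Collect_cong) auto
qed

theorem corollary1p7:
  fixes M :: "nat \<Rightarrow> 'a measure"
    and X :: "nat \<Rightarrow> 'a \<Rightarrow> complex mat"
    and ms :: "nat list"
  assumes "\<And>N. N \<ge> 1 \<Longrightarrow> prob_space (M N)"
    and "\<And>N. N \<ge> 1 \<Longrightarrow> GUE (M N) N (X N)"
    and "length ms \<ge> 1"
    and "\<And>m. m \<in> set ms \<Longrightarrow> m \<ge> 1"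
  shows "(\<lambda>N. of_nat N powi (int (length ms) - 2) *
            cumulant (M N) (map (\<lambda>m \<omega>. Tr (X N \<omega> ^\<^sub>m m)) ms))
         \<longlonglongrightarrow> of_nat (card (NC2 ms))"
proof -
  let ?m = "sum_list ms"
  let ?T = "{\<pi>. \<pi> \<in> pairings {1..?m} \<and> transitive_pair ?m \<pi> (gamma_perm ms)}"
  define c where "c \<pi> = card (orbit (\<pi> \<circ> gamma_perm ms) ` {1..?m})" for \<pi>
  define p where "p \<pi> = card (orbit \<pi> ` {1..?m})" for \<pi>
  \<comment> \<open>The defect in the genus inequality, twice the genus in topological terms. On
    \<open>?T\<close> the truncated subtraction is a true one, by the genus bound.\<close>
  define d where "d \<pi> = ?m + 2 - (p \<pi> + length ms + c \<pi>)" for \<pi>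
  have ne: "ms \<noteq> []" using assms(3) by auto
  \<comment> \<open>As \<open>?m\<close> is twice the number of cycles of \<pi>, the normalisation
    is an integral power of \<open>N\<close>, and the total exponent is minus the defect.\<close>
  have d: "int (length ms) - 2 + int (c \<pi>) - int (p \<pi>) = - int (d \<pi>)" and m2: "?m = 2 * p \<pi>"
    if "\<pi> \<in> ?T" for \<pi>
  proof -
    have "p \<pi> + length ms + c \<pi> \<le> ?m + 2"
      using transitive_pairing_genus_bound[OF assms(4) ne] that by (simp add: p_def c_def)
    moreover show m2: "?m = 2 * p \<pi>"
      using two_mult_card_orbits_pairing[of \<pi> "{1..?m}"] that by (simp add: p_def)
    ultimately show "int (length ms) - 2 + int (c \<pi>) - int (p \<pi>) = - int (d \<pi>)"
      unfolding d_def by (simp add: of_nat_diff)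
  qed
  have eq: "of_nat N powi (int (length ms) - 2) * cumulant (M N) (map (\<lambda>m \<omega>. Tr (X N \<omega> ^\<^sub>m m)) ms)
      = (\<Sum>\<pi>\<in>?T. (1 / of_nat N) ^ d \<pi> :: complex)" if N: "N \<ge> 1" for N
  proof -
    obtain x where x: "complex_wigner (M N) N (\<lambda>n. if n = 2 then 1 else 0) x (X N)"
      "\<And>i j. i < j \<Longrightarrow> j < N \<Longrightarrow> std_complex_gaussian (M N) (x i j)"
      using assms(2)[OF N] by (auto simp: GUE_def)
    interpret prob_space "M N" by (rule assms(1)[OF N])
    interpret gue_entries "M N" N x "X N" by unfold_locales (use x in auto)
    have "of_nat N powi (int (length ms) - 2) * cumulant (M N) (map (\<lambda>m \<omega>. Tr (X N \<omega> ^\<^sub>m m)) ms)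
        = (\<Sum>\<pi>\<in>?T. of_nat N powi (int (length ms) - 2) * (of_nat N ^ c \<pi> / complex_of_real (sqrt N) ^ ?m))"
      by (subst cumulant_traces[OF assms(4) ne], assumption)
         (simp only: c_def sum_distrib_left sum_divide_distrib)
    also have "\<dots> = (\<Sum>\<pi>\<in>?T. (1 / of_nat N) ^ d \<pi>)"
    proof (intro sum.cong refl)
      fix \<pi> assume \<pi>: "\<pi> \<in> ?T"
      have N0: "(of_nat N :: complex) \<noteq> 0" using N by simp
      have "(complex_of_real (sqrt N))\<^sup>2 = of_nat N"
        by (metis of_nat_0_le_iff of_real_of_nat_eq of_real_power real_sqrt_pow2)
      then have "complex_of_real (sqrt N) ^ ?m = of_nat N ^ p \<pi>"
        unfolding m2[OF \<pi>] by (simp only: power_mult)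
      then have "of_nat N powi (int (length ms) - 2) * (of_nat N ^ c \<pi> / complex_of_real (sqrt N) ^ ?m)
          = of_nat N powi (int (length ms) - 2) * of_nat N powi int (c \<pi>) / of_nat N powi int (p \<pi>)"
        by simp
      also have "\<dots> = of_nat N powi (- int (d \<pi>))"
        unfolding d[OF \<pi>, symmetric] using N0 by (simp add: power_int_add power_int_diff)
      finally show "of_nat N powi (int (length ms) - 2) * (of_nat N ^ c \<pi> / complex_of_real (sqrt N) ^ ?m)
          = (1 / of_nat N) ^ d \<pi>"
        by (simp add: power_int_minus power_one_over divide_inverse power_inverse)
    qed
    finally show ?thesis .
  qed
  \<comment> \<open>Only pairings of defect zero survive, each with limit
    \<open>0 ^ 0 = 1\<close>.\<close>
  have "(\<lambda>N. \<Sum>\<pi>\<in>?T. (1 / of_nat N) ^ d \<pi> :: complex) \<longlonglongrightarrow> (\<Sum>\<pi>\<in>?T. if d \<pi> = 0 then 1 else 0)"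
  proof (rule tendsto_sum)
    fix \<pi>
    have "(\<lambda>N. (1 / of_nat N) ^ d \<pi> :: complex) \<longlonglongrightarrow> 0 ^ d \<pi>"
      by (intro tendsto_power lim_1_over_n)
    then show "(\<lambda>N. (1 / of_nat N) ^ d \<pi> :: complex) \<longlonglongrightarrow> (if d \<pi> = 0 then 1 else 0)"
      by (simp add: power_0_left)
  qed
  also have "(\<Sum>\<pi>\<in>?T. if d \<pi> = 0 then 1 else 0 :: complex) = of_nat (card {\<pi>\<in>?T. d \<pi> = 0})"
    using finite_pairings[of "{1..?m}"] by (simp add: sum.If_cases Int_def)
  also have "{\<pi>\<in>?T. d \<pi> = 0} = NC2 ms"
  proof -
    have "d \<pi> = 0 \<longleftrightarrow> p \<pi> + length ms + c \<pi> = ?m + 2" if "\<pi> \<in> ?T" for \<pi>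
      using transitive_pairing_genus_bound[OF assms(4) ne, of \<pi>] that
      unfolding d_def p_def c_def by simp linarith
    moreover have "NC2 ms = {\<pi> \<in> ?T. p \<pi> + length ms + c \<pi> = ?m + 2}"
      unfolding p_def c_def using NC2_eq[of ms] assms(4) by (simp add: conj_assoc)
    ultimately show ?thesis by (simp cong: conj_cong)
  qed
  \<comment> \<open>The exact formula is available for \<open>N \<ge> 1\<close>, so the two
    sequences are compared eventually.\<close>
  finally show ?thesis
    by (rule Lim_transform_eventually) (rule eventually_sequentiallyI[of 1], rule eq[symmetric])
qed

end
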